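(* Let $A\subseteq\mathrm{VF}^2$ be a definable $2$-cell. Then there are standard contractions $\widehat T_{12}$ and $\widehat R_{21}$ of $A$ (with respect to the two permutations $12$ and $21$ of $\{1,2\}$) such that there is an $\mathrm{RV}[2,\cdot]$-isomorphism $$F:(\widehat T_{12}(A),\mathrm{pr}_{\le2})\longrightarrow(\widehat R_{21}(A),\mathrm{pr}_{\le2}).$$
   Context: **Setting.** Algebraically closed nontrivially valued fields of residue characteristic $0$ are viewed in the two-sorted language $\mathcal L_{\mathrm{RV}}$: the sort $\mathrm{VF}$ (the field, ring language); the sort $\mathrm{RV}=\mathrm{VF}^\times/(1+\mathfrak m)\cup\{\infty\}$ ($\mathfrak m$ the maximal ideal of the valuation ring) with its multiplication, the subgroup of nonzero residue field elements and addition on the residue field; and the quotient map $\mathrm{rv}:\mathrm{VF}\to\mathrm{RV}$, $\mathrm{rv}(0)=\infty$. $\Gamma$ is the value group, $\mathrm{val}$ the valuation, $\mathrm{vrv}:\mathrm{RV}\to\Gamma\cup\{\infty\}$ the induced map. We work in a sufficiently saturated model of the theory with constants for a small substructure $S$ with $\Gamma(S)$ nontrivial; "definable" means definable with parameters from $S$, "$\vec a$-definable" allows extra parameters $\vec a$; $\mathrm{acl}$ is model-theoretic algebraic closure (over $S$). **$2$-cells.** An open ball of radius $\gamma\in\Gamma$ is a set $\{a:\mathrm{val}(a-b)>\gamma\}$; $\mathrm{rad}$ denotes radius. An $\mathrm{rv}$-ball is a set $\mathrm{rv}^{-1}(t)$, $t\in\mathrm{RV}$. For $A\subseteq\mathrm{VF}^2$,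 $\mathrm{fib}(A,a)=\{b:(a,b)\in A\}$. An injection $f$ between subsets of $\mathrm{VF}$ has the open-to-open property if for every subset $\mathfrak a$ of its domain, $\mathfrak a$ is an open ball iff $f(\mathfrak a)$ is. An injection $f:\mathfrak a\to\mathrm{VF}$ on an open ball is $\Gamma$-linear if there is $\gamma\in\Gamma$ with $\mathrm{val}(f(a)-f(a'))=\gamma+\mathrm{val}(a-a')$ for all $a,a'\in\mathfrak a$. If $\mathrm{pr}_1(A),\mathrm{pr}_2(A)$ are open balls and $f:\mathrm{pr}_1(A)\to\mathrm{pr}_2(A)$ is a $\Gamma$-linear bijection with the open-to-open property, $f$ is balanced in $A$ if there are $t_1,t_2\in\mathrm{RV}$ such that for each $a\in\mathrm{pr}_1(A)$: $\mathrm{fib}(A,a)=\mathrm{rv}^{-1}(t_2)+f(a)$ and $f^{-1}(\mathrm{fib}(A,a))=a-\mathrm{rv}^{-1}(t_1)$. A set $A\subseteq\mathrm{VF}^2$ is a $2$-cell if: (1) $A$ is contained in a product of two $\mathrm{rv}$-balls and $\mathrm{pr}_1(A)$ is either a point or an open ball contained in one $\mathrm{rv}$-ball; (2) there are a function $\epsilon:\mathrm{pr}_1(A)\to\mathrm{VF}$ and $t\in\mathrm{RV}$ with $\mathrm{fib}(A,a)=\mathrm{rv}^{-1}(t)+\epsilon(a)$ for each $a\in\mathrm{pr}_1(A)$; (3) either (a) $\epsilon$ is constant, or (b) $\epsilon$ is injective, has the open-to-open property, and $\mathrm{rad}(\epsilon(\mathrm{pr}_1(A)))\ge\mathrm{vrv}(t)$,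 or (c) $\epsilon$ is balanced in $A$. A $2$-cell is definable if all these ingredients are definable. **Special bijections.** An $\mathrm{rv}$-polydisc is a set $\prod_i\mathrm{rv}^{-1}(t_i)\times\{\vec s\}\subseteq\mathrm{VF}^n\times\mathrm{RV}^m$; $\mathrm{RVH}(A)$ is the union of the $\mathrm{rv}$-polydiscs meeting $A$; $A$ is an $\mathrm{RV}$-pullback if $A=\mathrm{RVH}(A)$. The canonical bijection $\mathbf c$ is $(a,t)\mapsto(a,\mathrm{rv}(a),t)$; a set is tacitly identified with its image under $\mathbf c$. For a $\mathrm{VF}$-coordinate, say the first, a definable $\mathrm{RV}$-pullback $C\subseteq\mathrm{RVH}(A)$ and a definable $\lambda:\mathrm{pr}_{>1}(C\cap A)\to\mathrm{VF}$ with graph contained in $C$ (i.e. $(\lambda(\vec y),\vec y)\in C$), the centripetal transformation is $\eta(a,\vec y)=(a-\lambda(\vec y),\vec y)$ on $C\cap A$ and the identity on $A\setminus C$. A special bijection on $A$ is a finite alternating composition $\mathbf c\circ\eta_n\circ\cdots\circ\mathbf c\circ\eta_1$ (with $\mathbf c$ first applied to $A$). **Standard contractions.** Let $A\subseteq\mathrm{VF}^n\times\mathrm{RV}^m$ be definable and $i\le n$. Choose a definable bijection $T_i$ on $A$ which does not change the coordinates of a point other than the $i$-th $\mathrm{VF}$-coordinate (apart from adding new $\mathrm{RV}$-coordinates) and such that for every $\vec a\in\mathrm{pr}_{\tilde i}(A)$ (projection to all coordinates other than the $i$-th $\mathrm{VF}$-coordinate) its restriction to $\mathrm{fib}(A,\vec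 a)\subseteq\mathrm{VF}$ is an ($\vec a$-definable) special bijection whose image is an $\mathrm{RV}$-pullback. Let $A_i=\bigcup_{\vec a}\{\vec a\}\times\mathrm{prv}(T_i(\mathrm{fib}(A,\vec a)))\subseteq\mathrm{VF}^{n-1}\times\mathrm{RV}^{m_i}$, where $\mathrm{prv}$ is projection to the $\mathrm{RV}$-coordinates (including $\mathrm{rv}$ of the $\mathrm{VF}$-coordinate), and $\widehat T_i:A\to A_i$ the induced map. For a permutation $\sigma$ of $\{1,\dots,n\}$, repeating this for the coordinates $\sigma(1),\dots,\sigma(n)$ successively gives a composite $\widehat T_\sigma:A\to\mathrm{RV}^l$, called a standard contraction of $A$ (as is its image $\widehat T_\sigma(A)$); coordinates are arranged so that the first $n$ coordinates of $\widehat T_\sigma(A)$ are the $\mathrm{rv}$-values of the $n$ (transformed) $\mathrm{VF}$-coordinates. **$\mathrm{RV}[k,\cdot]$.** Objects are pairs $(U,f)$ with $U\subseteq\mathrm{RV}^m$ and $f:U\to\mathrm{RV}^k$ definable; an isomorphism $(U,f)\to(V,g)$ is a definable bijection $F:U\to V$ such that for every $u$ the tuples $f(u),g(F(u))$ have the same number of coordinates different from $\infty$, $g(F(u))\in\mathrm{acl}(f(u))$ and $f(u)\in\mathrm{acl}(g(F(u)))$. $\mathrm{pr}_{\le2}$ is projection to the first two coordinates. *)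

theory Defs
  imports "HOL-Computational_Algebra.Polynomial"
begin

section \<open>Valued fields\<close>

datatype 'g ext_val = Fin 'g | Infty

instantiation ext_val :: (plus) plus
begin
fun plus_ext_val :: "'a ext_val \<Rightarrow> 'a ext_val \<Rightarrow> 'a ext_val" where
  "Fin a + Fin b = Fin (a + b)"
| "_ + _ = Infty"
instance ..
end

instantiation ext_val :: (linorder) linorder
begin
fun less_eq_ext_val :: "'a ext_val \<Rightarrow> 'a ext_val \<Rightarrow> bool" where
  "_ \<le> Infty \<longleftrightarrow> True"
| "Infty \<le> Fin _ \<longleftrightarrow> False"
| "Fin a \<le> Fin b \<longleftrightarrow> a \<le> b"
definition less_ext_val :: "'a ext_val \<Rightarrow> 'a ext_val \<Rightarrow> bool" where
  "x < y \<longleftrightarrow> x \<le> y \<and> \<not> y \<le> (x :: 'a ext_val)"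
instance
proof
  fix x y z :: "'a ext_val"
  show "(x < y) = (x \<le> y \<and> \<not> y \<le> x)" by (rule less_ext_val_def)
  show "x \<le> x" by (cases x) auto
  show "x \<le> y \<Longrightarrow> y \<le> z \<Longrightarrow> x \<le> z" by (cases x; cases y; cases z) auto
  show "x \<le> y \<Longrightarrow> y \<le> x \<Longrightarrow> x = y" by (cases x; cases y) auto
  show "x \<le> y \<or> y \<le> x" by (cases x; cases y) auto
qed
end

text \<open>Algebraically closed, nontrivially valued, residue characteristic 0: every positive integer
  is a unit of the valuation ring. \<^typ>\<open>'g\<close> is the value group.\<close>

definition acvf_00 ::
  "('a::alg_closed_field \<Rightarrow> 'g::linordered_ab_group_add ext_val) \<Rightarrow> bool" where
  "acvf_00 val \<longleftrightarrow>
     (\<forall>x. val x = Infty \<longleftrightarrow> x = 0) \<and>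
     (\<forall>x y. val (x * y) = val x + val y) \<and>
     (\<forall>x y. min (val x) (val y) \<le> val (x + y)) \<and>
     range val = UNIV \<and>
     (\<exists>x. x \<noteq> 0 \<and> val x \<noteq> Fin 0) \<and>
     (\<forall>n>0. val (of_nat n) = Fin 0)"


section \<open>The two-sorted language\<close>

text \<open>Variables of the two sorts are named by separate copies of \<^typ>\<open>nat\<close>; \<open>'a\<close> and \<open>'r\<close> supply
  the constants for parameters of sort VF and RV. The elements \<open>1\<close> and \<open>\<infinity>\<close> of RV are the terms
  \<open>rv 1\<close> and \<open>rv 0\<close>. Addition of the residue field, being a partial operation on RV, is a ternary
  relation symbol.\<close>

datatype (set_vt: 'a) vterm =
    VVar nat | VConst 'a | VZero | VOne | VNeg "'a vterm"
  | VAdd "'a vterm" "'a vterm" | VMul "'a vterm" "'a vterm"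

datatype ('a, 'r) rterm =
    RVar nat | RConst 'r | RMul "('a, 'r) rterm" "('a, 'r) rterm" | Rv "'a vterm"

datatype (vparams: 'a, rparams: 'r) fm =
    VEq "'a vterm" "'a vterm"
  | REq "('a, 'r) rterm" "('a, 'r) rterm"
  | ResUnit "('a, 'r) rterm"
  | ResAdd "('a, 'r) rterm" "('a, 'r) rterm" "('a, 'r) rterm"
  | Neg "('a, 'r) fm"
  | Conj "('a, 'r) fm" "('a, 'r) fm"
  | ExV nat "('a, 'r) fm"
  | ExR nat "('a, 'r) fm"

text \<open>A point of \<open>VF\<^sup>n \<times> RV\<^sup>m\<close> is a pair of lists; elements of RV are cosets, hence sets.
  A parameter set has a VF part and an RV part.\<close>

type_synonym 'a point = "'a list \<times> 'a set list"
type_synonym 'a params = "'a set \<times> 'a set set"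

definition extend_params :: "'a params \<Rightarrow> 'a point \<Rightarrow> 'a params" where
  "extend_params P p = (fst P \<union> set (fst p), snd P \<union> set (snd p))"

definition delete_at :: "nat \<Rightarrow> 'b list \<Rightarrow> 'b list" where
  "delete_at i xs = take i xs @ drop (Suc i) xs"

locale valued =
  fixes val :: "'a::field \<Rightarrow> 'g::linordered_ab_group_add ext_val"
begin

text \<open>\<open>rv x\<close> is the coset \<open>x(1 + \<mm>)\<close>; in particular \<open>\<infinity> = rv 0 = {0}\<close>.\<close>

definition rv :: "'a \<Rightarrow> 'a set" where
  "rv x = {x * (1 + e) |e. Fin 0 < val e}"

abbreviation RV_infty :: "'a set" where "RV_infty \<equiv> rv 0"

definition RV :: "'a set set" where "RV = range rv"

definition vrv :: "'a set \<Rightarrow> 'g ext_val" where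
  "vrv t = (THE g. \<exists>x. rv x = t \<and> val x = g)"

definition rv_mult :: "'a set \<Rightarrow> 'a set \<Rightarrow> 'a set" where
  "rv_mult s t = {x * y |x y. x \<in> s \<and> y \<in> t}"

definition res_units :: "'a set set" where
  "res_units = rv ` {x. val x = Fin 0}"

text \<open>The residue map on the valuation ring, with the residue field viewed as
  \<open>res_units \<union> {\<infinity>}\<close>, i.e. its zero represented by \<open>\<infinity>\<close>.\<close>

definition res :: "'a \<Rightarrow> 'a set" where
  "res x = (if val x = Fin 0 then rv x else RV_infty)"

definition res_add :: "'a set \<Rightarrow> 'a set \<Rightarrow> 'a set \<Rightarrow> bool" where
  "res_add r s t \<longleftrightarrow>
     (\<exists>x y. Fin 0 \<le> val x \<and> Fin 0 \<le> val y \<and> r = res x \<and> s = res y \<and> t = res (x + y))"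

primrec veval :: "(nat \<Rightarrow> 'a) \<Rightarrow> 'a vterm \<Rightarrow> 'a" where
  "veval e (VVar i) = e i"
| "veval e (VConst c) = c"
| "veval e VZero = 0"
| "veval e VOne = 1"
| "veval e (VNeg u) = - veval e u"
| "veval e (VAdd u v) = veval e u + veval e v"
| "veval e (VMul u v) = veval e u * veval e v"

primrec reval :: "(nat \<Rightarrow> 'a) \<Rightarrow> (nat \<Rightarrow> 'a set) \<Rightarrow> ('a, 'a set) rterm \<Rightarrow> 'a set" where
  "reval e d (RVar i) = d i"
| "reval e d (RConst c) = c"
| "reval e d (RMul s t) = rv_mult (reval e d s) (reval e d t)"
| "reval e d (Rv u) = rv (veval e u)"

primrec sat :: "(nat \<Rightarrow> 'a) \<Rightarrow> (nat \<Rightarrow> 'a set) \<Rightarrow> ('a, 'a set) fm \<Rightarrow> bool" where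
  "sat e d (VEq u v) \<longleftrightarrow> veval e u = veval e v"
| "sat e d (REq s t) \<longleftrightarrow> reval e d s = reval e d t"
| "sat e d (ResUnit t) \<longleftrightarrow> reval e d t \<in> res_units"
| "sat e d (ResAdd r s t) \<longleftrightarrow> res_add (reval e d r) (reval e d s) (reval e d t)"
| "sat e d (Neg \<phi>) \<longleftrightarrow> \<not> sat e d \<phi>"
| "sat e d (Conj \<phi> \<psi>) \<longleftrightarrow> sat e d \<phi> \<and> sat e d \<psi>"
| "sat e d (ExV i \<phi>) \<longleftrightarrow> (\<exists>a. sat (e(i := a)) d \<phi>)"
| "sat e d (ExR i \<phi>) \<longleftrightarrow> (\<exists>t\<in>RV. sat e (d(i := t)) \<phi>)"

text \<open>Free variables beyond the length of the point are read as the \<open>\<emptyset>\<close>-definable elements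
  \<open>0\<close> and \<open>\<infinity>\<close>, so they cannot smuggle in parameters.\<close>

definition holds :: "'a point \<Rightarrow> ('a, 'a set) fm \<Rightarrow> bool" where
  "holds p \<phi> \<longleftrightarrow>
     sat (\<lambda>i. if i < length (fst p) then fst p ! i else 0)
         (\<lambda>i. if i < length (snd p) then snd p ! i else RV_infty) \<phi>"

definition space :: "nat \<Rightarrow> nat \<Rightarrow> 'a point set" where
  "space n m = {(xs, rs). length xs = n \<and> length rs = m \<and> set rs \<subseteq> RV}"

definition fm_over :: "'a params \<Rightarrow> ('a, 'a set) fm \<Rightarrow> bool" where
  "fm_over P \<phi> \<longleftrightarrow> vparams \<phi> \<subseteq> fst P \<and> rparams \<phi> \<subseteq> snd P"

definition definable :: "'a params \<Rightarrow> nat \<Rightarrow> nat \<Rightarrow> 'a point set \<Rightarrow> bool" where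
  "definable P n m A \<longleftrightarrow> (\<exists>\<phi>. fm_over P \<phi> \<and> A = {p \<in> space n m. holds p \<phi>})"

definition definable_fun ::
  "'a params \<Rightarrow> nat \<Rightarrow> nat \<Rightarrow> nat \<Rightarrow> nat \<Rightarrow> 'a point set \<Rightarrow> ('a point \<Rightarrow> 'a point) \<Rightarrow> bool" where
  "definable_fun P n m n' m' A f \<longleftrightarrow>
     A \<subseteq> space n m \<and> f ` A \<subseteq> space n' m' \<and>
     definable P (n + n') (m + m') ((\<lambda>p. (fst p @ fst (f p), snd p @ snd (f p))) ` A)"

text \<open>\<open>acl_RV P ts\<close>: the tuples of RV elements algebraic over \<open>P \<union> ts\<close>.\<close>

definition acl_RV :: "'a params \<Rightarrow> 'a set list \<Rightarrow> 'a set list set" where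
  "acl_RV P ts =
     {us. \<exists>X. definable (extend_params P ([], ts)) 0 (length us) X \<and> finite X \<and> ([], us) \<in> X}"

text \<open>\<open>\<kappa>\<close>-saturation: over fewer than \<open>\<kappa>\<close> parameters, every finitely satisfiable set of formulas
  in finitely many variables of the two sorts is satisfiable.\<close>

definition saturated :: "'k rel \<Rightarrow> bool" where
  "saturated \<kappa> \<longleftrightarrow>
     (\<forall>P n m \<Phi>. snd P \<subseteq> RV \<and> (card_of (fst P), \<kappa>) \<in> ordLess \<and> (card_of (snd P), \<kappa>) \<in> ordLess \<and>
        (\<forall>\<phi>\<in>\<Phi>. fm_over P \<phi>) \<and>
        (\<forall>\<Phi>0. finite \<Phi>0 \<and> \<Phi>0 \<subseteq> \<Phi> \<longrightarrow> (\<exists>p\<in>space n m. \<forall>\<phi>\<in>\<Phi>0. holds p \<phi>))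
        \<longrightarrow> (\<exists>p\<in>space n m. \<forall>\<phi>\<in>\<Phi>. holds p \<phi>))"

definition substructure :: "'a params \<Rightarrow> bool" where
  "substructure S \<longleftrightarrow>
     0 \<in> fst S \<and> 1 \<in> fst S \<and>
     (\<forall>x\<in>fst S. \<forall>y\<in>fst S. - x \<in> fst S \<and> x + y \<in> fst S \<and> x * y \<in> fst S) \<and>
     snd S \<subseteq> RV \<and> rv ` fst S \<subseteq> snd S \<and>
     (\<forall>s\<in>snd S. \<forall>t\<in>snd S. rv_mult s t \<in> snd S \<and> (\<forall>u. res_add s t u \<longrightarrow> u \<in> snd S))"

definition Gamma_nontrivial :: "'a params \<Rightarrow> bool" where
  "Gamma_nontrivial S \<longleftrightarrow> (\<exists>t\<in>snd S. vrv t \<noteq> Infty \<and> vrv t \<noteq> Fin 0)"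


section \<open>2-cells\<close>

definition open_ball :: "'a \<Rightarrow> 'g \<Rightarrow> 'a set" where
  "open_ball b \<gamma> = {a. Fin \<gamma> < val (a - b)}"

definition is_open_ball :: "'a set \<Rightarrow> bool" where
  "is_open_ball B \<longleftrightarrow> (\<exists>b \<gamma>. B = open_ball b \<gamma>)"

definition fib :: "('a \<times> 'a) set \<Rightarrow> 'a \<Rightarrow> 'a set" where
  "fib A a = {b. (a, b) \<in> A}"

definition open_to_open :: "'a set \<Rightarrow> ('a \<Rightarrow> 'a) \<Rightarrow> bool" where
  "open_to_open D f \<longleftrightarrow> inj_on f D \<and> (\<forall>B\<subseteq>D. is_open_ball B \<longleftrightarrow> is_open_ball (f ` B))"

definition Gamma_linear :: "'a set \<Rightarrow> ('a \<Rightarrow> 'a) \<Rightarrow> bool" where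
  "Gamma_linear D f \<longleftrightarrow>
     inj_on f D \<and> (\<exists>\<gamma>. \<forall>a\<in>D. \<forall>a'\<in>D. val (f a - f a') = Fin \<gamma> + val (a - a'))"

definition balanced :: "('a \<times> 'a) set \<Rightarrow> ('a \<Rightarrow> 'a) \<Rightarrow> bool" where
  "balanced A f \<longleftrightarrow>
     is_open_ball (fst ` A) \<and> is_open_ball (snd ` A) \<and>
     bij_betw f (fst ` A) (snd ` A) \<and> Gamma_linear (fst ` A) f \<and> open_to_open (fst ` A) f \<and>
     (\<exists>t1\<in>RV. \<exists>t2\<in>RV. \<forall>a\<in>fst ` A.
        fib A a = (\<lambda>y. y + f a) ` (rv -` {t2}) \<and>
        {x \<in> fst ` A. f x \<in> fib A a} = (\<lambda>x. a - x) ` (rv -` {t1}))"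

definition two_cell_by :: "('a \<times> 'a) set \<Rightarrow> ('a \<Rightarrow> 'a) \<Rightarrow> 'a set \<Rightarrow> bool" where
  "two_cell_by A \<epsilon> t \<longleftrightarrow>
     (\<exists>s1\<in>RV. \<exists>s2\<in>RV. A \<subseteq> rv -` {s1} \<times> rv -` {s2}) \<and>
     ((\<exists>a. fst ` A = {a}) \<or> is_open_ball (fst ` A) \<and> (\<exists>s\<in>RV. fst ` A \<subseteq> rv -` {s})) \<and>
     t \<in> RV \<and> (\<forall>a\<in>fst ` A. fib A a = (\<lambda>y. y + \<epsilon> a) ` (rv -` {t})) \<and>
     ((\<exists>c. \<forall>a\<in>fst ` A. \<epsilon> a = c) \<or>
      open_to_open (fst ` A) \<epsilon> \<and> (\<exists>b \<gamma>. \<epsilon> ` fst ` A = open_ball b \<gamma> \<and> vrv t \<le> Fin \<gamma>) \<or>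
      balanced A \<epsilon>)"

text \<open>A subset of \<open>VF\<^sup>2\<close> as a set of points of \<open>VF\<^sup>2 \<times> RV\<^sup>0\<close>.\<close>

definition plane :: "('a \<times> 'a) set \<Rightarrow> 'a point set" where
  "plane A = (\<lambda>(a, b). ([a, b], [])) ` A"

text \<open>The remaining ingredients of a 2-cell (the rv-balls, \<open>t1\<close>, \<open>t2\<close> and the radii) are determined
  by \<open>A\<close> and \<open>\<epsilon>\<close>, hence definable as soon as these are.\<close>

definition definable_two_cell :: "'a params \<Rightarrow> ('a \<times> 'a) set \<Rightarrow> bool" where
  "definable_two_cell P A \<longleftrightarrow>
     definable P 2 0 (plane A) \<and>
     (\<exists>\<epsilon> t. two_cell_by A \<epsilon> t \<and> definable P 0 1 {([], [t])} \<and>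
            definable P 2 0 (plane ((\<lambda>a. (a, \<epsilon> a)) ` fst ` A)))"


section \<open>Special bijections\<close>

definition polydisc :: "'a set list \<Rightarrow> 'a set list \<Rightarrow> 'a point set" where
  "polydisc ts ss = {(xs, ss) |xs. map rv xs = ts}"

definition RVH :: "'a point set \<Rightarrow> 'a point set" where
  "RVH A = \<Union>{polydisc ts ss |ts ss. polydisc ts ss \<inter> A \<noteq> {}}"

definition RV_pullback :: "'a point set \<Rightarrow> bool" where
  "RV_pullback A \<longleftrightarrow> A = RVH A"

definition canonical :: "'a point \<Rightarrow> 'a point" where
  "canonical p = (fst p, map rv (fst p) @ snd p)"

text \<open>\<open>\<lambda>\<close> takes the coordinates of a point other than the \<open>i\<close>-th VF-coordinate. Points of the
  graph of \<open>\<lambda>\<close> are written with the value of \<open>\<lambda>\<close> in the \<open>i\<close>-th position. Coordinates are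
  counted from 0.\<close>

definition centripetal ::
  "'a params \<Rightarrow> nat \<Rightarrow> nat \<Rightarrow> 'a point set \<Rightarrow> ('a point \<Rightarrow> 'a point) \<Rightarrow> bool" where
  "centripetal P n m A \<eta> \<longleftrightarrow>
     (\<exists>i<n. \<exists>C lam.
        definable P n m C \<and> RV_pullback C \<and> C \<subseteq> RVH A \<and>
        (let G = {(xs[i := lam (delete_at i xs) rs], rs) |xs rs. (xs, rs) \<in> C \<inter> A}
         in definable P n m G \<and> G \<subseteq> C) \<and>
        (\<forall>(xs, rs)\<in>A. \<eta> (xs, rs) =
           (if (xs, rs) \<in> C then (xs[i := xs ! i - lam (delete_at i xs) rs], rs) else (xs, rs))))"

text \<open>\<open>special_bij P n m A k T\<close>: \<open>T\<close> restricts to a \<open>P\<close>-definable special bijection from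
  \<open>A \<subseteq> VF\<^sup>n \<times> RV\<^sup>m\<close> into \<open>VF\<^sup>n \<times> RV\<^sup>k\<close>. As \<open>canonical\<close> is applied first and after each
  centripetal transformation, the first \<open>n\<close> RV-coordinates of an image point are the rv-values of
  its VF-coordinates.\<close>

inductive special_bij ::
  "'a params \<Rightarrow> nat \<Rightarrow> nat \<Rightarrow> 'a point set \<Rightarrow> nat \<Rightarrow> ('a point \<Rightarrow> 'a point) \<Rightarrow> bool"
  for P n m A where
  canonical: "definable P n m A \<Longrightarrow> special_bij P n m A (n + m) canonical"
| step: "special_bij P n m A k T \<Longrightarrow> centripetal P n k (T ` A) \<eta> \<Longrightarrow>
         special_bij P n m A (n + k) (canonical \<circ> \<eta> \<circ> T)"


section \<open>Standard contractions\<close>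

text \<open>The bijection \<open>T\<^sub>i\<close> on \<open>A \<subseteq> VF\<^sup>n \<times> RV\<^sup>m\<close>. It puts \<open>k\<close> new RV-coordinates in front of the old
  ones. For \<open>(xs, rs) \<in> A\<close>, the tuple \<open>(delete_at i xs, rs)\<close> is the element of
  \<open>pr\<^sub>\<tilde>\<^sub>i(A)\<close> below it, and \<open>B\<close> is the fibre over that tuple.\<close>

definition coordinate_bij ::
  "'a params \<Rightarrow> nat \<Rightarrow> nat \<Rightarrow> nat \<Rightarrow> 'a point set \<Rightarrow> nat \<Rightarrow> ('a point \<Rightarrow> 'a point) \<Rightarrow> bool" where
  "coordinate_bij P i n m A k T \<longleftrightarrow>
     definable_fun P n m n (k + m) A T \<and> inj_on T A \<and>
     (\<forall>(xs, rs)\<in>A.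
        let B = {([b], []) |b. (xs[i := b], rs) \<in> A}
        in \<exists>T'. special_bij (extend_params P (delete_at i xs, rs)) 1 0 B k T' \<and>
                RV_pullback (T' ` B) \<and>
                (\<forall>b b' new. ([b], []) \<in> B \<and> T' ([b], []) = ([b'], new) \<longrightarrow>
                   T (xs[i := b], rs) = (xs[i := b'], new @ rs)))"

text \<open>The induced map \<open>A \<rightarrow> A\<^sub>i\<close>: forget the \<open>i\<close>-th VF-coordinate, keeping its rv-value, which is
  the first of the \<open>k\<close> new RV-coordinates. This rv-value is inserted at position \<open>p\<close> among
  the old RV-coordinates, the other new ones go to the end.\<close>

definition induced_contraction ::
  "nat \<Rightarrow> nat \<Rightarrow> nat \<Rightarrow> ('a point \<Rightarrow> 'a point) \<Rightarrow> 'a point \<Rightarrow> 'a point" where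
  "induced_contraction i p k T q =
     (let (xs, us) = T q; new = take k us; old = drop k us
      in (delete_at i xs, take p old @ hd new # drop p old @ tl new))"

text \<open>Contract the original VF-coordinates listed in the second argument one after the other, those
  in \<open>D\<close> having been contracted already. Coordinate \<open>i\<close> then sits at position \<open>i - p\<close> of the
  remaining VF-coordinates, where \<open>p\<close> counts the members of \<open>D\<close> below \<open>i\<close>. Inserting its
  rv-value at position \<open>p\<close> keeps the rv-values of the contracted coordinates at the front of the
  RV-coordinates, in increasing order of the index. A permutation \<open>\<sigma>\<close> is the list of its values,
  counted from 0, so the permutations \<open>12\<close> and \<open>21\<close> are \<open>[0, 1]\<close> and \<open>[1, 0]\<close>.\<close>

primrec successive_contraction ::
  "'a params \<Rightarrow> nat list \<Rightarrow> nat set \<Rightarrow> nat \<Rightarrow> nat \<Rightarrow> 'a point set \<Rightarrow> nat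
     \<Rightarrow> ('a point \<Rightarrow> 'a point) \<Rightarrow> bool" where
  "successive_contraction P [] D n m A l f \<longleftrightarrow> l = m \<and> (\<forall>q\<in>A. f q = q)"
| "successive_contraction P (i # is) D n m A l f \<longleftrightarrow>
     (\<exists>k T g. let p = card {j \<in> D. j < i}; h = induced_contraction (i - p) p k T
              in coordinate_bij P (i - p) n m A k T \<and>
                 successive_contraction P is (insert i D) (n - 1) (m + k) (h ` A) l g \<and>
                 (\<forall>q\<in>A. f q = g (h q)))"

definition standard_contraction ::
  "'a params \<Rightarrow> nat list \<Rightarrow> nat \<Rightarrow> nat \<Rightarrow> 'a point set \<Rightarrow> nat \<Rightarrow> ('a point \<Rightarrow> 'a set list) \<Rightarrow> bool" where
  "standard_contraction P \<sigma> n m A l f \<longleftrightarrow>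
     definable P n m A \<and> distinct \<sigma> \<and> set \<sigma> = {..<n} \<and>
     successive_contraction P \<sigma> {} n m A l (\<lambda>q. ([], f q))"


section \<open>The category \<open>RV[k,\<cdot>]\<close>\<close>

definition definable_RV_fun ::
  "'a params \<Rightarrow> nat \<Rightarrow> nat \<Rightarrow> 'a set list set \<Rightarrow> ('a set list \<Rightarrow> 'a set list) \<Rightarrow> bool" where
  "definable_RV_fun P m m' U f \<longleftrightarrow> definable_fun P 0 m 0 m' (Pair [] ` U) (\<lambda>q. ([], f (snd q)))"

definition RV_object ::
  "'a params \<Rightarrow> nat \<Rightarrow> nat \<Rightarrow> 'a set list set \<Rightarrow> ('a set list \<Rightarrow> 'a set list) \<Rightarrow> bool" where
  "RV_object P k m U f \<longleftrightarrow> definable P 0 m (Pair [] ` U) \<and> definable_RV_fun P m k U f"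

definition RV_iso ::
  "'a params \<Rightarrow> nat \<Rightarrow> nat \<Rightarrow> 'a set list set \<Rightarrow> ('a set list \<Rightarrow> 'a set list)
     \<Rightarrow> nat \<Rightarrow> 'a set list set \<Rightarrow> ('a set list \<Rightarrow> 'a set list)
     \<Rightarrow> ('a set list \<Rightarrow> 'a set list) \<Rightarrow> bool" where
  "RV_iso P k m U f m' V g F \<longleftrightarrow>
     RV_object P k m U f \<and> RV_object P k m' V g \<and>
     definable_RV_fun P m m' U F \<and> bij_betw F U V \<and>
     (\<forall>u\<in>U.
        length (filter (\<lambda>t. t \<noteq> RV_infty) (f u)) = length (filter (\<lambda>t. t \<noteq> RV_infty) (g (F u))) \<and>
        g (F u) \<in> acl_RV P (f u) \<and> f u \<in> acl_RV P (g (F u)))"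

end

end

theory Submission
  imports Defs
begin

text \<open>Translating a ball by a suitable centre turns it into a union of rv-balls, and this is the only
  kind of special bijection that occurs below. If \<open>A = B1 \<times> B2\<close> is a product of open balls or
  points, each coordinate is translated by a centre of its ball. Neither translation depends on the
  other coordinate, so both orders of contraction lead to the same set, up to the order of its
  constant RV-coordinates. By the condition on the radius in the definition of a 2-cell, every
  2-cell that is not balanced is such a product.
  
  If \<open>A\<close> is balanced by \<open>f\<close>, it consists of the points \<open>(x, y)\<close> of \<open>B1 \<times> B2\<close> with
  \<open>rv (x - f\<^sup>-\<^sup>1 y) = t1\<close>, and equally of those with \<open>rv (y - f x) = t2\<close>. Contracting the first
  coordinate along \<open>f\<^sup>-\<^sup>1 y\<close> leaves \<open>{t1} \<times> B2\<close>, contracting the second one along \<open>f x\<close> leaves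
  \<open>B1 \<times> {t2}\<close>. It remains to match the contractions of \<open>B2\<close> and \<open>B1\<close>. If \<open>B1\<close> contains a
  definable point \<open>\<mu>\<close>, the balls are centred at \<open>\<mu>\<close> and \<open>f \<mu>\<close>; as \<open>f\<close> multiplies distances by a
  constant, it induces a definable bijection between the sets of values \<open>rv (x - \<mu>)\<close> and
  \<open>rv (y - f \<mu>)\<close>. Otherwise \<open>B2\<close> contains no definable point either, and both balls contract to a
  single element of RV (\<open>isomorphic_contractions_balanced\<close>).
  
  What makes this work over parameters from RV is that every definable open ball has a definable
  centre: a definable point in the smallest closed ball around it (\<open>definable_point_near_ball\<close>).
  This rests on elimination of the quantifiers over the field (\<open>formula_rv_determined\<close>): the
  truth of a formula depends on its field variables only through the values \<open>rv (g e)\<close> of finitely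
  many polynomials \<open>g\<close> over its field parameters. If none of these polynomials had a root in the
  closed ball, the formula could not separate the open ball from the points next to it; so there is
  a root, and the average of the roots in the closed ball is definable.
  
  The elimination itself is a statement about one polynomial. Let its coefficients vary with a
  parameter \<open>e\<close>, and let two values of \<open>e\<close> agree in the sense that certain polynomials in the
  coefficients have the same image in RV. Then the roots for the two values can be matched in such a
  way that prescribed polynomials take values with the same image in RV
  (\<open>root_matching\<close>). For this the coefficients of a norm form are compared, which are
  symmetric functions of the roots (\<open>matching_of_symsums\<close>). A point that is not a root is
  transported by a translation along with the root next to it (\<open>point_matching\<close>).\<close>

section \<open>Estimates in a valued field\<close>

locale acvf = valued val
  for val :: "'a::alg_closed_field \<Rightarrow> 'g::linordered_ab_group_add ext_val" +
  assumes acvf: "acvf_00 val"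
begin

lemma val_eq_Infty [simp]: "val x = Infty \<longleftrightarrow> x = 0"
  and val_mult: "val (x * y) = val x + val y"
  and val_add: "min (val x) (val y) \<le> val (x + y)"
  and val_surj: "\<exists>x. val x = v"
  and val_of_nat: "n > 0 \<Longrightarrow> val (of_nat n) = Fin 0"
  using acvf unfolding acvf_00_def by (auto simp: surj_def) (metis surjD)

text \<open>Estimates are made between elements of the field rather than between values: \<open>x \<preceq> y\<close> says
  that \<open>y\<close> divides \<open>x\<close> over the valuation ring. Bounds multiply with the elements, so no
  arithmetic of values is required.\<close>

definition vle :: "'a \<Rightarrow> 'a \<Rightarrow> bool" (infix \<open>\<preceq>\<close> 50) where
  "x \<preceq> y \<longleftrightarrow> val y \<le> val x"

definition vlt :: "'a \<Rightarrow> 'a \<Rightarrow> bool" (infix \<open>\<prec>\<close> 50) where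
  "x \<prec> y \<longleftrightarrow> val y < val x"

lemma vle_refl [simp]: "x \<preceq> x"
  and vlt_irrefl [simp]: "\<not> x \<prec> x"
  and vle_trans: "x \<preceq> y \<Longrightarrow> y \<preceq> z \<Longrightarrow> x \<preceq> z"
  and vlt_vle_trans: "x \<prec> y \<Longrightarrow> y \<preceq> z \<Longrightarrow> x \<prec> z"
  and vle_vlt_trans: "x \<preceq> y \<Longrightarrow> y \<prec> z \<Longrightarrow> x \<prec> z"
  and vlt_imp_vle: "x \<prec> y \<Longrightarrow> x \<preceq> y"
  and not_vle_iff: "\<not> x \<preceq> y \<longleftrightarrow> y \<prec> x"
  and not_vlt_iff: "\<not> x \<prec> y \<longleftrightarrow> y \<preceq> x"
  unfolding vle_def vlt_def by auto

lemma ext_val_le_Infty [simp]: "v \<le> Infty" for v :: "'g ext_val"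
  by (cases v) auto

lemma Infty_le_iff [simp]: "Infty \<le> v \<longleftrightarrow> v = Infty" for v :: "'g ext_val"
  by (cases v) auto

lemma less_Infty_iff [simp]: "v < Infty \<longleftrightarrow> v \<noteq> Infty" for v :: "'g ext_val"
  by (cases v) (auto simp: less_le)

lemma Fin_less_Fin [simp]: "Fin a < Fin b \<longleftrightarrow> a < (b :: 'g)"
  by (auto simp: less_ext_val_def)

lemma val_0 [simp]: "val 0 = Infty"
  by simp

lemma zero_vle [simp]: "0 \<preceq> x"
  and vle_zero_iff [simp]: "x \<preceq> 0 \<longleftrightarrow> x = 0"
  and zero_vlt_iff [simp]: "0 \<prec> x \<longleftrightarrow> x \<noteq> 0"
  and not_vlt_zero [simp]: "\<not> x \<prec> 0"
  unfolding vle_def vlt_def by (auto simp: not_less)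

lemma val_nonzero: "x \<noteq> 0 \<Longrightarrow> \<exists>g. val x = Fin g"
  by (metis ext_val.exhaust val_eq_Infty)

lemma val_1 [simp]: "val 1 = Fin 0"
  using val_of_nat[of 1] by simp

lemma val_uminus [simp]: "val (- x) = val x"
proof -
  obtain g where g: "val (- 1) = Fin g"
    using val_nonzero[of "- 1"] by auto
  have "Fin (g + g) = (Fin 0 :: 'g ext_val)"
    using val_mult[of "- 1" "- 1"] g by simp
  hence "g = 0" by simp
  with g have "val (- 1) = Fin 0" by simp
  thus ?thesis
    using val_mult[of "- 1" x] by (cases "val x") auto
qed

lemma vle_uminus [simp]: "- x \<preceq> y \<longleftrightarrow> x \<preceq> y" "x \<preceq> - y \<longleftrightarrow> x \<preceq> y"
  and vlt_uminus [simp]: "- x \<prec> y \<longleftrightarrow> x \<prec> y" "x \<prec> - y \<longleftrightarrow> x \<prec> y"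
  unfolding vle_def vlt_def by auto

lemma vle_add: "x \<preceq> z \<Longrightarrow> y \<preceq> z \<Longrightarrow> x + y \<preceq> z"
  unfolding vle_def using val_add[of x y] by (meson min.boundedI order_trans)

lemma vlt_add: "x \<prec> z \<Longrightarrow> y \<prec> z \<Longrightarrow> x + y \<prec> z"
  unfolding vlt_def using val_add[of x y] by (meson min_less_iff_conj order.strict_trans2)

lemma vle_diff: "x \<preceq> z \<Longrightarrow> y \<preceq> z \<Longrightarrow> x - y \<preceq> z"
  using vle_add[of x z "- y"] by simp

lemma vlt_diff: "x \<prec> z \<Longrightarrow> y \<prec> z \<Longrightarrow> x - y \<prec> z"
  using vlt_add[of x z "- y"] by simp

lemma vle_mult_cancel: "z \<noteq> 0 \<Longrightarrow> x * z \<preceq> y * z \<longleftrightarrow> x \<preceq> y"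
  unfolding vle_def val_mult using val_nonzero[of z]
  by (cases "val x"; cases "val y") auto

lemma vlt_mult_cancel: "z \<noteq> 0 \<Longrightarrow> x * z \<prec> y * z \<longleftrightarrow> x \<prec> y"
  using vle_mult_cancel by (simp flip: not_vle_iff)

lemma vle_mult: "x \<preceq> y \<Longrightarrow> x' \<preceq> y' \<Longrightarrow> x * x' \<preceq> y * y'"
  unfolding vle_def val_mult
  by (cases "val x"; cases "val y"; cases "val x'"; cases "val y'") (auto intro: add_mono)

lemma vlt_vle_mult: "x \<prec> y \<Longrightarrow> x' \<preceq> y' \<Longrightarrow> y' \<noteq> 0 \<Longrightarrow> x * x' \<prec> y * y'"
  by (metis mult.commute vle_mult vle_refl vle_vlt_trans vlt_mult_cancel)

lemma vle_sum: "(\<And>i. i \<in> I \<Longrightarrow> f i \<preceq> z) \<Longrightarrow> sum f I \<preceq> z"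
  by (induction I rule: infinite_finite_induct) (auto intro: vle_add)

lemma vlt_sum: "z \<noteq> 0 \<Longrightarrow> (\<And>i. i \<in> I \<Longrightarrow> f i \<prec> z) \<Longrightarrow> sum f I \<prec> z"
  by (induction I rule: infinite_finite_induct) (auto intro: vlt_add)

lemma vle_prod: "(\<And>i. i \<in> I \<Longrightarrow> f i \<preceq> g i) \<Longrightarrow> prod f I \<preceq> prod g I"
  by (induction I rule: infinite_finite_induct) (auto intro: vle_mult)

lemma vle_of_nat: "of_nat n \<preceq> 1"
  by (cases "n = 0") (simp_all add: vle_def val_of_nat)

lemma one_vle_of_nat: "n > 0 \<Longrightarrow> 1 \<preceq> of_nat n"
  by (simp add: vle_def val_of_nat)

lemma of_nat_neq_0: "n > 0 \<Longrightarrow> (of_nat n :: 'a) \<noteq> 0"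
  using val_of_nat[of n] by auto

lemma val_add_dominated: "x \<prec> y \<Longrightarrow> val (x + y) = val y"
proof (rule antisym)
  assume *: "x \<prec> y"
  hence "\<not> val y < val (x + y)"
    using vlt_diff[of "x + y" y x] by (auto simp: vlt_def)
  thus "val (x + y) \<le> val y" by simp
  show "val y \<le> val (x + y)"
    using vle_add[of x y y] * vlt_imp_vle by (auto simp: vle_def)
qed

lemma vle_total: "x \<preceq> y \<or> y \<preceq> x"
  unfolding vle_def by auto

lemma rv_eq_iff: "rv x = rv y \<longleftrightarrow> x = y \<or> x - y \<prec> x"
proof -
  have mem: "z \<in> rv x \<longleftrightarrow> z = x \<or> z - x \<prec> x" for z x
  proof
    assume "z \<in> rv x"
    then obtain e where e: "z = x * (1 + e)" "Fin 0 < val e"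
      by (auto simp: rv_def)
    hence "z - x = e * x" "e \<prec> 1" by (auto simp: algebra_simps vlt_def)
    thus "z = x \<or> z - x \<prec> x"
      using vlt_mult_cancel[of x e 1] by (cases "x = 0") auto
  next
    assume *: "z = x \<or> z - x \<prec> x"
    show "z \<in> rv x"
    proof (cases "z = x")
      case True
      have "z = x * (1 + 0)" "Fin 0 < val 0"
        using True by (auto simp del: less_Infty_iff simp add: less_ext_val_def)
      thus ?thesis unfolding rv_def by blast
    next
      case False
      hence "x \<noteq> 0" "z - x \<prec> x" using * by auto
      moreover from this have "(z - x) / x * x \<prec> 1 * x" by simp
      ultimately have "(z - x) / x \<prec> 1" using vlt_mult_cancel by blast
      moreover have "z = x * (1 + (z - x) / x)" using \<open>x \<noteq> 0\<close> by (simp add: field_simps)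
      ultimately show ?thesis unfolding rv_def vlt_def by auto
    qed
  qed
  have close: "val y = val x" if "x - y \<prec> x" for x y
    using val_add_dominated[of "y - x" x] that
    by (metis add.commute diff_add_cancel minus_diff_eq vlt_uminus(1))
  have sub: "rv x \<subseteq> rv y" if "x = y \<or> x - y \<prec> x" for x y
  proof
    fix z assume "z \<in> rv x"
    hence "z = x \<or> z - x \<prec> x" by (simp add: mem)
    thus "z \<in> rv y"
    proof (cases "x = y")
      case False
      hence *: "x - y \<prec> x" using that by auto
      hence "x - y \<prec> y" using close[OF *] by (simp add: vlt_def)
      moreover from \<open>z = x \<or> z - x \<prec> x\<close> have "z = x \<or> z - x \<prec> y"
        using close[OF *] by (simp add: vlt_def)
      moreover have "z - y = (z - x) + (x - y)" by simp
      ultimately show ?thesis using vlt_add mem by metis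
    qed (simp add: mem)
  qed
  show ?thesis
  proof
    assume "rv x = rv y"
    hence "y \<in> rv x" using mem by blast
    thus "x = y \<or> x - y \<prec> x" using mem by (metis minus_diff_eq vlt_uminus(1))
  next
    assume *: "x = y \<or> x - y \<prec> x"
    hence "y = x \<or> y - x \<prec> y"
      using close[of x y] by (metis minus_diff_eq vlt_def vlt_uminus(1))
    thus "rv x = rv y" using sub[of x y] sub[of y x] * by auto
  qed
qed

lemma val_cong_rv: "rv x = rv y \<Longrightarrow> val x = val y"
  using val_add_dominated[of "y - x" x] unfolding rv_eq_iff
  by (metis diff_add_cancel minus_diff_eq vlt_uminus(1))

lemma rv_eq_zero_iff [simp]: "rv x = rv 0 \<longleftrightarrow> x = 0" "rv 0 = rv x \<longleftrightarrow> x = 0"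
  using val_cong_rv by (metis val_eq_Infty)+

lemma rv_mult_eqI: "rv x = rv y \<Longrightarrow> rv (x * z) = rv (y * z)"
  unfolding rv_eq_iff using vlt_mult_cancel[of z "x - y" x]
  by (cases "z = 0") (auto simp: algebra_simps)

lemma rv_mult_cong: "rv x = rv y \<Longrightarrow> rv x' = rv y' \<Longrightarrow> rv (x * x') = rv (y * y')"
  by (metis mult.commute rv_mult_eqI)

lemma rv_power_cong: "rv x = rv y \<Longrightarrow> rv (x ^ n) = rv (y ^ n)"
proof (induction n)
  case (Suc n)
  thus ?case using rv_mult_cong[OF Suc.prems, of "x ^ n" "y ^ n"] by simp
qed simp

lemma rv_mult_cancel:
  assumes "z \<noteq> 0"
  shows "rv (x * z) = rv (y * z) \<longleftrightarrow> rv x = rv y"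
proof
  assume "rv (x * z) = rv (y * z)"
  thus "rv x = rv y" using rv_mult_eqI[of "x * z" "y * z" "inverse z"] assms by (simp add: mult.assoc)
qed (rule rv_mult_eqI)

lemma rv_inverse_cong: "rv x = rv y \<Longrightarrow> rv (inverse x) = rv (inverse y)"
proof (cases "x = 0 \<or> y = 0")
  case False
  assume "rv x = rv y"
  moreover have "inverse x * (x * y) = y" "inverse y * (x * y) = x" using False by auto
  ultimately show ?thesis
    using False rv_mult_cancel[of "x * y" "inverse x" "inverse y"] by (metis mult_eq_0_iff)
qed auto

lemma rv_diff_vlt: "rv x = rv y \<Longrightarrow> x \<noteq> y \<Longrightarrow> y - x \<prec> y"
  using rv_eq_iff[of y x] by auto

lemma splits_into_roots:
  fixes p :: "'a poly"
  assumes "p \<noteq> 0"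
  shows "\<exists>Z. p = smult (lead_coeff p) (\<Prod>z\<in>#Z. [:-z, 1:]) \<and> (\<forall>z\<in>#Z. poly p z = 0)"
proof -
  obtain Z where Z: "p = smult (lead_coeff p) (\<Prod>z\<in>#Z. [:-z, 1:])"
    using alg_closed_imp_factorization[OF assms] by blast
  have "poly p z = 0" if "z \<in># Z" for z
  proof -
    have "poly (\<Prod>z\<in>#Z. [:-z, 1:]) z = 0"
      using that by (induction Z) auto
    thus ?thesis using Z by (metis mult_zero_right poly_smult)
  qed
  with Z show ?thesis by blast
qed

lemma rv_poly_cong:
  fixes p :: "'a poly"
  assumes "\<And>r. poly p r = 0 \<Longrightarrow> rv (x - r) = rv (y - r)"
  shows "rv (poly p x) = rv (poly p y)"
proof (cases "p = 0")
  case False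
  obtain Z where Z: "p = smult (lead_coeff p) (\<Prod>z\<in>#Z. [:-z, 1:])"
    and rts: "\<And>z. z \<in># Z \<Longrightarrow> poly p z = 0"
    using splits_into_roots[OF False] by blast
  have "rv (poly (\<Prod>z\<in>#Z. [:-z, 1:]) x) = rv (poly (\<Prod>z\<in>#Z. [:-z, 1:]) y)"
    using rts
  proof (induction Z)
    case (add z Z)
    hence "rv ((x - z) * poly (\<Prod>z\<in>#Z. [:-z, 1:]) x) = rv ((y - z) * poly (\<Prod>z\<in>#Z. [:-z, 1:]) y)"
      by (intro rv_mult_cong assms) auto
    thus ?case by (simp add: algebra_simps)
  qed simp
  from rv_mult_cong[OF refl this, of "lead_coeff p"]
  show ?thesis by (metis Z poly_smult)
qed simp

text \<open>Gauss's lemma for a product of linear factors: each factor bounds both of its terms, and bounds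
  multiply. The estimate excludes cancellation among the terms of \<^term>\<open>poly p t\<close>.\<close>

lemma coeff_vle_poly:
  fixes p :: "'a poly"
  assumes "p \<noteq> 0" and "\<And>r. poly p r = 0 \<Longrightarrow> w \<preceq> t - r \<and> r \<preceq> t - r"
  shows "coeff p i * w ^ i \<preceq> poly p t"
proof -
  obtain Z where Z: "p = smult (lead_coeff p) (\<Prod>z\<in>#Z. [:-z, 1:])"
    and rts: "\<And>z. z \<in># Z \<Longrightarrow> poly p z = 0"
    using splits_into_roots[OF assms(1)] by blast
  have "coeff (\<Prod>z\<in>#Z. [:-z, 1:]) i * w ^ i \<preceq> poly (\<Prod>z\<in>#Z. [:-z, 1:]) t"
    using rts
  proof (induction Z arbitrary: i)
    case empty
    show ?case by (cases "i = 0") (auto simp: coeff_1)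
  next
    case (add z Z)
    define q where "q = (\<Prod>z\<in>#Z. [:-z, 1:])"
    have IH: "coeff q i * w ^ i \<preceq> poly q t" for i
      using add unfolding q_def by auto
    have b: "w \<preceq> t - z" "z \<preceq> t - z" using assms(2)[of z] add.prems[of z] by auto
    have "z * (coeff q i * w ^ i) \<preceq> (t - z) * poly q t"
      using IH[of i] b by (intro vle_mult)
    moreover have "(case i of 0 \<Rightarrow> 0 | Suc j \<Rightarrow> coeff q j) * w ^ i \<preceq> (t - z) * poly q t"
      using vle_mult[OF b(1) IH[of "i - 1"]] by (cases i) (auto simp: ac_simps)
    ultimately have "(case i of 0 \<Rightarrow> 0 | Suc j \<Rightarrow> coeff q j) * w ^ i - z * (coeff q i * w ^ i)
        \<preceq> (t - z) * poly q t"
      by (rule vle_diff[rotated])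
    moreover have "coeff ([:-z, 1:] * q) i * w ^ i
        = (case i of 0 \<Rightarrow> 0 | Suc j \<Rightarrow> coeff q j) * w ^ i - z * (coeff q i * w ^ i)"
      by (cases i) (auto simp: algebra_simps)
    moreover have "poly ([:-z, 1:] * q) t = (t - z) * poly q t"
      by (simp add: algebra_simps)
    ultimately show ?case by (simp add: q_def)
  qed
  hence "lead_coeff p * (coeff (\<Prod>z\<in>#Z. [:-z, 1:]) i * w ^ i) \<preceq> lead_coeff p * poly (\<Prod>z\<in>#Z. [:-z, 1:]) t"
    by (intro vle_mult) auto
  moreover have "coeff p i = lead_coeff p * coeff (\<Prod>z\<in>#Z. [:-z, 1:]) i"
    by (metis Z coeff_smult)
  moreover have "poly p t = lead_coeff p * poly (\<Prod>z\<in>#Z. [:-z, 1:]) t"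
    by (metis Z poly_smult)
  ultimately show ?thesis by (metis mult.assoc)
qed

text \<open>As the residue field has characteristic \<open>0\<close>, the natural numbers have distinct residues, so
  some natural number avoids the residues of all roots of finitely many polynomials.\<close>

lemma generic_nat:
  assumes "finite I"
  shows "\<exists>m. \<forall>i\<in>I. \<forall>k\<le>n. y i k \<preceq> (\<Sum>k\<le>n. of_nat m ^ k * y i k)"
proof -
  define p where "p i = Poly (map (y i) [0..<Suc n])" for i
  have cp: "coeff (p i) k = (if k \<le> n then y i k else 0)" for i k
    by (auto simp: p_def nth_default_def coeff_Poly_eq simp del: upt_Suc)
  have pp: "poly (p i) x = (\<Sum>k\<le>n. x ^ k * y i k)" for i x
  proof -
    have "degree (p i) \<le> n" by (rule degree_le) (auto simp: cp)
    hence "poly (p i) x = (\<Sum>k\<le>n. coeff (p i) k * x ^ k)"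
      unfolding poly_altdef
      by (intro sum.mono_neutral_left) (simp_all add: coeff_eq_0)
    also have "\<dots> = (\<Sum>k\<le>n. x ^ k * y i k)"
      by (intro sum.cong) (auto simp: cp)
    finally show ?thesis .
  qed
  define R where "R = (\<Union>i\<in>{i\<in>I. p i \<noteq> 0}. {r. poly (p i) r = 0})"
  have "finite R" unfolding R_def using assms by (auto intro: poly_roots_finite)
  define bad where "bad = (\<Union>r\<in>R. {m. r - of_nat m \<prec> 1})"
  have "finite {m. r - of_nat m \<prec> 1}" for r
  proof -
    have *: "m = m'" if "r - of_nat m \<prec> 1" "r - of_nat m' \<prec> 1" "m \<le> m'" for m m'
    proof (rule ccontr)
      assume "m \<noteq> m'"
      hence "1 \<preceq> of_nat (m' - m)" using that(3) by (intro one_vle_of_nat) auto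
      moreover have "(of_nat (m' - m) :: 'a) = (r - of_nat m) - (r - of_nat m')"
        using that(3) by (simp add: of_nat_diff)
      ultimately show False using vlt_diff[OF that(1,2)] not_vle_iff by metis
    qed
    have "m = m'" if "r - of_nat m \<prec> 1" "r - of_nat m' \<prec> 1" for m m'
      using *[of m m'] *[of m' m] that by (cases "m \<le> m'") auto
    hence "{m. r - of_nat m \<prec> 1} = {} \<or> (\<exists>m0. {m. r - of_nat m \<prec> 1} = {m0})"
      by blast
    thus ?thesis by (metis finite.emptyI finite.insertI)
  qed
  hence "finite bad" using \<open>finite R\<close> unfolding bad_def by auto
  then obtain m where m: "m \<notin> bad" using ex_new_if_finite[OF infinite_UNIV_nat] by blast
  have "y i k \<preceq> (\<Sum>k\<le>n. of_nat m ^ k * y i k)" if "i \<in> I" "k \<le> n" for i k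
  proof (cases "p i = 0")
    case True
    hence "y i k = 0" using cp[of i k] that by auto
    thus ?thesis by simp
  next
    case False
    have "coeff (p i) k * 1 ^ k \<preceq> poly (p i) (of_nat m)"
    proof (rule coeff_vle_poly[OF False])
      fix r assume "poly (p i) r = 0"
      hence "r \<in> R" using False that by (auto simp: R_def)
      hence "\<not> r - of_nat m \<prec> 1"
        using m unfolding bad_def by blast
      hence "\<not> of_nat m - r \<prec> 1" using vlt_uminus(1)[of "of_nat m - r"] by simp
      hence 1: "1 \<preceq> of_nat m - r" by (simp add: not_vlt_iff)
      moreover have "r \<preceq> of_nat m - r"
        using vle_diff[OF vle_trans[OF vle_of_nat 1], of "of_nat m - r" m] by simp
      ultimately show "1 \<preceq> of_nat m - r \<and> r \<preceq> of_nat m - r" by simp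
    qed
    thus ?thesis using that by (simp add: cp pp)
  qed
  thus ?thesis by blast
qed

end

section \<open>Matching finite families by symmetric functions\<close>

text \<open>A sum over injective assignments of indices below \<open>N\<close> to the members of the list. For \<open>N\<close> members
  it is the permanent of the matrix of their values; for equal members it is an elementary symmetric
  function up to a factorial.\<close>

definition symsum :: "nat \<Rightarrow> (nat \<Rightarrow> 'a::field) list \<Rightarrow> 'a" where
  "symsum N ys =
     (\<Sum>is | set is \<subseteq> {..<N} \<and> length is = length ys \<and> distinct is. \<Prod>j<length ys. (ys ! j) (is ! j))"

lemma finite_distinct_lists: "finite {is. set is \<subseteq> {..<N::nat} \<and> length is = r \<and> distinct is}"
  by (rule finite_subset[OF _ finite_lists_length_eq[of "{..<N}" r]]) auto

lemma symsum_Nil: "symsum N [] = 1"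
proof -
  have "{is. set is \<subseteq> {..<N} \<and> length is = length ([] :: (nat \<Rightarrow> 'a) list) \<and> distinct is} = {[]}"
    by auto
  thus ?thesis by (simp add: symsum_def)
qed

text \<open>The index assigned to \<open>y\<close> is first chosen freely. The choices that collide with the index of
  some member \<open>ys ! s\<close> are then subtracted; in these \<open>y\<close> is absorbed into that member.\<close>

lemma symsum_Cons:
  "symsum N (y # ys) = (\<Sum>i<N. y i) * symsum N ys
     - (\<Sum>s<length ys. symsum N (ys[s := (\<lambda>i. (ys ! s) i * y i)]))"
proof -
  define D where "D r = {is. set is \<subseteq> {..<N} \<and> length is = r \<and> distinct is}" for r
  define r where "r = length ys"
  define P where "P is = (\<Prod>j<r. (ys ! j) (is ! j))" for "is"
  have finD: "finite (D k)" for k unfolding D_def by (rule finite_distinct_lists)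
  have upd: "(\<Prod>j<r. (ys[s := (\<lambda>i. (ys ! s) i * y i)] ! j) (is ! j)) = P is * y (is ! s)"
    if "s < r" for s "is"
  proof -
    have "(\<Prod>j<r. (ys[s := (\<lambda>i. (ys ! s) i * y i)] ! j) (is ! j))
        = (\<Prod>j<r. (ys ! j) (is ! j) * (if j = s then y (is ! s) else 1))"
      using that by (intro prod.cong) (auto simp: r_def nth_list_update)
    also have "\<dots> = P is * y (is ! s)"
      using that by (simp add: prod.distrib P_def)
    finally show ?thesis .
  qed
  have "symsum N (y # ys) = (\<Sum>is\<in>D (Suc r). \<Prod>j<Suc r. ((y # ys) ! j) (is ! j))"
    by (simp add: symsum_def D_def r_def)
  also have "\<dots> = (\<Sum>(is, i)\<in>(SIGMA is : D r. {..<N} - set is). P is * y i)"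
    by (intro sum.reindex_bij_witness[of _ "\<lambda>(is, i). i # is" "\<lambda>is. (tl is, hd is)"])
      (auto simp: D_def P_def prod.lessThan_Suc_shift length_Suc_conv mult.commute
        simp del: prod.lessThan_Suc)
  also have "\<dots> = (\<Sum>is\<in>D r. \<Sum>i\<in>{..<N} - set is. P is * y i)"
    by (intro sum.Sigma[symmetric] finD ballI) auto
  also have "\<dots> = (\<Sum>is\<in>D r. (\<Sum>i<N. y i) * P is - (\<Sum>s<r. P is * y (is ! s)))"
  proof (rule sum.cong[OF refl])
    fix "is" assume "is \<in> D r"
    hence *: "set is \<subseteq> {..<N}" "length is = r" "distinct is" by (auto simp: D_def)
    have "(\<Sum>i\<in>set is. y i) = (\<Sum>s<r. y (is ! s))"
      using *(2,3) by (simp add: sum.distinct_set_conv_list sum_list_sum_nth atLeast0LessThan)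
    hence "(\<Sum>i\<in>{..<N} - set is. y i) = (\<Sum>i<N. y i) - (\<Sum>s<r. y (is ! s))"
      using *(1) by (simp add: sum_diff)
    thus "(\<Sum>i\<in>{..<N} - set is. P is * y i) = (\<Sum>i<N. y i) * P is - (\<Sum>s<r. P is * y (is ! s))"
      by (simp only: sum_distrib_left[symmetric]) (simp only: algebra_simps)
  qed
  also have "\<dots> = (\<Sum>i<N. y i) * (\<Sum>is\<in>D r. P is) - (\<Sum>s<r. \<Sum>is\<in>D r. P is * y (is ! s))"
    by (subst sum.swap) (simp add: sum_subtractf sum_distrib_left)
  also have "(\<Sum>s<r. \<Sum>is\<in>D r. P is * y (is ! s))
      = (\<Sum>s<r. symsum N (ys[s := (\<lambda>i. (ys ! s) i * y i)]))"
  proof (rule sum.cong[OF refl])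
    fix s assume "s \<in> {..<r}"
    thus "(\<Sum>is\<in>D r. P is * y (is ! s)) = symsum N (ys[s := (\<lambda>i. (ys ! s) i * y i)])"
      using upd by (simp add: symsum_def D_def r_def)
  qed
  also have "(\<Sum>is\<in>D r. P is) = symsum N ys"
    by (simp add: symsum_def D_def r_def P_def)
  finally show ?thesis by (simp add: r_def)
qed

lemma sum_lists_prod:
  fixes f :: "'k \<Rightarrow> 'i \<Rightarrow> 'b::comm_semiring_1"
  assumes "finite K"
  shows "(\<Sum>\<kappa> | set \<kappa> \<subseteq> K \<and> length \<kappa> = length is. \<Prod>j<length is. f (\<kappa> ! j) (is ! j))
           = (\<Prod>j<length is. \<Sum>k\<in>K. f k (is ! j))"
proof (induction "is")
  case Nil
  have "{\<kappa>. set \<kappa> \<subseteq> K \<and> length \<kappa> = length []} = {[]}" by auto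
  thus ?case by simp
next
  case (Cons i "is")
  define C where "C = {\<kappa>. set \<kappa> \<subseteq> K \<and> length \<kappa> = length is}"
  have finC: "finite C" unfolding C_def by (rule finite_lists_length_eq[OF assms])
  have "(\<Sum>\<kappa> | set \<kappa> \<subseteq> K \<and> length \<kappa> = length (i # is). \<Prod>j<length (i # is). f (\<kappa> ! j) ((i # is) ! j))
      = (\<Sum>(k, \<kappa>)\<in>K \<times> C. f k i * (\<Prod>j<length is. f (\<kappa> ! j) (is ! j)))"
    by (intro sum.reindex_bij_witness[of _ "\<lambda>(k, \<kappa>). k # \<kappa>" "\<lambda>\<kappa>. (hd \<kappa>, tl \<kappa>)"])
      (auto simp: C_def prod.lessThan_Suc_shift length_Suc_conv simp del: prod.lessThan_Suc)
  also have "\<dots> = (\<Sum>k\<in>K. f k i) * (\<Sum>\<kappa>\<in>C. \<Prod>j<length is. f (\<kappa> ! j) (is ! j))"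
    by (simp add: sum_product sum.cartesian_product)
  also have "\<dots> = (\<Prod>j<length (i # is). \<Sum>k\<in>K. f k ((i # is) ! j))"
    using Cons by (simp add: C_def prod.lessThan_Suc_shift del: prod.lessThan_Suc)
  finally show ?case .
qed

lemma prod_nth_permutation:
  assumes "set is \<subseteq> {..<N}" "length is = N" "distinct is"
  shows "(\<Prod>j<N. f (is ! j)) = (\<Prod>i<N. f i)"
proof -
  have "set is = {..<N}"
  proof (rule card_subset_eq[OF _ assms(1)])
    show "card (set is) = card {..<N}" using distinct_card[OF assms(3)] assms(2) by simp
  qed simp
  hence "bij_betw ((!) is) {..<N} {..<N}"
    by (intro bij_betw_nth assms(3)) (simp_all add: assms(2))
  thus ?thesis by (rule prod.reindex_bij_betw)
qed

text \<open>Permanents are the coefficients of the product of \<open>N\<close> linear forms, up to the factor \<open>N!\<close>.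
  Indexing them by words \<open>\<kappa>\<close> instead of exponents avoids collecting equal monomials.\<close>

lemma prod_linear_forms:
  fixes x :: "nat \<Rightarrow> nat \<Rightarrow> 'a::field"
  shows "(\<Sum>\<kappa> | set \<kappa> \<subseteq> {..n} \<and> length \<kappa> = N. symsum N (map x \<kappa>) * (\<Prod>j<N. u (\<kappa> ! j)))
           = of_nat (fact N) * (\<Prod>i<N. \<Sum>k\<le>n. u k * x k i)"
proof -
  define K where "K = {\<kappa>. set \<kappa> \<subseteq> {..n} \<and> length \<kappa> = N}"
  define D where "D = {is. set is \<subseteq> {..<N} \<and> length is = N \<and> distinct is}"
  have "(\<Sum>\<kappa>\<in>K. symsum N (map x \<kappa>) * (\<Prod>j<N. u (\<kappa> ! j)))
      = (\<Sum>\<kappa>\<in>K. \<Sum>is\<in>D. \<Prod>j<N. u (\<kappa> ! j) * x (\<kappa> ! j) (is ! j))"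
  proof (rule sum.cong[OF refl])
    fix \<kappa> assume "\<kappa> \<in> K"
    hence "length \<kappa> = N" by (simp add: K_def)
    thus "symsum N (map x \<kappa>) * (\<Prod>j<N. u (\<kappa> ! j))
        = (\<Sum>is\<in>D. \<Prod>j<N. u (\<kappa> ! j) * x (\<kappa> ! j) (is ! j))"
      by (simp add: symsum_def D_def sum_distrib_left prod.distrib mult.commute)
  qed
  also have "\<dots> = (\<Sum>is\<in>D. \<Sum>\<kappa>\<in>K. \<Prod>j<N. u (\<kappa> ! j) * x (\<kappa> ! j) (is ! j))"
    by (rule sum.swap)
  also have "\<dots> = (\<Sum>is\<in>D. \<Prod>i<N. \<Sum>k\<le>n. u k * x k i)"
  proof (rule sum.cong[OF refl])
    fix "is" assume "is \<in> D"
    hence *: "set is \<subseteq> {..<N}" "length is = N" "distinct is" by (auto simp: D_def)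
    have "(\<Sum>\<kappa>\<in>K. \<Prod>j<N. u (\<kappa> ! j) * x (\<kappa> ! j) (is ! j)) = (\<Prod>j<N. \<Sum>k\<le>n. u k * x k (is ! j))"
      using sum_lists_prod[of "{..n}" "\<lambda>k i. u k * x k i" "is"] *(2) by (simp add: K_def)
    thus "(\<Sum>\<kappa>\<in>K. \<Prod>j<N. u (\<kappa> ! j) * x (\<kappa> ! j) (is ! j)) = (\<Prod>i<N. \<Sum>k\<le>n. u k * x k i)"
      using prod_nth_permutation[OF *, of "\<lambda>i. \<Sum>k\<le>n. u k * x k i"] by simp
  qed
  also have "card D = fact N"
  proof -
    have "card D = \<Prod>{card {..<N} - N + 1..card {..<N}}"
      unfolding D_def using card_lists_distinct_length_eq[of "{..<N}" N]
      by (simp add: conj_ac)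
    thus ?thesis by (simp add: fact_prod)
  qed
  hence "(\<Sum>is\<in>D. \<Prod>i<N. \<Sum>k\<le>n. u k * x k i) = of_nat (fact N) * (\<Prod>i<N. \<Sum>k\<le>n. u k * x k i)"
    by simp
  finally show ?thesis by (simp add: K_def)
qed

text \<open>The coefficients of the reversed polynomial are the elementary symmetric functions with their
  signs, so that Newton's identities need none.\<close>

lemma newton_identity:
  fixes xs :: "'a::field list" and k :: nat
  defines "g \<equiv> coeff (prod_list (map (\<lambda>x. [:1, -x:]) xs))"
  assumes "k > 0"
  shows "of_nat k * g k + (\<Sum>i=1..k. g (k - i) * sum_list (map (\<lambda>x. x ^ i) xs)) = 0"
  using assms(2) unfolding g_def
proof (induction xs arbitrary: k)
  case Nil
  thus ?case by (cases k) auto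
next
  case (Cons x xs)
  define g where "g = coeff (prod_list (map (\<lambda>x. [:1, -x:]) xs))"
  define p where "p i = sum_list (map (\<lambda>x. x ^ i) xs)" for i
  obtain l where k: "k = Suc l" using Cons.prems gr0_conv_Suc by blast
  define h where "h j = (case j of 0 \<Rightarrow> 0 | Suc i \<Rightarrow> g i)" for j
  have g': "coeff (prod_list (map (\<lambda>x. [:1, -x:]) (x # xs))) j = g j - x * h j" for j
    by (cases j) (auto simp: g_def h_def)
  have IH: "of_nat j * g j + (\<Sum>i=1..j. g (j - i) * p i) = 0" if "j > 0" for j
    using Cons.IH[OF that] by (simp add: g_def p_def)
  have IH': "of_nat l * g l + (\<Sum>i=1..l. g (l - i) * p i) = 0"
    using IH[of l] by (cases "l = 0") auto
  have h: "(\<Sum>i=1..k. h (k - i) * t i) = (\<Sum>i=1..l. g (l - i) * t i)" for t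
  proof -
    have "(\<Sum>i=1..k. h (k - i) * t i) = (\<Sum>i=1..l. h (k - i) * t i)"
      by (simp add: k h_def)
    also have "\<dots> = (\<Sum>i=1..l. g (l - i) * t i)"
      by (intro sum.cong) (auto simp: k h_def Suc_diff_le)
    finally show ?thesis .
  qed
  have tel: "(\<Sum>i=1..k. g (k - i) * x ^ i) = x * g l + x * (\<Sum>i=1..l. g (l - i) * x ^ i)"
  proof -
    have "(\<Sum>i=1..k. g (k - i) * x ^ i) = (\<Sum>i=0..l. g (l - i) * x ^ Suc i)"
      unfolding k One_nat_def by (subst sum.shift_bounds_cl_Suc_ivl) simp
    also have "\<dots> = x * g l + (\<Sum>i=1..l. g (l - i) * x ^ Suc i)"
      by (subst sum.atLeast_Suc_atMost) auto
    finally show ?thesis by (simp add: sum_distrib_left mult_ac)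
  qed
  have "(\<Sum>i=1..k. (g (k - i) - x * h (k - i)) * (x ^ i + p i))
      = (\<Sum>i=1..k. g (k - i) * x ^ i) + (\<Sum>i=1..k. g (k - i) * p i)
        - x * ((\<Sum>i=1..k. h (k - i) * x ^ i) + (\<Sum>i=1..k. h (k - i) * p i))"
    by (simp add: sum.distrib[symmetric] sum_subtractf[symmetric] sum_distrib_left algebra_simps)
  also have "\<dots> = x * g l + (\<Sum>i=1..k. g (k - i) * p i) - x * (\<Sum>i=1..l. g (l - i) * p i)"
    unfolding h tel by (simp add: algebra_simps)
  finally have "of_nat k * (g k - x * h k) + (\<Sum>i=1..k. (g (k - i) - x * h (k - i)) * (x ^ i + p i))
      = (of_nat k * g k + (\<Sum>i=1..k. g (k - i) * p i))
        - x * (of_nat l * g l + (\<Sum>i=1..l. g (l - i) * p i))"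
    by (simp add: k h_def algebra_simps)
  hence "of_nat k * (g k - x * h k) + (\<Sum>i=1..k. (g (k - i) - x * h (k - i)) * (x ^ i + p i)) = 0"
    using IH[OF Cons.prems] IH' by simp
  thus ?case unfolding g' p_def by simp
qed

context acvf
begin

lemma ex_dominating_multiplier:
  assumes "finite V" "0 \<notin> V"
  shows "\<exists>w. w \<noteq> 0 \<and> (\<forall>v\<in>V. 1 \<preceq> w * v)"
  using assms
proof (induction V)
  case empty
  show ?case by (rule exI[of _ 1]) auto
next
  case (insert v V)
  then obtain w where w: "w \<noteq> 0" "\<And>v'. v' \<in> V \<Longrightarrow> 1 \<preceq> w * v'" and v: "v \<noteq> 0" by auto
  show ?case
  proof (cases "inverse v \<preceq> w")
    case True
    hence "1 \<preceq> w * v" using vle_mult[OF True vle_refl[of v]] v by simp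
    thus ?thesis using w by auto
  next
    case False
    hence le: "w \<preceq> inverse v" using vle_total by blast
    have "1 \<preceq> inverse v * v'" if "v' \<in> V" for v'
      using vle_trans[OF w(2)[OF that] vle_mult[OF le vle_refl]] .
    thus ?thesis using v by (intro exI[of _ "inverse v"]) auto
  qed
qed

text \<open>Write \<open>N\<^sub>x(u) = \<Prod>i. \<Sum>k. u k * x k i\<close>. Up to the unit \<open>N!\<close>, its coefficients are the symmetric
  sums in the hypothesis, so the coefficients of \<open>N\<^sub>x\<close> and \<open>N\<^sub>x'\<close> differ by less than their size.
  At a zero \<open>u\<close> of the factor of index \<open>i0\<close> we have \<open>N\<^sub>x(u) = 0\<close>, so \<open>N\<^sub>x'(u)\<close> has to be smaller than
  its largest term. Suppose that no index \<open>j\<close> matches \<open>i0\<close>. Then for a generic zero \<open>u\<close>, scaled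
  such that the entries \<open>u k * x k i0\<close> are units, there is no cancellation in any factor of
  \<open>N\<^sub>x'(u)\<close>, so that \<open>N\<^sub>x'(u)\<close> is as large as its largest term, a contradiction.\<close>

theorem matching_of_symsums:
  fixes x x' :: "nat \<Rightarrow> nat \<Rightarrow> 'a"
  assumes rv_symsum: "\<And>\<kappa>. set \<kappa> \<subseteq> {..n} \<Longrightarrow> length \<kappa> = N \<Longrightarrow>
      rv (symsum N (map x \<kappa>)) = rv (symsum N (map x' \<kappa>))"
    and one: "\<And>i. x 0 i = 1" "\<And>i. x' 0 i = 1"
    and i0: "i0 < N"
  shows "\<exists>j<N. \<forall>k\<le>n. rv (x' k j) = rv (x k i0)"
proof (rule ccontr)
  assume "\<not> ?thesis"
  hence unmatched: "\<exists>k\<le>n. rv (x' k j) \<noteq> rv (x k i0)" if "j < N" for j using that by blast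
  have "finite ((\<lambda>(k, j). x' k j) ` ({..n} \<times> {..<N}) - {0})" by auto
  from ex_dominating_multiplier[OF this] obtain w where
    w: "w \<noteq> 0" "\<And>k j. k \<le> n \<Longrightarrow> j < N \<Longrightarrow> x' k j \<noteq> 0 \<Longrightarrow> 1 \<preceq> w * x' k j"
    by auto
  \<comment> \<open>The scale of the variable \<open>u k\<close>. Where \<open>x k i0 = 0\<close> it is so large that every nonzero \<open>x' k j\<close> counts as different from it.\<close>
  define s where "s k = (if x k i0 = 0 then w else inverse (x k i0))" for k
  have s0: "s k \<noteq> 0" for k using w(1) by (auto simp: s_def)
  have sx: "s k * x k i0 \<preceq> 1" for k by (auto simp: s_def)
  define y where "y j k = s k * (x' k j - x k i0)" for j k
  obtain m where m: "\<And>j k. j < N \<Longrightarrow> k \<le> n \<Longrightarrow> y j k \<preceq> (\<Sum>k\<le>n. of_nat m ^ k * y j k)"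
    using generic_nat[of "{..<N}" n y] by auto
  define L where "L j = (\<Sum>k\<le>n. of_nat m ^ k * y j k)" for j
  have oneL: "1 \<preceq> L j" if j: "j < N" for j
  proof -
    obtain k where k: "k \<le> n" "rv (x' k j) \<noteq> rv (x k i0)" using unmatched[OF j] by blast
    have "1 \<preceq> y j k"
    proof (cases "x k i0 = 0")
      case True
      thus ?thesis using k w(2)[OF k(1) j] by (auto simp: y_def s_def)
    next
      case False
      have "\<not> x k i0 - x' k j \<prec> x k i0" using k(2) rv_eq_iff[of "x k i0" "x' k j"] by auto
      hence "x k i0 \<preceq> x' k j - x k i0" by (metis minus_diff_eq not_vlt_iff vle_uminus(2))
      from vle_mult[OF this vle_refl[of "s k"]] show ?thesis
        using False by (simp add: y_def s_def mult.commute)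
    qed
    thus ?thesis using m[OF j k(1)] vle_trans L_def by metis
  qed
  hence L0: "L j \<noteq> 0" if "j < N" for j using that by force
  have sxL: "x' k j * s k \<preceq> L j" if "j < N" "k \<le> n" for j k
  proof -
    have "x' k j * s k = y j k + s k * x k i0" by (simp add: y_def algebra_simps)
    thus ?thesis
      using vle_add[OF m[OF that, folded L_def] vle_trans[OF sx oneL[OF that(1)]]] by simp
  qed
  \<comment> \<open>The variable of index \<open>0\<close>, whose coefficient is \<open>1\<close>, is used to make the form of index \<open>i0\<close> vanish.\<close>
  define u where "u k = of_nat m ^ k * s k
      - (if k = 0 then \<Sum>l\<le>n. of_nat m ^ l * (s l * x l i0) else 0)" for k
  have pow: "of_nat m ^ k \<preceq> 1" for k using vle_of_nat[of "m ^ k"] by simp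
  have us: "u k \<preceq> s k" for k
  proof -
    have 1: "of_nat m ^ k * s k \<preceq> s k" using vle_mult[OF pow vle_refl[of "s k"]] by simp
    have "(\<Sum>l\<le>n. of_nat m ^ l * (s l * x l i0)) \<preceq> 1"
      using vle_mult[OF pow sx] by (intro vle_sum) simp
    moreover have "s 0 = 1" by (simp add: s_def one)
    ultimately show ?thesis using 1 unfolding u_def by (intro vle_diff) auto
  qed
  have form: "(\<Sum>k\<le>n. u k * z k) = (\<Sum>k\<le>n. of_nat m ^ k * (s k * (z k - x k i0)))"
    if "z 0 = 1" for z
  proof -
    have "(\<Sum>k\<le>n. (if k = 0 then \<Sum>l\<le>n. of_nat m ^ l * (s l * x l i0) else 0) * z k)
        = (\<Sum>k\<le>n. if k = 0 then \<Sum>l\<le>n. of_nat m ^ l * (s l * x l i0) else 0)"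
      using that by (intro sum.cong) auto
    also have "\<dots> = (\<Sum>l\<le>n. of_nat m ^ l * (s l * x l i0))" by simp
    finally show ?thesis
      by (simp add: u_def left_diff_distrib right_diff_distrib sum_subtractf mult_ac)
  qed
  define \<Pi> where "\<Pi> = (\<Prod>i<N. L i)"
  have \<Pi>0: "\<Pi> \<noteq> 0" using L0 by (auto simp: \<Pi>_def)
  define K where "K = {\<kappa>. set \<kappa> \<subseteq> {..n} \<and> length \<kappa> = N}"
  have small: "(symsum N (map x' \<kappa>) - symsum N (map x \<kappa>)) * (\<Prod>j<N. u (\<kappa> ! j)) \<prec> \<Pi>"
    if "\<kappa> \<in> K" for \<kappa>
  proof -
    have \<kappa>: "set \<kappa> \<subseteq> {..n}" "length \<kappa> = N" using that by (auto simp: K_def)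
    have bound: "symsum N (map x' \<kappa>) * (\<Prod>j<N. s (\<kappa> ! j)) \<preceq> \<Pi>"
      unfolding symsum_def sum_distrib_right
    proof (rule vle_sum)
      fix "is" assume "is \<in> {is. set is \<subseteq> {..<N} \<and> length is = length (map x' \<kappa>) \<and> distinct is}"
      hence "is": "set is \<subseteq> {..<N}" "length is = N" "distinct is" using \<kappa> by auto
      have "(\<Prod>j<N. x' (\<kappa> ! j) (is ! j) * s (\<kappa> ! j)) \<preceq> (\<Prod>j<N. L (is ! j))"
      proof (rule vle_prod)
        fix j assume "j \<in> {..<N}"
        hence "is ! j \<in> set is" "\<kappa> ! j \<in> set \<kappa>" using "is"(2) \<kappa>(2) by auto
        hence "is ! j < N" "\<kappa> ! j \<le> n" using "is"(1) \<kappa>(1) by auto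
        thus "x' (\<kappa> ! j) (is ! j) * s (\<kappa> ! j) \<preceq> L (is ! j)" by (rule sxL)
      qed
      also have "(\<Prod>j<N. L (is ! j)) = \<Pi>"
        unfolding \<Pi>_def by (rule prod_nth_permutation[OF "is"])
      finally show "(\<Prod>j<length (map x' \<kappa>). (map x' \<kappa> ! j) (is ! j)) * (\<Prod>j<N. s (\<kappa> ! j)) \<preceq> \<Pi>"
        using \<kappa> by (simp add: prod.distrib)
    qed
    show ?thesis
    proof (cases "symsum N (map x \<kappa>) = symsum N (map x' \<kappa>)")
      case False
      have "symsum N (map x' \<kappa>) - symsum N (map x \<kappa>) \<prec> symsum N (map x' \<kappa>)"
        using rv_diff_vlt[OF rv_symsum[OF \<kappa>] False] .
      hence "(symsum N (map x' \<kappa>) - symsum N (map x \<kappa>)) * (\<Prod>j<N. u (\<kappa> ! j))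
          \<prec> symsum N (map x' \<kappa>) * (\<Prod>j<N. s (\<kappa> ! j))"
        by (rule vlt_vle_mult[OF _ vle_prod]) (simp_all add: us s0)
      thus ?thesis using bound by (rule vlt_vle_trans)
    qed (simp add: \<Pi>0)
  qed
  have "(\<Sum>\<kappa>\<in>K. (symsum N (map x' \<kappa>) - symsum N (map x \<kappa>)) * (\<Prod>j<N. u (\<kappa> ! j)))
      = of_nat (fact N) * (\<Prod>i<N. \<Sum>k\<le>n. u k * x' k i) - of_nat (fact N) * (\<Prod>i<N. \<Sum>k\<le>n. u k * x k i)"
    unfolding K_def by (simp only: left_diff_distrib sum_subtractf prod_linear_forms)
  also have "(\<Prod>i<N. \<Sum>k\<le>n. u k * x k i) = 0"
  proof -
    have "(\<Sum>k\<le>n. u k * x k i0) = 0" by (subst form) (simp_all add: one)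
    thus ?thesis using i0 by (intro prod_zero) auto
  qed
  also have "(\<Prod>i<N. \<Sum>k\<le>n. u k * x' k i) = \<Pi>"
    unfolding \<Pi>_def
  proof (rule prod.cong[OF refl])
    fix i
    show "(\<Sum>k\<le>n. u k * x' k i) = L i" by (subst form) (simp_all only: one L_def y_def)
  qed
  finally have "(\<Sum>\<kappa>\<in>K. (symsum N (map x' \<kappa>) - symsum N (map x \<kappa>)) * (\<Prod>j<N. u (\<kappa> ! j)))
      = of_nat (fact N) * \<Pi>" by (simp only: mult_zero_right diff_zero)
  hence "of_nat (fact N) * \<Pi> \<prec> \<Pi>"
    using vlt_sum[OF \<Pi>0 small, of K "\<lambda>\<kappa>. \<kappa>"] by simp
  moreover have "\<Pi> \<preceq> of_nat (fact N) * \<Pi>"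
    using vle_mult[OF one_vle_of_nat[OF fact_gt_zero] vle_refl[of \<Pi>]] by (simp only: mult_1_left)
  ultimately have "\<Pi> \<prec> \<Pi>" by (rule vle_vlt_trans[rotated])
  thus False by simp
qed

end

section \<open>Roots of families of polynomials\<close>

text \<open>Quantities that depend polynomially on parameters \<open>e\<close> are represented by functions of \<open>e\<close>; a
  function algebra plays the role of the ring of all such quantities.\<close>

definition function_algebra :: "('e \<Rightarrow> 'a::field) set \<Rightarrow> bool" where
  "function_algebra R \<longleftrightarrow>
     (\<forall>n. (\<lambda>_. of_nat n) \<in> R) \<and>
     (\<forall>f\<in>R. \<forall>g\<in>R. (\<lambda>e. f e + g e) \<in> R \<and> (\<lambda>e. f e * g e) \<in> R) \<and>
     (\<forall>f\<in>R. (\<lambda>e. - f e) \<in> R)"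

lemma function_algebraD:
  assumes "function_algebra R"
  shows fa_of_nat: "(\<lambda>_. of_nat n) \<in> R"
    and fa_add: "f \<in> R \<Longrightarrow> g \<in> R \<Longrightarrow> (\<lambda>e. f e + g e) \<in> R"
    and fa_mult: "f \<in> R \<Longrightarrow> g \<in> R \<Longrightarrow> (\<lambda>e. f e * g e) \<in> R"
    and fa_uminus: "f \<in> R \<Longrightarrow> (\<lambda>e. - f e) \<in> R"
  using assms unfolding function_algebra_def by auto

lemma fa_zero: "function_algebra R \<Longrightarrow> (\<lambda>_. 0) \<in> R"
  and fa_one: "function_algebra R \<Longrightarrow> (\<lambda>_. 1) \<in> R"
  using fa_of_nat[of R 0] fa_of_nat[of R 1] by auto

lemma fa_diff: "function_algebra R \<Longrightarrow> f \<in> R \<Longrightarrow> g \<in> R \<Longrightarrow> (\<lambda>e. f e - g e) \<in> R"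
  using fa_add[of R f "\<lambda>e. - g e"] fa_uminus[of R g] by simp

lemma fa_sum:
  "function_algebra R \<Longrightarrow> (\<And>i. i \<in> I \<Longrightarrow> f i \<in> R) \<Longrightarrow> (\<lambda>e. \<Sum>i\<in>I. f i e) \<in> R"
  by (induction I rule: infinite_finite_induct) (auto intro: fa_zero fa_add)

lemma fa_power: "function_algebra R \<Longrightarrow> f \<in> R \<Longrightarrow> (\<lambda>e. f e ^ n) \<in> R"
  by (induction n) (auto intro: fa_one fa_mult)

definition poly_family :: "('e \<Rightarrow> 'a::field) set \<Rightarrow> ('e \<Rightarrow> 'a poly) set" where
  "poly_family R = {p. (\<exists>d. \<forall>e. degree (p e) \<le> d) \<and> (\<forall>i. (\<lambda>e. coeff (p e) i) \<in> R)}"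

lemma poly_family_const: "function_algebra R \<Longrightarrow> f \<in> R \<Longrightarrow> (\<lambda>e. [:f e:]) \<in> poly_family R"
proof -
  assume R: "function_algebra R" "f \<in> R"
  have "(\<lambda>e. coeff [:f e:] i) \<in> R" for i
    using R fa_zero[OF R(1)] by (cases i) auto
  thus ?thesis by (auto simp: poly_family_def)
qed

lemma poly_family_one: "function_algebra R \<Longrightarrow> (\<lambda>e. 1) \<in> poly_family R"
  using poly_family_const[of R "\<lambda>_. 1"] by (simp add: fa_one one_pCons)

lemma poly_family_X: "function_algebra R \<Longrightarrow> (\<lambda>e. [:0, 1:]) \<in> poly_family R"
  unfolding poly_family_def
  by (auto simp: coeff_pCons fa_zero fa_one split: nat.split)

lemma poly_family_add:
  assumes "function_algebra R" "p \<in> poly_family R" "q \<in> poly_family R"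
  shows "(\<lambda>e. p e + q e) \<in> poly_family R"
proof -
  obtain d d' where "\<And>e. degree (p e) \<le> d" "\<And>e. degree (q e) \<le> d'"
    using assms by (auto simp: poly_family_def)
  hence "degree (p e + q e) \<le> max d d'" for e
    by (meson degree_add_le max.coboundedI1 max.coboundedI2)
  thus ?thesis using assms by (auto simp: poly_family_def intro: fa_add)
qed

lemma poly_family_uminus:
  assumes "function_algebra R" "p \<in> poly_family R"
  shows "(\<lambda>e. - p e) \<in> poly_family R"
  using assms by (auto simp: poly_family_def intro: fa_uminus)

lemma poly_family_mult:
  assumes "function_algebra R" "p \<in> poly_family R" "q \<in> poly_family R"
  shows "(\<lambda>e. p e * q e) \<in> poly_family R"
proof -
  obtain d d' where "\<And>e. degree (p e) \<le> d" "\<And>e. degree (q e) \<le> d'"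
    using assms by (auto simp: poly_family_def)
  hence "degree (p e * q e) \<le> d + d'" for e
    by (meson add_mono degree_mult_le order_trans)
  thus ?thesis using assms
    by (auto simp: poly_family_def coeff_mult intro!: fa_sum fa_mult)
qed

lemma poly_family_prod:
  "function_algebra R \<Longrightarrow> (\<And>p. p \<in> J \<Longrightarrow> f p \<in> poly_family R) \<Longrightarrow>
    (\<lambda>e. \<Prod>p\<in>J. f p e) \<in> poly_family R"
  by (induction J rule: infinite_finite_induct) (auto intro: poly_family_one poly_family_mult)

lemma prod_list_map_nth: "prod_list (map f xs) = (\<Prod>i<length xs. f (xs ! i))"
  by (induction xs) (simp_all add: prod.lessThan_Suc_shift del: prod.lessThan_Suc)

lemma poly_eq_sum:
  fixes p :: "'a::comm_semiring_1 poly"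
  assumes "degree p \<le> d"
  shows "poly p x = (\<Sum>l\<le>d. coeff p l * x ^ l)"
  unfolding poly_altdef using assms
  by (intro sum.mono_neutral_left) (auto simp: coeff_eq_0)

lemma coeff_prod_reversed:
  fixes xs :: "'a::field list"
  shows "coeff (prod_list (map (\<lambda>x. [:1, -x:]) xs)) k
    = (if k \<le> length xs then coeff (prod_list (map (\<lambda>x. [:-x, 1:]) xs)) (length xs - k) else 0)"
proof -
  have *: "reflect_poly (prod_list (map (\<lambda>x. [:-x, 1:]) xs)) = prod_list (map (\<lambda>x. [:1, -x:]) xs)
      \<and> degree (prod_list (map (\<lambda>x. [:-x, 1:]) xs)) = length xs
      \<and> prod_list (map (\<lambda>x. [:-x, 1:]) xs) \<noteq> 0"
  proof (induction xs)
    case (Cons x xs)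
    have "reflect_poly [:-x, 1:] = [:1, -x:]"
      by (cases "x = 0") (auto simp: reflect_poly_def)
    thus ?case using Cons by (simp add: reflect_poly_mult degree_mult_eq del: mult_pCons_left)
  qed auto
  hence "coeff (prod_list (map (\<lambda>x. [:1, -x:]) xs)) k
      = coeff (reflect_poly (prod_list (map (\<lambda>x. [:-x, 1:]) xs))) k" by simp
  also have "\<dots> = (if k \<le> length xs
      then coeff (prod_list (map (\<lambda>x. [:-x, 1:]) xs)) (length xs - k) else 0)"
    unfolding coeff_reflect_poly using * by (simp add: not_less)
  finally show ?thesis .
qed

text \<open>Newton's identities express the power sums of the roots by the coefficients of \<open>F\<close>. Every trace
  \<open>\<Sum>i. q(c\<^sub>i)\<close> is a combination of power sums, and the recursion for \<^term>\<open>symsum\<close> reduces symmetric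
  sums to traces. No step divides, so the result lies in the algebra itself. The factorization of
  \<open>F\<close> is available for parameters in \<open>E\<close> only; accordingly, membership in \<open>R\<close> is a property of the
  restriction to \<open>E\<close>.\<close>

lemma symsum_roots_in_algebra:
  fixes R :: "('e \<Rightarrow> 'a::field) set" and c :: "'e \<Rightarrow> nat \<Rightarrow> 'a"
  assumes R: "function_algebra R"
    and loc: "\<And>f g. f \<in> R \<Longrightarrow> (\<And>e. e \<in> E \<Longrightarrow> f e = g e) \<Longrightarrow> g \<in> R"
    and F: "\<And>e. e \<in> E \<Longrightarrow> F e = (\<Prod>i<N. [:- c e i, 1:])"
    and coeff_F: "\<And>i. (\<lambda>e. coeff (F e) i) \<in> R"
    and qs: "set qs \<subseteq> poly_family R"
  shows "(\<lambda>e. symsum N (map (\<lambda>q i. poly (q e) (c e i)) qs)) \<in> R"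
proof -
  have powersum: "(\<lambda>e. \<Sum>i<N. c e i ^ m) \<in> R" for m
  proof (induction m rule: less_induct)
    case (less m)
    show ?case
    proof (cases "m = 0")
      case True
      thus ?thesis using fa_of_nat[OF R, of N] by simp
    next
      case False
      define g where "g k e = (if k \<le> N then coeff (F e) (N - k) else 0)" for k e
      have gR: "g k \<in> R" for k
        unfolding g_def using coeff_F fa_zero[OF R] by (cases "k \<le> N") auto
      have "(\<lambda>e. - (of_nat m * g m e + (\<Sum>i\<in>{1..<m}. g (m - i) e * (\<Sum>j<N. c e j ^ i)))) \<in> R"
        by (intro fa_uminus[OF R] fa_add[OF R] fa_mult[OF R] fa_sum[OF R] fa_of_nat[OF R] gR less) auto
      thus ?thesis
      proof (rule loc)
        fix e assume e: "e \<in> E"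
        define xs where "xs = map (c e) [0..<N]"
        have F': "F e = prod_list (map (\<lambda>x. [:-x, 1:]) xs)"
          unfolding F[OF e] xs_def
          by (simp add: prod_list_map_nth del: map_map)
        have g: "coeff (prod_list (map (\<lambda>x. [:1, -x:]) xs)) k = g k e" for k
          unfolding coeff_prod_reversed F'[symmetric] by (simp add: xs_def g_def)
        have s: "sum_list (map (\<lambda>x. x ^ i) xs) = (\<Sum>j<N. c e j ^ i)" for i
          by (simp add: xs_def o_def interv_sum_list_conv_sum_set_nat atLeast0LessThan)
        have g0: "g 0 e = 1" unfolding g[symmetric] by (induction xs) auto
        have "of_nat m * g m e + (\<Sum>i=1..m. g (m - i) e * (\<Sum>j<N. c e j ^ i)) = 0"
          using newton_identity[of m xs] False unfolding g s by simp
        moreover have "{1..m} = insert m {1..<m}" using False by auto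
        ultimately have "of_nat m * g m e + (\<Sum>i\<in>{1..<m}. g (m - i) e * (\<Sum>j<N. c e j ^ i))
            + (\<Sum>j<N. c e j ^ m) = 0" by (simp add: g0 add_ac)
        thus "- (of_nat m * g m e + (\<Sum>i\<in>{1..<m}. g (m - i) e * (\<Sum>j<N. c e j ^ i)))
            = (\<Sum>j<N. c e j ^ m)" by (rule minus_unique)
      qed
    qed
  qed
  have trace: "(\<lambda>e. \<Sum>i<N. poly (q e) (c e i)) \<in> R" if q: "q \<in> poly_family R" for q
  proof -
    obtain d where d: "\<And>e. degree (q e) \<le> d" and qR: "\<And>i. (\<lambda>e. coeff (q e) i) \<in> R"
      using q by (auto simp: poly_family_def)
    have "(\<lambda>e. \<Sum>l\<le>d. coeff (q e) l * (\<Sum>i<N. c e i ^ l)) \<in> R"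
      by (intro fa_sum[OF R] fa_mult[OF R] qR powersum)
    moreover have "(\<Sum>l\<le>d. coeff (q e) l * (\<Sum>i<N. c e i ^ l)) = (\<Sum>i<N. poly (q e) (c e i))" for e
      unfolding poly_eq_sum[OF d] sum_distrib_left by (rule sum.swap)
    ultimately show ?thesis by simp
  qed
  show ?thesis using qs
  proof (induction "length qs" arbitrary: qs)
    case 0
    thus ?case using fa_one[OF R] by (simp add: symsum_Nil)
  next
    case (Suc r)
    then obtain q qs' where qs: "qs = q # qs'" "length qs' = r" by (cases qs) auto
    have q: "q \<in> poly_family R" "set qs' \<subseteq> poly_family R" using Suc.prems qs by auto
    have upd: "set (qs'[s := (\<lambda>e. (qs' ! s) e * q e)]) \<subseteq> poly_family R" if "s < length qs'" for s
      using q that by (intro set_update_subsetI poly_family_mult[OF R]) auto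
    have "(\<lambda>e. (\<Sum>i<N. poly (q e) (c e i)) * symsum N (map (\<lambda>q i. poly (q e) (c e i)) qs')
        - (\<Sum>s<length qs'. symsum N (map (\<lambda>q i. poly (q e) (c e i)) (qs'[s := (\<lambda>e. (qs' ! s) e * q e)])))) \<in> R"
      by (intro fa_diff[OF R] fa_mult[OF R] fa_sum[OF R] trace q Suc.hyps upd) (use qs q in auto)
    moreover have "symsum N (map (\<lambda>q i. poly (q e) (c e i)) qs)
        = (\<Sum>i<N. poly (q e) (c e i)) * symsum N (map (\<lambda>q i. poly (q e) (c e i)) qs')
        - (\<Sum>s<length qs'. symsum N (map (\<lambda>q i. poly (q e) (c e i)) (qs'[s := (\<lambda>e. (qs' ! s) e * q e)])))" for e
      by (simp add: qs symsum_Cons map_update)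
    ultimately show ?case by simp
  qed
qed

context acvf
begin

definition rv_agree :: "('e \<Rightarrow> 'a) set \<Rightarrow> 'e \<Rightarrow> 'e \<Rightarrow> bool" where
  "rv_agree G e e' \<longleftrightarrow> (\<forall>g\<in>G. rv (g e) = rv (g e'))"

lemma monic_root_matching:
  fixes R :: "('e \<Rightarrow> 'a) set" and q :: "nat \<Rightarrow> 'e \<Rightarrow> 'a poly"
  assumes R: "function_algebra R"
    and loc: "\<And>f g. f \<in> R \<Longrightarrow> (\<And>e. e \<in> E \<Longrightarrow> f e = g e) \<Longrightarrow> g \<in> R"
    and F: "\<And>e. e \<in> E \<Longrightarrow> degree (F e) = N \<and> lead_coeff (F e) = 1"
    and coeff_F: "\<And>i. (\<lambda>e. coeff (F e) i) \<in> R"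
    and q: "\<And>k. k \<le> n \<Longrightarrow> q k \<in> poly_family R" and q0: "q 0 = (\<lambda>_. 1)"
  shows "\<exists>G\<subseteq>R. finite G \<and> (\<forall>e\<in>E. \<forall>e'\<in>E. rv_agree G e e' \<longrightarrow>
    (\<forall>c. poly (F e) c = 0 \<longrightarrow> (\<exists>c'. \<forall>k\<le>n. rv (poly (q k e') c') = rv (poly (q k e) c))))"
proof -
  have "\<exists>c. F e = (\<Prod>i<N. [:- c i, 1:])" if e: "e \<in> E" for e
  proof -
    have "F e \<noteq> 0" using F[OF e] by auto
    then obtain Z where Z: "size Z = degree (F e)" "F e = smult (lead_coeff (F e)) (\<Prod>z\<in>#Z. [:-z, 1:])"
      using alg_closed_imp_factorization by blast
    obtain xs where xs: "mset xs = Z" using ex_mset by blast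
    have "F e = (\<Prod>z\<in>#Z. [:-z, 1:])" using Z(2) F[OF e] by (metis smult_1_left)
    also have "\<dots> = prod_list (map (\<lambda>z. [:-z, 1:]) xs)"
      by (simp add: xs[symmetric] prod_mset_prod_list flip: mset_map)
    also have "\<dots> = (\<Prod>i<N. [:- (xs ! i), 1:])"
    proof -
      have "length xs = N" using Z(1) F[OF e] xs by (metis size_mset)
      thus ?thesis by (simp add: prod_list_map_nth)
    qed
    finally show ?thesis by blast
  qed
  then obtain c where c: "\<And>e. e \<in> E \<Longrightarrow> F e = (\<Prod>i<N. [:- c e i, 1:])" by metis
  define sym where "sym \<kappa> e = symsum N (map (\<lambda>q i. poly (q e) (c e i)) (map q \<kappa>))" for \<kappa> e
  define G where "G = sym ` {\<kappa>. set \<kappa> \<subseteq> {..n} \<and> length \<kappa> = N}"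
  have "sym \<kappa> \<in> R" if "set \<kappa> \<subseteq> {..n}" for \<kappa>
    unfolding sym_def
  proof (rule symsum_roots_in_algebra[OF R _ c coeff_F])
    show "set (map q \<kappa>) \<subseteq> poly_family R" using q that by auto
  qed (fact loc)
  hence GR: "G \<subseteq> R" by (auto simp: G_def)
  have finG: "finite G"
    unfolding G_def by (intro finite_imageI finite_lists_length_eq) auto
  have match: "\<exists>c'. \<forall>k\<le>n. rv (poly (q k e') c') = rv (poly (q k e) c0)"
    if e: "e \<in> E" "e' \<in> E" and agree: "rv_agree G e e'" and c0: "poly (F e) c0 = 0" for e e' c0
  proof -
    obtain i0 where i0: "i0 < N" "c0 = c e i0"
      using c0 unfolding c[OF e(1)] by (auto simp: poly_prod)
    have "\<exists>j<N. \<forall>k\<le>n. rv (poly (q k e') (c e' j)) = rv (poly (q k e) (c e i0))"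
    proof (rule matching_of_symsums[OF _ _ _ i0(1), of n "\<lambda>k i. poly (q k e) (c e i)"
            "\<lambda>k i. poly (q k e') (c e' i)"])
      fix \<kappa> :: "nat list" assume "set \<kappa> \<subseteq> {..n}" "length \<kappa> = N"
      hence "sym \<kappa> \<in> G" by (auto simp: G_def)
      hence "rv (sym \<kappa> e) = rv (sym \<kappa> e')" using agree by (auto simp: rv_agree_def)
      thus "rv (symsum N (map (\<lambda>k i. poly (q k e) (c e i)) \<kappa>))
          = rv (symsum N (map (\<lambda>k i. poly (q k e') (c e' i)) \<kappa>))"
        by (simp add: sym_def o_def)
    qed (simp_all add: q0)
    thus ?thesis using i0(2) by blast
  qed
  show ?thesis
    by (intro exI[of _ G] conjI GR finG ballI allI impI match)
qed

text \<open>A polynomial of degree \<open>N\<close> becomes monic over the localisation of the algebra at its leading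
  coefficient. The degree is the same for parameters that agree, because an element is \<open>0\<close> iff its
  image in RV is \<open>\<infinity>\<close>; so finitely many conditions for each of the finitely many possible degrees
  suffice.\<close>

theorem root_matching:
  fixes R :: "('e \<Rightarrow> 'a) set"
  assumes R: "function_algebra R"
    and F: "F \<in> poly_family R"
    and Q: "finite Q" "Q \<subseteq> poly_family R"
  shows "\<exists>G\<subseteq>R. finite G \<and> (\<forall>e e'. rv_agree G e e' \<longrightarrow> F e \<noteq> 0 \<longrightarrow>
    (\<forall>c. poly (F e) c = 0 \<longrightarrow> (\<exists>c'. \<forall>q\<in>Q. rv (poly (q e') c') = rv (poly (q e) c))))"
proof -
  obtain d where d: "\<And>e. degree (F e) \<le> d" and FR: "\<And>i. (\<lambda>e. coeff (F e) i) \<in> R"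
    using F by (auto simp: poly_family_def)
  define E where "E N = {e. F e \<noteq> 0 \<and> degree (F e) = N}" for N
  define lc where "lc N e = coeff (F e) N" for N e
  have lc0: "lc N e \<noteq> 0" if "e \<in> E N" for N e using that by (auto simp: E_def lc_def)
  have lcR: "lc N \<in> R" for N unfolding lc_def[abs_def] by (rule FR)
  \<comment> \<open>the localisation of \<open>R\<close> at the leading coefficient\<close>
  define RN where "RN N = {f. \<exists>r\<in>R. \<exists>k. \<forall>e\<in>E N. f e * lc N e ^ k = r e}" for N
  have RNI: "f \<in> RN N" if "r \<in> R" "\<And>e. e \<in> E N \<Longrightarrow> f e * lc N e ^ k = r e" for f r k N
    unfolding RN_def mem_Collect_eq using that by (intro bexI[of _ r] exI[of _ k] ballI)
  have R_RN: "R \<subseteq> RN N" for N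
    by (auto intro: RNI[of _ _ _ 0])
  have RN: "function_algebra (RN N)" for N
  proof -
    have "(\<lambda>e. f e + g e) \<in> RN N \<and> (\<lambda>e. f e * g e) \<in> RN N" if fg: "f \<in> RN N" "g \<in> RN N" for f g
    proof -
      obtain r k where r': "r \<in> R" "\<forall>e\<in>E N. f e * lc N e ^ k = r e"
        using fg(1) unfolding RN_def by blast
      note r = r'(1) r'(2)[rule_format]
      obtain s l where s': "s \<in> R" "\<forall>e\<in>E N. g e * lc N e ^ l = s e"
        using fg(2) unfolding RN_def by blast
      note s = s'(1) s'(2)[rule_format]
      have "(\<lambda>e. f e + g e) \<in> RN N"
      proof (rule RNI)
        show "(\<lambda>e. r e * lc N e ^ l + s e * lc N e ^ k) \<in> R"
          by (intro fa_add[OF R] fa_mult[OF R] fa_power[OF R] r s lcR)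
        show "(f e + g e) * lc N e ^ (k + l) = r e * lc N e ^ l + s e * lc N e ^ k" if "e \<in> E N" for e
          by (simp add: r(2)[OF that, symmetric] s(2)[OF that, symmetric] power_add algebra_simps)
      qed
      moreover have "(\<lambda>e. f e * g e) \<in> RN N"
      proof (rule RNI)
        show "(\<lambda>e. r e * s e) \<in> R" by (intro fa_mult[OF R] r s)
        show "(f e * g e) * lc N e ^ (k + l) = r e * s e" if "e \<in> E N" for e
          by (simp add: r(2)[OF that, symmetric] s(2)[OF that, symmetric] power_add algebra_simps)
      qed
      ultimately show ?thesis ..
    qed
    moreover have "(\<lambda>e. - f e) \<in> RN N" if f: "f \<in> RN N" for f
    proof -
      obtain r k where r': "r \<in> R" "\<forall>e\<in>E N. f e * lc N e ^ k = r e"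
        using f unfolding RN_def by blast
      note r = r'(1) r'(2)[rule_format]
      show ?thesis
        by (rule RNI[OF fa_uminus[OF R r(1)], of N _ k]) (simp flip: r(2))
    qed
    ultimately show ?thesis
      using R_RN[of N] fa_of_nat[OF R] unfolding function_algebra_def by auto
  qed
  have loc: "g \<in> RN N" if "f \<in> RN N" "\<And>e. e \<in> E N \<Longrightarrow> f e = g e" for f g N
    using that unfolding RN_def by auto
  obtain qs where qs: "set qs = Q" using finite_list[OF Q(1)] by blast
  define q where "q k = (if k = 0 then (\<lambda>_. 1) else qs ! (k - 1))" for k
  define n where "n = length qs"
  have pfR: "poly_family R \<subseteq> poly_family (RN N)" for N
    using R_RN unfolding poly_family_def by blast
  have "\<exists>G\<subseteq>RN N. finite G \<and> (\<forall>e\<in>E N. \<forall>e'\<in>E N. rv_agree G e e' \<longrightarrow>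
    (\<forall>c. poly (smult (inverse (lc N e)) (F e)) c = 0 \<longrightarrow>
      (\<exists>c'. \<forall>k\<le>n. rv (poly (q k e') c') = rv (poly (q k e) c))))" for N
  proof (rule monic_root_matching[OF RN])
    show "q k \<in> poly_family (RN N)" if "k \<le> n" for k
    proof (cases "k = 0")
      case False
      hence "qs ! (k - 1) \<in> Q" using that qs by (auto simp: n_def intro: nth_mem)
      thus ?thesis using Q pfR False by (auto simp: q_def)
    qed (simp add: q_def poly_family_one[OF RN])
    show "(\<lambda>e. coeff (smult (inverse (lc N e)) (F e)) i) \<in> RN N" for i
    proof -
      show ?thesis
        by (rule RNI[OF FR[of i], of N _ 1]) (simp add: lc0)
    qed
    show "degree (smult (inverse (lc N e)) (F e)) = N \<and>
        lead_coeff (smult (inverse (lc N e)) (F e)) = 1" if "e \<in> E N" for e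
      using that lc0[OF that] by (auto simp: E_def lc_def)
  qed (use loc in \<open>auto simp: q_def\<close>)
  then obtain GN where GN: "\<And>N. GN N \<subseteq> RN N" "\<And>N. finite (GN N)"
    "\<And>N e e' c. e \<in> E N \<Longrightarrow> e' \<in> E N \<Longrightarrow> rv_agree (GN N) e e' \<Longrightarrow>
      poly (smult (inverse (lc N e)) (F e)) c = 0 \<Longrightarrow>
      \<exists>c'. \<forall>k\<le>n. rv (poly (q k e') c') = rv (poly (q k e) c)"
    by metis
  have "\<exists>rk. fst rk \<in> R \<and> (\<forall>e\<in>E N. g e * lc N e ^ snd rk = fst rk e)" if g: "g \<in> RN N" for g N
  proof -
    obtain r k where "r \<in> R" "\<forall>e\<in>E N. g e * lc N e ^ k = r e"
      using g unfolding RN_def by blast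
    thus ?thesis by (intro exI[of _ "(r, k)"]) simp
  qed
  note fraction = this
  define rk where "rk N g = (SOME rk. fst rk \<in> R \<and> (\<forall>e\<in>E N. g e * lc N e ^ snd rk = fst rk e))" for N g
  have rk: "fst (rk N g) \<in> R \<and> (\<forall>e\<in>E N. g e * lc N e ^ snd (rk N g) = fst (rk N g) e)"
    if "g \<in> RN N" for g N
    unfolding rk_def by (rule someI_ex[OF fraction[OF that]])
  define num where "num N g = fst (rk N g)" for N g
  define ex where "ex N g = snd (rk N g)" for N g
  have num: "num N g \<in> R" "\<And>e. e \<in> E N \<Longrightarrow> g e * lc N e ^ ex N g = num N g e" if "g \<in> RN N" for g N
    using rk[OF that] by (auto simp: num_def ex_def)
  define G where "G = (\<Union>N\<le>d. num N ` GN N) \<union> lc ` {..d}"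
  have GR: "G \<subseteq> R" using GN(1) num(1) lcR by (auto simp: G_def)
  have finG: "finite G" using GN(2) by (simp add: G_def)
  have match: "\<exists>c'. \<forall>q\<in>Q. rv (poly (q e') c') = rv (poly (q e) c)"
    if agree: "rv_agree G e e'" and F0: "F e \<noteq> 0" and c: "poly (F e) c = 0" for e e' c
  proof -
    have lc: "rv (lc i e) = rv (lc i e')" if "i \<le> d" for i
      using agree that by (auto simp: rv_agree_def G_def)
    have coeff0: "coeff (F e) i = 0 \<longleftrightarrow> coeff (F e') i = 0" for i
    proof (cases "i \<le> d")
      case True
      thus ?thesis using lc[OF True] by (metis lc_def rv_eq_zero_iff(1))
    next
      case False
      thus ?thesis using d by (metis coeff_eq_0 le_less_trans not_le)
    qed
    have "degree (F e) = degree (F e')"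
      by (simp add: degree_def coeff0)
    moreover have "F e' \<noteq> 0" using F0 coeff0 by (metis leading_coeff_0_iff coeff_0)
    ultimately have E: "e \<in> E (degree (F e))" "e' \<in> E (degree (F e))"
      using F0 by (auto simp: E_def)
    define N where "N = degree (F e)"
    have N: "N \<le> d" using d by (simp add: N_def)
    have agreeN: "rv_agree (GN N) e e'"
      unfolding rv_agree_def
    proof
      fix g assume g: "g \<in> GN N"
      hence gR: "g \<in> RN N" using GN(1) by blast
      have gf: "g f = num N g f * inverse (lc N f) ^ ex N g" if "f \<in> E N" for f
        using num(2)[OF gR that] lc0[OF that] by (simp add: field_simps)
      have "num N g \<in> G" using g N by (auto simp: G_def)
      hence "rv (num N g e) = rv (num N g e')" using agree by (auto simp: rv_agree_def)
      thus "rv (g e) = rv (g e')"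
        unfolding gf[OF E(1)[folded N_def]] gf[OF E(2)[folded N_def]]
        by (intro rv_mult_cong rv_power_cong rv_inverse_cong lc[OF N])
    qed
    have "poly (smult (inverse (lc N e)) (F e)) c = 0" using c by simp
    from GN(3)[OF E[folded N_def] agreeN this] obtain c'
      where c': "\<forall>k\<le>n. rv (poly (q k e') c') = rv (poly (q k e) c)" by (rule exE)
    have "rv (poly (p e') c') = rv (poly (p e) c)" if p: "p \<in> Q" for p
    proof -
      obtain i where "i < length qs" "p = qs ! i" using p[folded qs] unfolding in_set_conv_nth by blast
      thus ?thesis using c'[rule_format, of "Suc i"] by (simp add: q_def n_def)
    qed
    thus ?thesis by blast
  qed
  show ?thesis
    by (intro exI[of _ G] conjI GR finG ballI allI impI match)
qed

end

section \<open>Formulas see the field only through RV\<close>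

lemma poly_family_sum:
  "function_algebra R \<Longrightarrow> (\<And>j. j \<in> J \<Longrightarrow> f j \<in> poly_family R) \<Longrightarrow>
    (\<lambda>e. \<Sum>j\<in>J. f j e) \<in> poly_family R"
  using poly_family_const[OF _ fa_zero, of R]
  by (induction J rule: infinite_finite_induct) (auto intro: poly_family_add)

lemma poly_family_power:
  "function_algebra R \<Longrightarrow> p \<in> poly_family R \<Longrightarrow> (\<lambda>e. p e ^ n) \<in> poly_family R"
  by (induction n) (auto intro: poly_family_one poly_family_mult)

lemma taylor_coeff_family:
  assumes R: "function_algebra R" and p: "p \<in> poly_family R"
  shows "\<exists>t\<in>poly_family R. \<forall>e c. poly (t e) c = coeff (pcompose (p e) [:c, 1:]) i"
proof -
  obtain d where d: "\<And>e. degree (p e) \<le> d" and pR: "\<And>i. (\<lambda>e. coeff (p e) i) \<in> R"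
    using p by (auto simp: poly_family_def)
  define t where "t e = (\<Sum>j\<in>{i..d}. [:of_nat (j choose i) * coeff (p e) j:] * [:0, 1:] ^ (j - i))" for e
  have "t \<in> poly_family R"
    unfolding t_def[abs_def]
    by (intro poly_family_sum[OF R] poly_family_mult[OF R] poly_family_const[OF R]
        poly_family_power[OF R] poly_family_X[OF R] fa_mult[OF R] fa_of_nat[OF R] pR)
  moreover have "poly (t e) c = coeff (pcompose (p e) [:c, 1:]) i" for e c
  proof -
    have "degree (map_poly (\<lambda>x. [:x:]) (p e)) \<le> d"
    proof (rule degree_le, intro allI impI)
      fix j assume "d < j"
      thus "coeff (map_poly (\<lambda>x. [:x:]) (p e)) j = 0"
        using d[of e] by (simp add: coeff_map_poly coeff_eq_0)
    qed
    hence "pcompose (p e) [:c, 1:] = (\<Sum>j\<le>d. [:coeff (p e) j:] * [:c, 1:] ^ j)"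
      unfolding pcompose_altdef by (subst poly_eq_sum) (auto simp: coeff_map_poly)
    hence "coeff (pcompose (p e) [:c, 1:]) i = (\<Sum>j\<le>d. coeff (p e) j * coeff ([:c, 1:] ^ j) i)"
      by (simp add: coeff_sum)
    also have "\<dots> = (\<Sum>j\<in>{i..d}. coeff (p e) j * coeff ([:c, 1:] ^ j) i)"
    proof (intro sum.mono_neutral_right ballI)
      fix j assume "j \<in> {..d} - {i..d}"
      hence "degree ([:c, 1:] ^ j) < i" using degree_power_le[of "[:c, 1:]" j] by auto
      thus "coeff (p e) j * coeff ([:c, 1:] ^ j) i = 0" by (simp add: coeff_eq_0)
    qed auto
    also have "\<dots> = poly (t e) c"
      unfolding t_def poly_sum by (intro sum.cong) (auto simp: coeff_linear_poly_power)
    finally show ?thesis ..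
  qed
  ultimately show ?thesis by blast
qed

context acvf
begin

text \<open>If no root of \<open>p\<close> is closer to \<open>a\<close> than \<open>c\<close>, then there is no cancellation in the expansion of
  \<open>p\<close> at \<open>c\<close>, evaluated at \<open>a\<close>. So its terms may be changed by amounts that are small relative to
  them without changing the image of the value in RV.\<close>

lemma rv_poly_translate:
  fixes p p' :: "'a poly"
  assumes p0: "p \<noteq> 0"
    and closest: "\<And>r. poly p r = 0 \<Longrightarrow> a - c \<preceq> a - r"
    and rv_coeff: "\<And>i. rv (coeff (pcompose p [:c, 1:]) i) = rv (coeff (pcompose p' [:c', 1:]) i)"
  shows "rv (poly p' (c' + (a - c))) = rv (poly p a)"
proof -
  define q where "q = pcompose p [:c, 1:]"
  define q' where "q' = pcompose p' [:c', 1:]"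
  define u where "u = a - c"
  have pq: "poly p a = poly q u" "poly p' (c' + (a - c)) = poly q' u"
    by (simp_all add: q_def q'_def u_def poly_pcompose)
  have rvq: "rv (coeff q i) = rv (coeff q' i)" for i using rv_coeff by (simp add: q_def q'_def)
  show ?thesis
  proof (cases "u = 0")
    case True
    thus ?thesis using rvq[of 0] unfolding pq by (simp add: poly_0_coeff_0)
  next
    case False
    have q0: "q \<noteq> 0" using p0 pcompose_eq_0[of p "[:c, 1:]"] by (auto simp: q_def)
    have bound: "coeff q i * u ^ i \<preceq> poly q u" for i
    proof (rule coeff_vle_poly[OF q0])
      fix \<rho> assume "poly q \<rho> = 0"
      hence 1: "u \<preceq> u - \<rho>" using closest[of "c + \<rho>"] by (simp add: q_def poly_pcompose u_def algebra_simps)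
      moreover have "\<rho> \<preceq> u - \<rho>" using vle_diff[OF 1 vle_refl] by simp
      ultimately show "u \<preceq> u - \<rho> \<and> \<rho> \<preceq> u - \<rho>" by simp
    qed
    have nz: "poly q u \<noteq> 0"
    proof
      assume "poly q u = 0"
      hence "poly p a = 0" by (simp add: pq)
      from closest[OF this] False show False by (simp add: u_def)
    qed
    have "(coeff q i - coeff q' i) * u ^ i \<prec> poly q u" for i
    proof (cases "coeff q' i = coeff q i")
      case False
      from rv_diff_vlt[OF rvq[symmetric] False]
      have "coeff q i - coeff q' i \<prec> coeff q i" .
      hence "(coeff q i - coeff q' i) * u ^ i \<prec> coeff q i * u ^ i"
        using \<open>u \<noteq> 0\<close> by (simp add: vlt_mult_cancel)
      thus ?thesis using bound by (rule vlt_vle_trans)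
    qed (use nz in simp)
    hence "(\<Sum>i\<le>max (degree q) (degree q'). (coeff q i - coeff q' i) * u ^ i) \<prec> poly q u"
      by (intro vlt_sum nz)
    moreover have "(\<Sum>i\<le>max (degree q) (degree q'). (coeff q i - coeff q' i) * u ^ i)
        = poly q u - poly q' u"
      using poly_eq_sum[of q "max (degree q) (degree q')" u]
        poly_eq_sum[of q' "max (degree q) (degree q')" u]
      by (simp add: left_diff_distrib sum_subtractf)
    ultimately have "rv (poly q u) = rv (poly q' u)" unfolding rv_eq_iff by metis
    thus ?thesis unfolding pq by (rule sym)
  qed
qed

text \<open>Let \<open>c\<close> be a root closest to \<open>a\<close> among all roots of the nonzero members of \<open>Q\<close>. Matching the Taylor
  coefficients of all members at \<open>c\<close> yields a point \<open>c'\<close> for the second parameter, and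
  \<open>a' = c' + (a - c)\<close> works by \<open>rv_poly_translate\<close>.\<close>

theorem point_matching:
  fixes R :: "('e \<Rightarrow> 'a) set"
  assumes R: "function_algebra R" and Q: "finite Q" "Q \<subseteq> poly_family R"
  shows "\<exists>G\<subseteq>R. finite G \<and> (\<forall>e e'. rv_agree G e e' \<longrightarrow>
    (\<forall>a. \<exists>a'. \<forall>p\<in>Q. rv (poly (p e') a') = rv (poly (p e) a)))"
proof -
  have "\<exists>d. \<forall>e. degree (p e) \<le> d" if "p \<in> Q" for p
    using that Q(2) by (auto simp: poly_family_def)
  then obtain dg where dg: "\<And>p e. p \<in> Q \<Longrightarrow> degree (p e) \<le> dg p" by metis
  define d where "d = (\<Sum>p\<in>Q. dg p)"
  have d: "degree (p e) \<le> d" if "p \<in> Q" for p e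
    using dg[OF that, of e] member_le_sum[of p Q dg] that Q(1) unfolding d_def by auto
  have "\<exists>t\<in>poly_family R. \<forall>e c. poly (t e) c = coeff (pcompose (p e) [:c, 1:]) i" if "p \<in> Q" for p i
    using taylor_coeff_family[OF R] that Q(2) by blast
  then obtain t where t: "\<And>p i. p \<in> Q \<Longrightarrow> t p i \<in> poly_family R"
    "\<And>p i e c. p \<in> Q \<Longrightarrow> poly (t p i e) c = coeff (pcompose (p e) [:c, 1:]) i" by metis
  define T where "T = (\<lambda>(p, i). t p i) ` (Q \<times> {..d})"
  have T: "finite T" "T \<subseteq> poly_family R" using Q(1) t(1) by (auto simp: T_def)
  define F where "F J e = (\<Prod>p\<in>J. p e)" for J :: "('e \<Rightarrow> 'a poly) set" and e
  have F: "F J \<in> poly_family R" if "J \<subseteq> Q" for J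
    unfolding F_def[abs_def] using that Q(2) by (intro poly_family_prod[OF R]) auto
  have "\<exists>G\<subseteq>R. finite G \<and> (\<forall>e e'. rv_agree G e e' \<longrightarrow> F J e \<noteq> 0 \<longrightarrow>
    (\<forall>c. poly (F J e) c = 0 \<longrightarrow> (\<exists>c'. \<forall>q\<in>T. rv (poly (q e') c') = rv (poly (q e) c))))" if "J \<subseteq> Q" for J
    by (rule root_matching[OF R F[OF that] T])
  then obtain GJ where GJ: "\<And>J. J \<subseteq> Q \<Longrightarrow> GJ J \<subseteq> R" "\<And>J. J \<subseteq> Q \<Longrightarrow> finite (GJ J)"
    "\<And>J e e' c. J \<subseteq> Q \<Longrightarrow> rv_agree (GJ J) e e' \<Longrightarrow> F J e \<noteq> 0 \<Longrightarrow> poly (F J e) c = 0 \<Longrightarrow>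
      \<exists>c'. \<forall>q\<in>T. rv (poly (q e') c') = rv (poly (q e) c)"
    by metis
  define G where "G = (\<Union>J\<in>Pow Q. GJ J) \<union> (\<lambda>(p, i) e. coeff (p e) i) ` (Q \<times> {..d})"
  have GR: "G \<subseteq> R" using GJ(1) Q(2) by (auto simp: G_def poly_family_def)
  have finG: "finite G" using GJ(2) Q(1) by (auto simp: G_def)
  have match: "\<exists>a'. \<forall>p\<in>Q. rv (poly (p e') a') = rv (poly (p e) a)" if agree: "rv_agree G e e'" for e e' a
  proof -
    have rv_coeff: "rv (coeff (p e) i) = rv (coeff (p e') i)" if "p \<in> Q" for p i
    proof (cases "i \<le> d")
      case True
      hence "(\<lambda>e. coeff (p e) i) \<in> G" using that by (auto simp: G_def)
      thus ?thesis using agree by (auto simp: rv_agree_def)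
    next
      case False
      hence "degree (p e) < i" "degree (p e') < i" using d[OF that, of e] d[OF that, of e'] by auto
      thus ?thesis by (simp add: coeff_eq_0)
    qed
    have rv_const: "rv (poly (p e') x) = rv (poly (p e) y)" if p: "p \<in> Q" "degree (p e) = 0" for p x y
    proof -
      have "coeff (p e') i = 0" if "i > 0" for i
      proof -
        have "coeff (p e) i = 0" using that p(2) by (simp add: coeff_eq_0)
        thus ?thesis using rv_coeff[OF p(1), of i] by simp
      qed
      hence "degree (p e') \<le> 0" by (intro degree_le) auto
      then obtain b b' where "p e = [:b:]" "p e' = [:b':]" using p(2) by (metis degree_eq_zeroE le_zero_eq)
      thus ?thesis using rv_coeff[OF p(1), of 0] by simp
    qed
    define J where "J = {p \<in> Q. p e \<noteq> 0}"
    have J: "J \<subseteq> Q" "finite J" using Q(1) by (auto simp: J_def)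
    have F0: "F J e \<noteq> 0" using J(2) by (auto simp: F_def J_def)
    show ?thesis
    proof (cases "\<exists>c. poly (F J e) c = 0")
      case False
      have "degree (p e) = 0" if p: "p \<in> Q" for p
      proof (rule ccontr)
        assume *: "degree (p e) \<noteq> 0"
        then obtain c where "poly (p e) c = 0" using alg_closed_imp_poly_has_root by blast
        moreover have "p \<in> J" using p * by (auto simp: J_def)
        ultimately have "poly (F J e) c = 0" using J(2) by (auto simp: F_def poly_prod)
        thus False using False by blast
      qed
      thus ?thesis using rv_const by blast
    next
      case True
      define V where "V = (\<lambda>r. val (a - r)) ` {r. poly (F J e) r = 0}"
      have V: "finite V" "V \<noteq> {}" using poly_roots_finite[OF F0] True by (auto simp: V_def)
      obtain c where c: "poly (F J e) c = 0" "val (a - c) = Max V"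
        using Max_in[OF V] by (auto simp: V_def)
      have closest: "a - c \<preceq> a - r" if "poly (F J e) r = 0" for r
        unfolding vle_def c(2) using V(1) that by (intro Max_ge) (auto simp: V_def)
      have "rv_agree (GJ J) e e'" using agree J(1) by (auto simp: rv_agree_def G_def)
      then obtain c' where c': "\<And>q. q \<in> T \<Longrightarrow> rv (poly (q e') c') = rv (poly (q e) c)"
        using GJ(3)[OF J(1) _ F0 c(1)] by blast
      have "rv (poly (p e') (c' + (a - c))) = rv (poly (p e) a)" if p: "p \<in> Q" for p
      proof (cases "p e = 0")
        case True
        thus ?thesis using rv_const[OF p] by simp
      next
        case False
        hence pJ: "p \<in> J" using p by (simp add: J_def)
        show ?thesis
        proof (rule rv_poly_translate[OF False])
          fix r assume "poly (p e) r = 0"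
          hence "poly (F J e) r = 0" using J(2) pJ by (auto simp: F_def poly_prod)
          thus "a - c \<preceq> a - r" by (rule closest)
        next
          fix i
          show "rv (coeff (pcompose (p e) [:c, 1:]) i) = rv (coeff (pcompose (p e') [:c', 1:]) i)"
          proof (cases "i \<le> d")
            case True
            hence "t p i \<in> T" using p by (auto simp: T_def)
            from c'[OF this] show ?thesis by (simp add: t(2)[OF p])
          next
            case False
            have "degree (pcompose (p f) [:x, 1:]) < i" for f x
              using degree_pcompose_le[of "p f" "[:x, 1:]"] d[OF p, of f] False by simp
            thus ?thesis by (simp add: coeff_eq_0)
          qed
        qed
      qed
      thus ?thesis by blast
    qed
  qed
  show ?thesis
    by (intro exI[of _ G] conjI GR finG ballI allI impI match)
qed

end

definition term_functions :: "'a::field set \<Rightarrow> ((nat \<Rightarrow> 'a) \<Rightarrow> 'a) set" where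
  "term_functions P = {\<lambda>e. valued.veval e \<tau> |\<tau>. set_vt \<tau> \<subseteq> P}"

context acvf
begin

lemma term_functionsI: "set_vt \<tau> \<subseteq> P \<Longrightarrow> (\<lambda>e. veval e \<tau>) \<in> term_functions P"
  unfolding term_functions_def by blast

lemma function_algebra_term_functions:
  fixes P :: "'a set"
  shows "function_algebra (term_functions P)"
proof -
  have "\<exists>\<tau>::'a vterm. set_vt \<tau> \<subseteq> P \<and> (\<forall>e. veval e \<tau> = of_nat n)" for n
  proof (induction n)
    case 0
    show ?case by (rule exI[of _ VZero]) simp
  next
    case (Suc n)
    then obtain \<tau> :: "'a vterm" where "set_vt \<tau> \<subseteq> P" "\<forall>e. veval e \<tau> = of_nat n" by blast
    thus ?case by (intro exI[of _ "VAdd VOne \<tau>"]) simp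
  qed
  hence "(\<lambda>_. of_nat n) \<in> term_functions P" for n
    unfolding term_functions_def mem_Collect_eq by metis
  moreover have "(\<lambda>e. f e + g e) \<in> term_functions P \<and> (\<lambda>e. f e * g e) \<in> term_functions P"
    if fg: "f \<in> term_functions P" "g \<in> term_functions P" for f g
  proof -
    obtain \<sigma> \<tau> where "f = (\<lambda>e. veval e \<sigma>)" "g = (\<lambda>e. veval e \<tau>)" "set_vt \<sigma> \<subseteq> P" "set_vt \<tau> \<subseteq> P"
      using fg unfolding term_functions_def by auto
    thus ?thesis using term_functionsI[of "VAdd \<sigma> \<tau>" P] term_functionsI[of "VMul \<sigma> \<tau>" P] by simp
  qed
  moreover have "(\<lambda>e. - f e) \<in> term_functions P" if f: "f \<in> term_functions P" for f
  proof -
    obtain \<sigma> where "f = (\<lambda>e. veval e \<sigma>)" "set_vt \<sigma> \<subseteq> P"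
      using f unfolding term_functions_def by auto
    thus ?thesis using term_functionsI[of "VNeg \<sigma>" P] by simp
  qed
  ultimately show ?thesis unfolding function_algebra_def by blast
qed

lemma term_as_polynomial:
  fixes P :: "'a set"
  assumes "set_vt \<tau> \<subseteq> P"
  shows "\<exists>p\<in>poly_family (term_functions P). \<forall>e a. veval (e(i := a)) \<tau> = poly (p e) a"
  using assms
proof (induction \<tau>)
  case (VVar j)
  show ?case
  proof (cases "j = i")
    case True
    show ?thesis
      by (intro bexI[of _ "\<lambda>_. [:0, 1:]"] poly_family_X function_algebra_term_functions)
        (simp add: True)
  next
    case False
    show ?thesis using term_functionsI[of "VVar j" P] False
      by (intro bexI[of _ "\<lambda>e. [:e j:]"] poly_family_const function_algebra_term_functions) simp_all
  qed
next
  case (VConst c)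
  thus ?case using term_functionsI[of "VConst c" P]
    by (intro bexI[of _ "\<lambda>e. [:c:]"] poly_family_const function_algebra_term_functions) simp_all
next
  case VZero
  show ?case using term_functionsI[of VZero P]
    by (intro bexI[of _ "\<lambda>e. [:0:]"] poly_family_const function_algebra_term_functions) simp_all
next
  case VOne
  show ?case using term_functionsI[of VOne P]
    by (intro bexI[of _ "\<lambda>e. [:1:]"] poly_family_const function_algebra_term_functions) simp_all
next
  case (VNeg \<tau>)
  hence "set_vt \<tau> \<subseteq> P" by simp
  from VNeg.IH[OF this] obtain p where p: "p \<in> poly_family (term_functions P)"
    and "\<forall>e a. veval (e(i := a)) \<tau> = poly (p e) a" by blast
  thus ?case
    by (intro bexI[OF _ poly_family_uminus[OF function_algebra_term_functions p]])
      (simp_all del: fun_upd_apply)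
next
  case (VAdd \<sigma> \<tau>)
  hence "set_vt \<sigma> \<subseteq> P" "set_vt \<tau> \<subseteq> P" by simp_all
  with VAdd.IH obtain p q where pq: "p \<in> poly_family (term_functions P)"
    "q \<in> poly_family (term_functions P)"
    and "\<forall>e a. veval (e(i := a)) \<sigma> = poly (p e) a" "\<forall>e a. veval (e(i := a)) \<tau> = poly (q e) a"
    by meson
  thus ?case
    by (intro bexI[OF _ poly_family_add[OF function_algebra_term_functions pq]])
      (simp_all del: fun_upd_apply)
next
  case (VMul \<sigma> \<tau>)
  hence "set_vt \<sigma> \<subseteq> P" "set_vt \<tau> \<subseteq> P" by simp_all
  with VMul.IH obtain p q where pq: "p \<in> poly_family (term_functions P)"
    "q \<in> poly_family (term_functions P)"
    and "\<forall>e a. veval (e(i := a)) \<sigma> = poly (p e) a" "\<forall>e a. veval (e(i := a)) \<tau> = poly (q e) a"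
    by meson
  thus ?case
    by (intro bexI[OF _ poly_family_mult[OF function_algebra_term_functions pq]])
      (simp_all del: fun_upd_apply)
qed

definition rv_determined :: "'a set \<Rightarrow> ((nat \<Rightarrow> 'a) \<Rightarrow> 'x) \<Rightarrow> bool" where
  "rv_determined P f \<longleftrightarrow>
     (\<exists>G\<subseteq>term_functions P. finite G \<and> (\<forall>e e'. rv_agree G e e' \<longrightarrow> f e = f e'))"

lemma rv_determinedI:
  assumes "G \<subseteq> term_functions P" "finite G" "\<And>e e'. rv_agree G e e' \<Longrightarrow> f e = f e'"
  shows "rv_determined P f"
  unfolding rv_determined_def by (intro exI[of _ G] conjI allI impI assms)

lemma rv_determined_const: "rv_determined P (\<lambda>_. c)"
  by (rule rv_determinedI[of "{}"]) auto

lemma rv_determined_app: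
  assumes "rv_determined P f"
  shows "rv_determined P (\<lambda>e. h (f e))"
proof -
  obtain G where G: "G \<subseteq> term_functions P" "finite G" "\<forall>e e'. rv_agree G e e' \<longrightarrow> f e = f e'"
    using assms unfolding rv_determined_def by (elim exE conjE)
  show ?thesis
    by (rule rv_determinedI[OF G(1,2)]) (rule arg_cong[where f = h], use G(3) in simp)
qed

lemma rv_determined_app2:
  assumes "rv_determined P f" "rv_determined P g"
  shows "rv_determined P (\<lambda>e. h (f e) (g e))"
proof -
  obtain G where G: "G \<subseteq> term_functions P" "finite G" "\<forall>e e'. rv_agree G e e' \<longrightarrow> f e = f e'"
    using assms(1) unfolding rv_determined_def by (elim exE conjE)
  obtain H where H: "H \<subseteq> term_functions P" "finite H" "\<forall>e e'. rv_agree H e e' \<longrightarrow> g e = g e'"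
    using assms(2) unfolding rv_determined_def by (elim exE conjE)
  show ?thesis
  proof (rule rv_determinedI[of "G \<union> H"])
    fix e e' assume "rv_agree (G \<union> H) e e'"
    hence "rv_agree G e e'" "rv_agree H e e'" by (auto simp: rv_agree_def)
    hence "f e = f e'" "g e = g e'" using G(3) H(3) by blast+
    thus "h (f e) (g e) = h (f e') (g e')" by simp
  qed (use G H in auto)
qed

lemma rv_determined_rv_term:
  "set_vt u \<subseteq> P \<Longrightarrow> rv_determined P (\<lambda>e. rv (veval e u))"
  using term_functionsI[of u P] by (intro rv_determinedI[of "{\<lambda>e. veval e u}"]) (auto simp: rv_agree_def)

lemma rterm_rv_determined:
  fixes s :: "('a, 'a set) rterm"
  assumes "set1_rterm s \<subseteq> P"
  shows "rv_determined P (\<lambda>e d. reval e d s)"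
  using assms
proof (induction s)
  case (RMul s t)
  hence "rv_determined P (\<lambda>e d. reval e d s)" "rv_determined P (\<lambda>e d. reval e d t)" by auto
  from rv_determined_app2[OF this, of "\<lambda>f g d. rv_mult (f d) (g d)"] show ?case by simp
next
  case (Rv u)
  hence "rv_determined P (\<lambda>e. rv (veval e u))" by (intro rv_determined_rv_term) auto
  from rv_determined_app[OF this, of "\<lambda>t d. t"] show ?case by simp
qed (auto intro: rv_determined_const)

text \<open>Elimination of the quantifiers over VF. Both environments are used with the same values of the
  RV-variables, so that quantifiers over RV do no harm and no normal form of the formula is needed.
  A quantifier over VF is moved from one environment to the other by \<open>point_matching\<close>, applied to
  the polynomials that determine the body of the formula.\<close>

theorem formula_rv_determined:
  fixes \<phi> :: "('a, 'a set) fm"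
  assumes "vparams \<phi> \<subseteq> P"
  shows "rv_determined P (\<lambda>e d. sat e d \<phi>)"
  using assms
proof (induction \<phi>)
  case (VEq u v)
  have "set_vt (VAdd u (VNeg v)) \<subseteq> P" using VEq by simp
  from rv_determined_app[OF rv_determined_rv_term[OF this], of "\<lambda>t d. t = rv 0"]
  show ?case by simp
next
  case (REq s t)
  hence "rv_determined P (\<lambda>e d. reval e d s)" "rv_determined P (\<lambda>e d. reval e d t)"
    by (auto intro: rterm_rv_determined)
  from rv_determined_app2[OF this, of "\<lambda>f g d. f d = g d"] show ?case by simp
next
  case (ResUnit t)
  hence "rv_determined P (\<lambda>e d. reval e d t)" by (auto intro: rterm_rv_determined)
  from rv_determined_app[OF this, of "\<lambda>f d. f d \<in> res_units"] show ?case by simp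
next
  case (ResAdd r s t)
  hence r: "rv_determined P (\<lambda>e d. reval e d r)" and s: "rv_determined P (\<lambda>e d. reval e d s)"
    and t: "rv_determined P (\<lambda>e d. reval e d t)"
    by (auto intro: rterm_rv_determined)
  from rv_determined_app2[OF rv_determined_app2[OF r s, of Pair] t,
      of "\<lambda>p f d. res_add (fst p d) (snd p d) (f d)"]
  show ?case by simp
next
  case (Neg \<phi>)
  hence "rv_determined P (\<lambda>e d. sat e d \<phi>)" by simp
  from rv_determined_app[OF this, of "\<lambda>f d. \<not> f d"] show ?case by simp
next
  case (Conj \<phi> \<psi>)
  hence "rv_determined P (\<lambda>e d. sat e d \<phi>)" "rv_determined P (\<lambda>e d. sat e d \<psi>)" by simp_all
  from rv_determined_app2[OF this, of "\<lambda>f g d. f d \<and> g d"] show ?case by simp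
next
  case (ExV i \<phi>)
  hence "rv_determined P (\<lambda>e d. sat e d \<phi>)" by simp
  then obtain G where G: "G \<subseteq> term_functions P" "finite G"
    "\<forall>e e'. rv_agree G e e' \<longrightarrow> (\<lambda>d. sat e d \<phi>) = (\<lambda>d. sat e' d \<phi>)"
    unfolding rv_determined_def by (elim exE conjE)
  have "\<exists>p. p \<in> poly_family (term_functions P) \<and> (\<forall>e a. g (e(i := a)) = poly (p e) a)" if g: "g \<in> G" for g
  proof -
    obtain \<tau> where "set_vt \<tau> \<subseteq> P" "g = (\<lambda>e. veval e \<tau>)"
      using g G(1) unfolding term_functions_def by auto
    thus ?thesis using term_as_polynomial[of \<tau> P i] by blast
  qed
  then obtain p where p: "\<forall>g\<in>G. p g \<in> poly_family (term_functions P) \<and>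
      (\<forall>e a. g (e(i := a)) = poly (p g e) a)" by metis
  hence "finite (p ` G)" "p ` G \<subseteq> poly_family (term_functions P)" using G(2) by auto
  from point_matching[OF function_algebra_term_functions this]
  obtain H where H: "H \<subseteq> term_functions P" "finite H"
    "\<forall>e e'. rv_agree H e e' \<longrightarrow> (\<forall>a. \<exists>a'. \<forall>q\<in>p ` G. rv (poly (q e') a') = rv (poly (q e) a))"
    by (elim exE conjE)
  have step: "sat e' d (ExV i \<phi>)" if agree: "rv_agree H e e'" and sat: "sat e d (ExV i \<phi>)" for e e' d
  proof -
    obtain a where a: "sat (e(i := a)) d \<phi>" using sat by auto
    obtain a' where a': "\<forall>q\<in>p ` G. rv (poly (q e') a') = rv (poly (q e) a)"
      using H(3)[rule_format, OF agree] by blast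
    have "rv_agree G (e(i := a)) (e'(i := a'))"
      unfolding rv_agree_def using a' p by auto
    with G(3) have "(\<lambda>d. sat (e(i := a)) d \<phi>) = (\<lambda>d. sat (e'(i := a')) d \<phi>)" by blast
    hence "sat (e'(i := a')) d \<phi>" using a by metis
    thus ?thesis by auto
  qed
  show ?case
  proof (rule rv_determinedI[OF H(1,2)], rule ext)
    fix e e' d assume "rv_agree H e e'"
    thus "sat e d (ExV i \<phi>) = sat e' d (ExV i \<phi>)"
      using step[of e e' d] step[of e' e d] by (auto simp del: sat.simps simp: rv_agree_def)
  qed
next
  case (ExR i \<phi>)
  hence "rv_determined P (\<lambda>e d. sat e d \<phi>)" by simp
  from rv_determined_app[OF this, of "\<lambda>f d. \<exists>t\<in>RV. f (d(i := t))"] show ?case by simp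
qed


section \<open>Definable relations\<close>

definition rterm_functions :: "'a params \<Rightarrow> ((nat \<Rightarrow> 'a) \<Rightarrow> (nat \<Rightarrow> 'a set) \<Rightarrow> 'a set) set" where
  "rterm_functions P = {\<lambda>e d. reval e d s |s. set1_rterm s \<subseteq> fst P \<and> set2_rterm s \<subseteq> snd P}"

text \<open>Definability of relations between environments. These are closed under the logical connectives
  and quantifiers by rules that can be chained, with variables playing the role of coordinates.\<close>

definition defin :: "'a params \<Rightarrow> ((nat \<Rightarrow> 'a) \<Rightarrow> (nat \<Rightarrow> 'a set) \<Rightarrow> bool) \<Rightarrow> bool" where
  "defin P R \<longleftrightarrow> (\<exists>\<phi>. fm_over P \<phi> \<and> (\<forall>e d. range d \<subseteq> RV \<longrightarrow> sat e d \<phi> = R e d))"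

lemma rv_in_RV [simp]: "rv x \<in> RV"
  by (simp add: RV_def)

lemma tf_var: "(\<lambda>e. e i) \<in> term_functions (P :: 'a set)"
  using term_functionsI[of "VVar i" P] by simp

lemma tf_const: "c \<in> P \<Longrightarrow> (\<lambda>e. c) \<in> term_functions (P :: 'a set)"
  using term_functionsI[of "VConst c" P] by simp

lemmas tf_ops =
  fa_zero[OF function_algebra_term_functions] fa_one[OF function_algebra_term_functions]
  fa_of_nat[OF function_algebra_term_functions] fa_add[OF function_algebra_term_functions]
  fa_diff[OF function_algebra_term_functions] fa_mult[OF function_algebra_term_functions]
  fa_sum[OF function_algebra_term_functions]

lemma rtf_var: "(\<lambda>e d. d i) \<in> rterm_functions P"
  unfolding rterm_functions_def mem_Collect_eq by (intro exI[of _ "RVar i"]) auto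

lemma rtf_const: "c \<in> snd P \<Longrightarrow> (\<lambda>e d. c) \<in> rterm_functions P"
  unfolding rterm_functions_def mem_Collect_eq by (intro exI[of _ "RConst c"]) auto

lemma rtf_rv: "f \<in> term_functions (fst P) \<Longrightarrow> (\<lambda>e d. rv (f e)) \<in> rterm_functions P"
proof -
  assume "f \<in> term_functions (fst P)"
  then obtain \<tau> where "set_vt \<tau> \<subseteq> fst P" "f = (\<lambda>e. veval e \<tau>)" by (auto simp: term_functions_def)
  thus ?thesis unfolding rterm_functions_def mem_Collect_eq by (intro exI[of _ "Rv \<tau>"]) auto
qed

lemma definI:
  assumes "fm_over P \<phi>" "\<And>e d. range d \<subseteq> RV \<Longrightarrow> sat e d \<phi> = R e d"
  shows "defin P R"
  unfolding defin_def using assms by blast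

lemma definE:
  assumes "defin P R"
  obtains \<phi> where "fm_over P \<phi>" "\<forall>e d. range d \<subseteq> RV \<longrightarrow> sat e d \<phi> = R e d"
  using assms unfolding defin_def by (elim exE conjE)

lemma defin_eqR:
  assumes "f \<in> rterm_functions P" "g \<in> rterm_functions P"
  shows "defin P (\<lambda>e d. f e d = g e d)"
proof -
  obtain s where "set1_rterm s \<subseteq> fst P" "set2_rterm s \<subseteq> snd P" "f = (\<lambda>e d. reval e d s)"
    using assms(1) by (auto simp: rterm_functions_def)
  moreover obtain t where "set1_rterm t \<subseteq> fst P" "set2_rterm t \<subseteq> snd P" "g = (\<lambda>e d. reval e d t)"
    using assms(2) by (auto simp: rterm_functions_def)
  ultimately show ?thesis by (intro definI[of P "REq s t"]) (auto simp: fm_over_def)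
qed

lemma defin_eqV:
  assumes "f \<in> term_functions (fst P)" "g \<in> term_functions (fst P)"
  shows "defin P (\<lambda>e d. f e = g e)"
proof -
  obtain s where "set_vt s \<subseteq> fst P" "f = (\<lambda>e. veval e s)"
    using assms(1) by (auto simp: term_functions_def)
  moreover obtain t where "set_vt t \<subseteq> fst P" "g = (\<lambda>e. veval e t)"
    using assms(2) by (auto simp: term_functions_def)
  ultimately show ?thesis by (intro definI[of P "VEq s t"]) (auto simp: fm_over_def)
qed

lemma defin_not:
  assumes "defin P R"
  shows "defin P (\<lambda>e d. \<not> R e d)"
proof -
  obtain \<phi> where "fm_over P \<phi>" "\<forall>e d. range d \<subseteq> RV \<longrightarrow> sat e d \<phi> = R e d"
    using assms by (rule definE)
  thus ?thesis by (intro definI[of P "Neg \<phi>"]) (auto simp: fm_over_def)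
qed

lemma defin_conj:
  assumes "defin P R" "defin P R'"
  shows "defin P (\<lambda>e d. R e d \<and> R' e d)"
proof -
  obtain \<phi> where "fm_over P \<phi>" "\<forall>e d. range d \<subseteq> RV \<longrightarrow> sat e d \<phi> = R e d"
    using assms(1) by (rule definE)
  moreover obtain \<psi> where "fm_over P \<psi>" "\<forall>e d. range d \<subseteq> RV \<longrightarrow> sat e d \<psi> = R' e d"
    using assms(2) by (rule definE)
  ultimately show ?thesis by (intro definI[of P "Conj \<phi> \<psi>"]) (auto simp: fm_over_def)
qed

lemma defin_imp: "defin P R \<Longrightarrow> defin P R' \<Longrightarrow> defin P (\<lambda>e d. R e d \<longrightarrow> R' e d)"
  using defin_not[OF defin_conj[OF _ defin_not, of P R R']] by simp

lemma defin_const: "defin P (\<lambda>e d. b)"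
  using defin_eqV[OF tf_ops(1) tf_ops(1), of P] defin_not[OF defin_eqV[OF tf_ops(1) tf_ops(1), of P]]
  by (cases b) auto

lemma defin_exV:
  assumes "defin P R"
  shows "defin P (\<lambda>e d. \<exists>a. R (e(i := a)) d)"
proof -
  from assms obtain \<phi> where "fm_over P \<phi>" "\<forall>e d. range d \<subseteq> RV \<longrightarrow> sat e d \<phi> = R e d"
    by (rule definE)
  thus ?thesis by (intro definI[of P "ExV i \<phi>"]) (auto simp: fm_over_def simp del: fun_upd_apply)
qed

lemma defin_allV: "defin P R \<Longrightarrow> defin P (\<lambda>e d. \<forall>a. R (e(i := a)) d)"
  using defin_not[OF defin_exV[OF defin_not, of P R i]] by simp

lemma range_upd: "range d \<subseteq> RV \<Longrightarrow> t \<in> RV \<Longrightarrow> range (d(i := t)) \<subseteq> RV"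
  by auto

lemma defin_exR:
  assumes "defin P R"
  shows "defin P (\<lambda>e d. \<exists>t\<in>RV. R e (d(i := t)))"
proof -
  from assms obtain \<phi> where \<phi>: "fm_over P \<phi>" "\<forall>e d. range d \<subseteq> RV \<longrightarrow> sat e d \<phi> = R e d"
    by (rule definE)
  show ?thesis
  proof (rule definI[of P "ExR i \<phi>"])
    fix e and d :: "nat \<Rightarrow> 'a set" assume "range d \<subseteq> RV"
    thus "sat e d (ExR i \<phi>) = (\<exists>t\<in>RV. R e (d(i := t)))"
      using \<phi>(2)[rule_format, OF range_upd[of d]] by simp
  qed (use \<phi>(1) in \<open>simp add: fm_over_def\<close>)
qed

lemma defin_ball:
  "finite I \<Longrightarrow> (\<And>i. i \<in> I \<Longrightarrow> defin P (R i)) \<Longrightarrow> defin P (\<lambda>e d. \<forall>i\<in>I. R i e d)"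
  by (induction I rule: finite_induct) (auto intro: defin_const defin_conj)

lemma defin_exVs:
  assumes "defin P R"
  shows "defin P (\<lambda>e d. \<exists>e'. (\<forall>j. j \<notin> set js \<longrightarrow> e' j = e j) \<and> R e' d)"
proof (induction js)
  case Nil
  have "(\<exists>e'. (\<forall>j. j \<notin> set [] \<longrightarrow> e' j = e j) \<and> R e' d) = R e d" for e d
    by (auto simp flip: fun_eq_iff)
  thus ?case using assms by simp
next
  case (Cons i js)
  have "(\<exists>e'. (\<forall>j. j \<notin> set (i # js) \<longrightarrow> e' j = e j) \<and> R e' d)
      = (\<exists>a e'. (\<forall>j. j \<notin> set js \<longrightarrow> e' j = (e(i := a)) j) \<and> R e' d)" for e d
  proof
    assume "\<exists>e'. (\<forall>j. j \<notin> set (i # js) \<longrightarrow> e' j = e j) \<and> R e' d"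
    then obtain e' where "\<forall>j. j \<notin> set (i # js) \<longrightarrow> e' j = e j" "R e' d" by blast
    thus "\<exists>a e'. (\<forall>j. j \<notin> set js \<longrightarrow> e' j = (e(i := a)) j) \<and> R e' d"
      by (intro exI[of _ "e' i"] exI[of _ e']) auto
  next
    assume "\<exists>a e'. (\<forall>j. j \<notin> set js \<longrightarrow> e' j = (e(i := a)) j) \<and> R e' d"
    then obtain a e' where "\<forall>j. j \<notin> set js \<longrightarrow> e' j = (e(i := a)) j" "R e' d" by blast
    thus "\<exists>e'. (\<forall>j. j \<notin> set (i # js) \<longrightarrow> e' j = e j) \<and> R e' d"
      by (intro exI[of _ e']) auto
  qed
  thus ?case using defin_exV[OF Cons.IH, of i] by simp
qed

lemma defin_exRs:
  assumes "defin P R"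
  shows "defin P (\<lambda>e d. \<exists>d'. (\<forall>j. j \<notin> set js \<longrightarrow> d' j = d j) \<and> (\<forall>j\<in>set js. d' j \<in> RV) \<and> R e d')"
proof (induction js)
  case Nil
  have "(\<exists>d'. (\<forall>j. j \<notin> set [] \<longrightarrow> d' j = d j) \<and> (\<forall>j\<in>set []. d' j \<in> RV) \<and> R e d') = R e d" for e d
    by (auto simp flip: fun_eq_iff)
  thus ?case using assms by simp
next
  case (Cons i js)
  have eq: "(\<exists>d'. (\<forall>j. j \<notin> set (i # js) \<longrightarrow> d' j = d j) \<and> (\<forall>j\<in>set (i # js). d' j \<in> RV) \<and> R e d')
      = (\<exists>t\<in>RV. \<exists>d'. (\<forall>j. j \<notin> set js \<longrightarrow> d' j = (d(i := t)) j) \<and> (\<forall>j\<in>set js. d' j \<in> RV) \<and> R e d')"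
    for e and d :: "nat \<Rightarrow> 'a set"
  proof
    assume "\<exists>d'. (\<forall>j. j \<notin> set (i # js) \<longrightarrow> d' j = d j) \<and> (\<forall>j\<in>set (i # js). d' j \<in> RV) \<and> R e d'"
    then obtain d' where "\<forall>j. j \<notin> set (i # js) \<longrightarrow> d' j = d j" "\<forall>j\<in>set (i # js). d' j \<in> RV" "R e d'"
      by blast
    thus "\<exists>t\<in>RV. \<exists>d'. (\<forall>j. j \<notin> set js \<longrightarrow> d' j = (d(i := t)) j) \<and> (\<forall>j\<in>set js. d' j \<in> RV) \<and> R e d'"
      by (intro bexI[of _ "d' i"] exI[of _ d']) auto
  next
    assume "\<exists>t\<in>RV. \<exists>d'. (\<forall>j. j \<notin> set js \<longrightarrow> d' j = (d(i := t)) j) \<and> (\<forall>j\<in>set js. d' j \<in> RV) \<and> R e d'"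
    then obtain t d' where "t \<in> RV" "\<forall>j. j \<notin> set js \<longrightarrow> d' j = (d(i := t)) j"
      "\<forall>j\<in>set js. d' j \<in> RV" "R e d'"
      by blast
    thus "\<exists>d'. (\<forall>j. j \<notin> set (i # js) \<longrightarrow> d' j = d j) \<and> (\<forall>j\<in>set (i # js). d' j \<in> RV) \<and> R e d'"
      by (intro exI[of _ d']) (cases "i \<in> set js", auto)
  qed
  show ?case using defin_exR[OF Cons.IH, of i] unfolding eq .
qed

text \<open>The values of terms and formulas depend on finitely many variables.\<close>

definition supported :: "nat \<Rightarrow> ((nat \<Rightarrow> 'a) \<Rightarrow> (nat \<Rightarrow> 'a set) \<Rightarrow> 'x) \<Rightarrow> bool" where
  "supported K f \<longleftrightarrow> (\<forall>e e' d d'. (\<forall>i<K. e i = e' i) \<and> (\<forall>i<K. d i = d' i) \<longrightarrow> f e d = f e' d')"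

lemma supportedD:
  assumes "supported K f" "\<And>i. i < K \<Longrightarrow> e i = e' i" "\<And>i. i < K \<Longrightarrow> d i = d' i"
  shows "f e d = f e' d'"
  using assms(1)[unfolded supported_def, rule_format, of e e' d d'] assms(2,3) by simp

lemma supported_mono:
  assumes "supported K f" "K \<le> L"
  shows "supported L f"
  unfolding supported_def
proof (intro allI impI)
  fix e e' :: "nat \<Rightarrow> 'a" and d d' :: "nat \<Rightarrow> 'a set"
  assume "(\<forall>i<L. e i = e' i) \<and> (\<forall>i<L. d i = d' i)"
  thus "f e d = f e' d'" using assms(2) by (intro supportedD[OF assms(1)]) auto
qed

lemma supported_app2:
  assumes "supported K f" "supported L g"
  shows "supported (max K L) (\<lambda>e d. h (f e d) (g e d))"
  unfolding supported_def
proof (intro allI impI)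
  fix e e' :: "nat \<Rightarrow> 'a" and d d' :: "nat \<Rightarrow> 'a set"
  assume "(\<forall>i<max K L. e i = e' i) \<and> (\<forall>i<max K L. d i = d' i)"
  hence "f e d = f e' d'" "g e d = g e' d'"
    by (intro supportedD[OF assms(1)] supportedD[OF assms(2)]; simp)+
  thus "h (f e d) (g e d) = h (f e' d') (g e' d')" by simp
qed

lemma supported_app: "supported K f \<Longrightarrow> supported K (\<lambda>e d. h (f e d))"
  using supported_app2[of K f K f "\<lambda>x y. h x"] by simp

lemma supported_const: "supported 0 (\<lambda>e d. c)"
  by (simp add: supported_def)

lemma ex_supported_veval: "\<exists>K. supported K (\<lambda>e d. veval e \<tau>)"
proof (induction \<tau>)
  case (VVar i)
  show ?case by (intro exI[of _ "Suc i"]) (auto simp: supported_def)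
next
  case (VNeg t)
  then obtain K where "supported K (\<lambda>e d. veval e t)" by blast
  from supported_app[OF this, of uminus] show ?case by auto
next
  case (VAdd s t)
  then obtain K L where "supported K (\<lambda>e d. veval e s)" "supported L (\<lambda>e d. veval e t)" by blast
  from supported_app2[OF this, of "(+)"] show ?case by auto
next
  case (VMul s t)
  then obtain K L where "supported K (\<lambda>e d. veval e s)" "supported L (\<lambda>e d. veval e t)" by blast
  from supported_app2[OF this, of "(*)"] show ?case by auto
qed (auto intro: supported_const)

lemma ex_supported_reval: "\<exists>K. supported K (\<lambda>e d. reval e d s)"
proof (induction s)
  case (RVar i)
  show ?case by (intro exI[of _ "Suc i"]) (auto simp: supported_def)
next
  case (RConst c)
  show ?case by (auto simp: supported_def)
next
  case (RMul s t)
  then obtain K L where "supported K (\<lambda>e d. reval e d s)" "supported L (\<lambda>e d. reval e d t)" by blast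
  from supported_app2[OF this, of rv_mult] show ?case by auto
next
  case (Rv u)
  obtain K where "supported K (\<lambda>e d. veval e u)" using ex_supported_veval by blast
  from supported_app[OF this, of rv] show ?case by auto
qed

lemma ex_supported_sat: "\<exists>K. supported K (\<lambda>e d. sat e d \<phi>)"
proof (induction \<phi>)
  case (VEq u v)
  obtain K L where "supported K (\<lambda>e d. veval e u)" "supported L (\<lambda>e d. veval e v)"
    using ex_supported_veval by metis
  from supported_app2[OF this, of "(=)"] show ?case by auto
next
  case (REq s t)
  obtain K L where "supported K (\<lambda>e d. reval e d s)" "supported L (\<lambda>e d. reval e d t)"
    using ex_supported_reval by metis
  from supported_app2[OF this, of "(=)"] show ?case by auto
next
  case (ResUnit t)
  obtain K where "supported K (\<lambda>e d. reval e d t)" using ex_supported_reval by metis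
  from supported_app[OF this, of "\<lambda>t. t \<in> res_units"] show ?case by auto
next
  case (ResAdd r s t)
  obtain K L M where r: "supported K (\<lambda>e d. reval e d r)" and s: "supported L (\<lambda>e d. reval e d s)"
    and t: "supported M (\<lambda>e d. reval e d t)"
    using ex_supported_reval by metis
  from supported_app2[OF supported_app2[OF r s, of Pair] t, of "\<lambda>p t. res_add (fst p) (snd p) t"]
  show ?case by auto
next
  case (Neg \<phi>)
  then obtain K where "supported K (\<lambda>e d. sat e d \<phi>)" by blast
  from supported_app[OF this, of Not] show ?case by auto
next
  case (Conj \<phi> \<psi>)
  then obtain K L where "supported K (\<lambda>e d. sat e d \<phi>)" "supported L (\<lambda>e d. sat e d \<psi>)" by blast
  from supported_app2[OF this, of "(\<and>)"] show ?case by auto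
next
  case (ExV i \<phi>)
  then obtain K where K: "supported K (\<lambda>e d. sat e d \<phi>)" by blast
  have "sat (e(i := a)) d \<phi> = sat (e'(i := a)) d' \<phi>" if "\<forall>i<K. e i = e' i" "\<forall>i<K. d i = d' i" for e e' d d' a
    using that by (intro supportedD[OF K]) auto
  hence "supported K (\<lambda>e d. sat e d (ExV i \<phi>))" unfolding supported_def sat.simps by blast
  thus ?case ..
next
  case (ExR i \<phi>)
  then obtain K where K: "supported K (\<lambda>e d. sat e d \<phi>)" by blast
  have "sat e (d(i := t)) \<phi> = sat e' (d'(i := t)) \<phi>" if "\<forall>i<K. e i = e' i" "\<forall>i<K. d i = d' i" for e e' d d' t
    using that by (intro supportedD[OF K]) auto
  hence "supported K (\<lambda>e d. sat e d (ExR i \<phi>))" unfolding supported_def sat.simps by blast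
  thus ?case ..
qed

lemma ex_supported_all:
  assumes "finite F" "\<And>f. f \<in> F \<Longrightarrow> \<exists>K. supported K f"
  shows "\<exists>K. \<forall>f\<in>F. supported K f"
  using assms
proof (induction F)
  case (insert f F)
  obtain K where K: "\<And>g. g \<in> F \<Longrightarrow> supported K g" using insert by blast
  obtain L where L: "supported L f" using insert.prems by blast
  have "supported (max K L) g" if "g \<in> insert f F" for g
    using that supported_mono[OF K, of g "max K L"] supported_mono[OF L, of "max K L"] by auto
  thus ?case by blast
qed auto

definition params_le :: "'a params \<Rightarrow> 'a params \<Rightarrow> bool" where
  "params_le P P' \<longleftrightarrow> fst P \<subseteq> fst P' \<and> snd P \<subseteq> snd P'"

lemma params_le_refl [simp]: "params_le P P"
  and params_le_extend [simp]: "params_le P (extend_params P p)"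
  by (auto simp: params_le_def extend_params_def)

text \<open>Substitution of terms into a definable set. The values of the terms are copied to fresh
  variables before the variables of the formula are assigned, which avoids capture.\<close>

lemma defin_mem:
  assumes Z: "definable P n m Z" and PP': "params_le P P'"
    and fs: "length fs = n" "set fs \<subseteq> term_functions (fst P')"
    and gs: "length gs = m" "set gs \<subseteq> rterm_functions P'"
  shows "defin P' (\<lambda>e d. (map (\<lambda>f. f e) fs, map (\<lambda>g. g e d) gs) \<in> Z)"
proof -
  obtain \<phi> where \<phi>: "fm_over P \<phi>" "Z = {p \<in> space n m. holds p \<phi>}"
    using Z unfolding definable_def by blast
  have "\<exists>K. supported K f" if f: "f \<in> (\<lambda>f e d. {f e}) ` set fs \<union> set gs" for f
  proof -
    consider g where "g \<in> set fs" "f = (\<lambda>e d. {g e})" | "f \<in> set gs" using f by blast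
    thus ?thesis
    proof cases
      case 1
      then obtain \<tau> where "g = (\<lambda>e. veval e \<tau>)" using fs(2) by (auto simp: term_functions_def)
      moreover obtain K where "supported K (\<lambda>e d. veval e \<tau>)" using ex_supported_veval by blast
      ultimately show ?thesis using supported_app[of K "\<lambda>e d. veval e \<tau>" "\<lambda>x. {x}"] 1 by auto
    next
      case 2
      thus ?thesis using gs(2) ex_supported_reval by (auto simp: rterm_functions_def)
    qed
  qed
  then obtain K1 where K1: "\<forall>f\<in>(\<lambda>f e d. {f e}) ` set fs \<union> set gs. supported K1 f"
    using ex_supported_all[of "(\<lambda>f e d. {f e}) ` set fs \<union> set gs"] by blast
  obtain K2 where K2: "supported K2 (\<lambda>e d. sat e d \<phi>)" using ex_supported_sat by blast
  define K where "K = Max {K1, K2, n, m}"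
  have K: "K1 \<le> K" "K2 \<le> K" "n \<le> K" "m \<le> K" by (auto simp: K_def)
  have supp_fs: "f e = f e'" if "f \<in> set fs" "\<And>i. i < K \<Longrightarrow> e i = e' i" for f e e'
  proof -
    have "supported K (\<lambda>e d. {f e})" using that(1) K1 K(1) by (auto intro: supported_mono)
    hence "{f e} = {f e'}" by (rule supportedD[where d = "\<lambda>_. {}" and d' = "\<lambda>_. {}"]) (use that in auto)
    thus ?thesis by simp
  qed
  have supp_gs: "g e d = g e' d'"
    if "g \<in> set gs" "\<And>i. i < K \<Longrightarrow> e i = e' i" "\<And>i. i < K \<Longrightarrow> d i = d' i" for g e e' d d'
  proof -
    have "supported K g" using that(1) K1 K(1) by (auto intro: supported_mono)
    thus ?thesis by (rule supportedD) (use that in auto)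
  qed
  have supp_\<phi>: "supported K (\<lambda>e d. sat e d \<phi>)" using K2 K(2) by (rule supported_mono)
  define R1 where "R1 e d \<longleftrightarrow> (\<forall>j\<in>{..<n}. e j = e (K + j)) \<and> (\<forall>j\<in>{n..<K}. e j = 0) \<and>
    (\<forall>j\<in>{..<m}. d j = d (K + j)) \<and> (\<forall>j\<in>{m..<K}. d j = rv 0) \<and> sat e d \<phi>" for e d
  have "fm_over P' \<phi>" using \<phi>(1) PP' by (auto simp: fm_over_def params_le_def)
  hence "defin P' (\<lambda>e d. sat e d \<phi>)" by (rule definI) simp
  hence R1: "defin P' R1" unfolding R1_def[abs_def]
    by (intro defin_conj defin_ball defin_eqV defin_eqR tf_var rtf_var tf_ops rtf_rv) auto
  define R2 where "R2 e d \<longleftrightarrow> (\<exists>d'. (\<forall>j. j \<notin> set [0..<K] \<longrightarrow> d' j = d j) \<and> (\<forall>j\<in>set [0..<K]. d' j \<in> RV) \<and>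
    (\<exists>e'. (\<forall>j. j \<notin> set [0..<K] \<longrightarrow> e' j = e j) \<and> R1 e' d'))" for e d
  have R2: "defin P' R2" unfolding R2_def[abs_def] by (intro defin_exRs defin_exVs R1)
  have R2_iff: "R2 e d \<longleftrightarrow> holds (map (\<lambda>j. e (K + j)) [0..<n], map (\<lambda>j. d (K + j)) [0..<m]) \<phi>"
    if d: "range d \<subseteq> RV" for e d
  proof -
    define e0 where "e0 j = (if j < n then e (K + j) else if j < K then 0 else e j)" for j
    define d0 where "d0 j = (if j < m then d (K + j) else if j < K then rv 0 else d j)" for j
    have eq: "holds (map (\<lambda>j. e (K + j)) [0..<n], map (\<lambda>j. d (K + j)) [0..<m]) \<phi> = sat e0 d0 \<phi>"
      unfolding holds_def by (rule supportedD[OF supp_\<phi>]) (auto simp: e0_def d0_def)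
    show ?thesis
    proof
      assume "R2 e d"
      then obtain d' e' where d': "\<forall>j. j \<notin> set [0..<K] \<longrightarrow> d' j = d j"
        and e': "\<forall>j. j \<notin> set [0..<K] \<longrightarrow> e' j = e j" and "R1 e' d'"
        unfolding R2_def by blast
      hence "sat e' d' \<phi>" "\<forall>j<K. e' j = e0 j" "\<forall>j<K. d' j = d0 j"
        unfolding R1_def by (auto simp: e0_def d0_def)
      thus "holds (map (\<lambda>j. e (K + j)) [0..<n], map (\<lambda>j. d (K + j)) [0..<m]) \<phi>"
        unfolding eq using supportedD[OF supp_\<phi>, of e' e0 d' d0] by blast
    next
      assume "holds (map (\<lambda>j. e (K + j)) [0..<n], map (\<lambda>j. d (K + j)) [0..<m]) \<phi>"
      hence "R1 e0 d0" unfolding eq R1_def using K by (auto simp: e0_def d0_def)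
      thus "R2 e d" unfolding R2_def using d
        by (intro exI[of _ d0] exI[of _ e0] conjI) (use K in \<open>auto simp: e0_def d0_def\<close>)
    qed
  qed
  define R3 where "R3 e d \<longleftrightarrow> (\<forall>j\<in>{..<n}. e (K + j) = (fs ! j) e) \<and>
    (\<forall>j\<in>{..<m}. d (K + j) = (gs ! j) e d) \<and> R2 e d" for e d
  have R3: "defin P' R3" unfolding R3_def[abs_def]
  proof (intro defin_conj defin_ball R2 defin_eqV defin_eqR)
    fix j assume "j \<in> {..<n}"
    thus "(fs ! j) \<in> term_functions (fst P')" using fs by (auto dest!: nth_mem)
  next
    fix j assume "j \<in> {..<m}"
    thus "(gs ! j) \<in> rterm_functions P'" using gs by (auto dest!: nth_mem)
  qed (auto intro: tf_var rtf_var)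
  define R4 where "R4 e d \<longleftrightarrow> (\<exists>d'. (\<forall>j. j \<notin> set [K..<K + m] \<longrightarrow> d' j = d j) \<and>
    (\<forall>j\<in>set [K..<K + m]. d' j \<in> RV) \<and>
    (\<exists>e'. (\<forall>j. j \<notin> set [K..<K + n] \<longrightarrow> e' j = e j) \<and> R3 e' d'))" for e d
  have R4: "defin P' R4" unfolding R4_def[abs_def] by (intro defin_exRs defin_exVs R3)
  have R4_iff: "R4 e d \<longleftrightarrow> (map (\<lambda>f. f e) fs, map (\<lambda>g. g e d) gs) \<in> Z"
    if d: "range d \<subseteq> RV" for e d
  proof
    assume "R4 e d"
    then obtain d' e' where d': "\<forall>j. j \<notin> set [K..<K + m] \<longrightarrow> d' j = d j"
      "\<forall>j\<in>set [K..<K + m]. d' j \<in> RV"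
      and e': "\<forall>j. j \<notin> set [K..<K + n] \<longrightarrow> e' j = e j" and R3': "R3 e' d'"
      unfolding R4_def by blast
    have "d' j \<in> RV" for j
    proof (cases "j \<in> set [K..<K + m]")
      case False
      thus ?thesis using d d'(1)[rule_format, OF False] by auto
    next
      case True
      thus ?thesis by (rule d'(2)[rule_format])
    qed
    hence d'RV: "range d' \<subseteq> RV" by (simp add: image_subset_iff)
    have fs': "map (\<lambda>j. e' (K + j)) [0..<n] = map (\<lambda>f. f e) fs"
    proof (rule nth_equalityI)
      fix j assume "j < length (map (\<lambda>j. e' (K + j)) [0..<n])"
      hence j: "j < n" by simp
      have "(fs ! j) e' = (fs ! j) e"
        by (rule supp_fs) (use e' j fs(1) in simp_all)
      thus "map (\<lambda>j. e' (K + j)) [0..<n] ! j = map (\<lambda>f. f e) fs ! j"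
        using R3' j fs(1) by (simp add: R3_def)
    qed (use fs in simp)
    have gs': "map (\<lambda>j. d' (K + j)) [0..<m] = map (\<lambda>g. g e d) gs"
    proof (rule nth_equalityI)
      fix j assume "j < length (map (\<lambda>j. d' (K + j)) [0..<m])"
      hence j: "j < m" by simp
      have "(gs ! j) e' d' = (gs ! j) e d"
        by (rule supp_gs) (use e' d'(1) j gs(1) in simp_all)
      thus "map (\<lambda>j. d' (K + j)) [0..<m] ! j = map (\<lambda>g. g e d) gs ! j"
        using R3' j gs(1) by (simp add: R3_def)
    qed (use gs in simp)
    have "R2 e' d'" using R3' by (simp add: R3_def)
    hence "holds (map (\<lambda>f. f e) fs, map (\<lambda>g. g e d) gs) \<phi>"
      unfolding R2_iff[OF d'RV] fs' gs' .
    moreover have "set (map (\<lambda>g. g e d) gs) \<subseteq> RV"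
      unfolding gs'[symmetric] using d'RV by auto
    ultimately show "(map (\<lambda>f. f e) fs, map (\<lambda>g. g e d) gs) \<in> Z"
      unfolding \<phi>(2) using fs(1) gs(1) by (simp add: space_def)
  next
    assume *: "(map (\<lambda>f. f e) fs, map (\<lambda>g. g e d) gs) \<in> Z"
    define e' where "e' j = (if K \<le> j \<and> j < K + n then (fs ! (j - K)) e else e j)" for j
    define d' where "d' j = (if K \<le> j \<and> j < K + m then (gs ! (j - K)) e d else d j)" for j
    have RVgs: "(gs ! j) e d \<in> RV" if "j < m" for j
      using * that gs(1) unfolding \<phi>(2) space_def by auto
    have d'RV: "range d' \<subseteq> RV" using d RVgs by (auto simp: d'_def)
    have "map (\<lambda>j. e' (K + j)) [0..<n] = map (\<lambda>f. f e) fs"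
      "map (\<lambda>j. d' (K + j)) [0..<m] = map (\<lambda>g. g e d) gs"
      using fs(1) gs(1) by (auto simp: e'_def d'_def intro!: nth_equalityI)
    hence "R2 e' d'" unfolding R2_iff[OF d'RV] using * unfolding \<phi>(2) by simp
    moreover have "(fs ! j) e' = (fs ! j) e" if "j < n" for j
      by (rule supp_fs) (use that fs(1) in \<open>simp_all add: e'_def\<close>)
    moreover have "(gs ! j) e' d' = (gs ! j) e d" if "j < m" for j
      by (rule supp_gs) (use that gs(1) in \<open>simp_all add: e'_def d'_def\<close>)
    ultimately have "R3 e' d'" unfolding R3_def by (auto simp: e'_def d'_def)
    thus "R4 e d" unfolding R4_def
      by (intro exI[of _ d'] exI[of _ e'] conjI) (use RVgs in \<open>auto simp: e'_def d'_def\<close>)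
  qed
  obtain \<psi> where \<psi>: "fm_over P' \<psi>" "\<forall>e d. range d \<subseteq> RV \<longrightarrow> sat e d \<psi> = R4 e d"
    using R4 by (rule definE)
  show ?thesis by (rule definI[OF \<psi>(1)]) (simp add: \<psi>(2) R4_iff)
qed

lemma definableI:
  assumes R: "defin P R" and Z: "Z \<subseteq> space n m"
    and iff: "\<And>xs rs. length xs = n \<Longrightarrow> length rs = m \<Longrightarrow> set rs \<subseteq> RV \<Longrightarrow>
      (xs, rs) \<in> Z \<longleftrightarrow> R (\<lambda>i. if i < n then xs ! i else 0) (\<lambda>i. if i < m then rs ! i else rv 0)"
  shows "definable P n m Z"
proof -
  obtain \<phi> where \<phi>: "fm_over P \<phi>" "\<forall>e d. range d \<subseteq> RV \<longrightarrow> sat e d \<phi> = R e d"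
    using R by (rule definE)
  have "p \<in> Z \<longleftrightarrow> p \<in> space n m \<and> holds p \<phi>" for p
  proof (cases p)
    case (Pair xs rs)
    show ?thesis
    proof (cases "p \<in> space n m")
      case True
      hence *: "length xs = n" "length rs = m" "set rs \<subseteq> RV" by (auto simp: space_def Pair)
      have "range (\<lambda>i. if i < m then rs ! i else rv 0) \<subseteq> RV" using * by auto
      from \<phi>(2)[rule_format, OF this]
      have "holds p \<phi> = R (\<lambda>i. if i < n then xs ! i else 0) (\<lambda>i. if i < m then rs ! i else rv 0)"
        unfolding holds_def Pair fst_conv snd_conv *(1,2) .
      thus ?thesis using iff[OF *] True by (simp add: Pair)
    qed (use Z in auto)
  qed
  thus ?thesis unfolding definable_def using \<phi>(1) by blast
qed


section \<open>Definable centres of balls\<close>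

lemma vlt_minus_commute: "x - y \<prec> z \<longleftrightarrow> y - x \<prec> z"
  using vlt_uminus(1)[of "x - y" z] by simp

text \<open>Points of a set are read off the initial variables of an environment.\<close>

lemma definable_setI:
  assumes "defin P R" "Z \<subseteq> space n m"
    and "\<And>e d. range d \<subseteq> RV \<Longrightarrow> R e d \<longleftrightarrow> (map e [0..<n], map d [0..<m]) \<in> Z"
  shows "definable P n m Z"
proof (rule definableI[OF assms(1,2)])
  fix xs :: "'a list" and rs :: "'a set list"
  assume *: "length xs = n" "length rs = m" "set rs \<subseteq> RV"
  define e where "e i = (if i < n then xs ! i else 0)" for i
  define d where "d i = (if i < m then rs ! i else rv 0)" for i
  have "range d \<subseteq> RV" using * by (auto simp: d_def)
  moreover have "map e [0..<n] = xs" "map d [0..<m] = rs"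
    using * by (auto simp: e_def d_def intro!: nth_equalityI)
  ultimately have "R e d \<longleftrightarrow> (xs, rs) \<in> Z" using assms(3)[of d e] by simp
  thus "(xs, rs) \<in> Z \<longleftrightarrow> R (\<lambda>i. if i < n then xs ! i else 0) (\<lambda>i. if i < m then rs ! i else rv 0)"
    unfolding e_def[abs_def] d_def[abs_def] by simp
qed

definition line :: "'a set \<Rightarrow> 'a point set" where
  "line B = (\<lambda>x. ([x], [])) ` B"

abbreviation definable_point :: "'a params \<Rightarrow> 'a \<Rightarrow> bool" where
  "definable_point P x \<equiv> definable P 1 0 (line {x})"

lemma mem_line [simp]: "([x], []) \<in> line B \<longleftrightarrow> x \<in> B"
  by (auto simp: line_def)

lemma line_subset_space: "line B \<subseteq> space (Suc 0) 0"
  by (auto simp: line_def space_def)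

lemma mem_plane [simp]: "([x, y], []) \<in> plane A \<longleftrightarrow> (x, y) \<in> A"
  by (auto simp: plane_def)

lemma plane_subset_space: "plane A \<subseteq> space 2 0"
  by (auto simp: plane_def space_def)

lemma defin_mem_line:
  assumes "definable P 1 0 (line B)" "params_le P P'" "f \<in> term_functions (fst P')"
  shows "defin P' (\<lambda>e d. f e \<in> B)"
  using defin_mem[OF assms(1,2), of "[f]" "[]"] assms(3) by simp

lemma defin_mem_plane:
  assumes "definable P 2 0 (plane A)" "params_le P P'" "f \<in> term_functions (fst P')"
    "g \<in> term_functions (fst P')"
  shows "defin P' (\<lambda>e d. (f e, g e) \<in> A)"
  using defin_mem[OF assms(1,2), of "[f, g]" "[]"] assms(3,4) by simp

lemma definable_lineI:
  assumes "defin P R" "\<And>e d. R e d \<longleftrightarrow> e 0 \<in> B"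
  shows "definable P 1 0 (line B)"
  using line_subset_space assms(2) by (intro definable_setI[OF assms(1)]) auto

lemma definable_planeI:
  assumes "defin P R" "\<And>e d. R e d \<longleftrightarrow> (e 0, e 1) \<in> A"
  shows "definable P 2 0 (plane A)"
  using plane_subset_space assms(2)
  by (intro definable_setI[OF assms(1)]) (auto simp: numeral_2_eq_2)

lemma defin_eq_point:
  assumes "definable_point P x" "params_le P P'" "f \<in> term_functions (fst P')"
  shows "defin P' (\<lambda>e d. f e = x)"
  using defin_mem_line[OF assms] by simp

lemma definable_point_zero: "definable_point P 0"
  by (rule definable_lineI[OF defin_eqV[OF tf_var[of 0] tf_ops(1)]]) simp

text \<open>The smallest closed ball around an open ball is definable, although its radius is not
  mentioned: an element \<open>v\<close> is small relative to \<open>u\<close> iff \<open>rv (u + v) = rv u\<close>.\<close>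

lemma definable_closed_hull:
  assumes B: "definable P 1 0 (line (open_ball b \<gamma>))"
  shows "definable P 1 0 (line {x. Fin \<gamma> \<le> val (x - b)})"
proof -
  define B where "B = open_ball b \<gamma>"
  define R2 where "R2 e d \<longleftrightarrow> (rv ((e 0 - e 1) + (e 2 - e 1)) = rv (e 0 - e 1) \<longrightarrow> e 2 \<in> B)"
    for e :: "nat \<Rightarrow> 'a" and d :: "nat \<Rightarrow> 'a set"
  define R1 where "R1 e d \<longleftrightarrow> e 1 \<in> B \<and> (\<forall>y. R2 (e(2 := y)) d)" for e d
  define R where "R e d \<longleftrightarrow> (\<exists>a. R1 (e(1 := a)) d)" for e d
  have "defin P R2" unfolding R2_def[abs_def] B_def
    by (intro defin_imp defin_eqR rtf_rv tf_ops tf_var defin_mem_line[OF B] params_le_refl)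
  hence "defin P R1" unfolding R1_def[abs_def] B_def
    by (intro defin_conj defin_allV defin_mem_line[OF B] tf_var params_le_refl)
  hence "defin P R" unfolding R_def[abs_def] by (rule defin_exV)
  thus ?thesis
  proof (rule definable_lineI)
    fix e :: "nat \<Rightarrow> 'a" and d :: "nat \<Rightarrow> 'a set"
    define x where "x = e 0"
    obtain g where g: "val g = Fin \<gamma>" using val_surj by blast
    hence g0: "g \<noteq> 0" by auto
    have mem: "z \<in> B \<longleftrightarrow> z - b \<prec> g" for z by (simp add: B_def open_ball_def vlt_def g)
    have "R e d \<longleftrightarrow> (\<exists>b'\<in>B. \<forall>y. rv ((x - b') + (y - b')) = rv (x - b') \<longrightarrow> y \<in> B)"
      by (auto simp: R_def R1_def R2_def x_def)
    also have "\<dots> \<longleftrightarrow> x - b \<preceq> g"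
    proof
      assume "\<exists>b'\<in>B. \<forall>y. rv ((x - b') + (y - b')) = rv (x - b') \<longrightarrow> y \<in> B"
      then obtain b' where b': "b' - b \<prec> g" "\<And>y. rv ((x - b') + (y - b')) = rv (x - b') \<Longrightarrow> y \<in> B"
        using mem by auto
      show "x - b \<preceq> g"
      proof (rule ccontr)
        assume "\<not> x - b \<preceq> g"
        hence *: "g \<prec> x - b" by (simp add: not_vle_iff)
        have "g \<prec> x - b'"
        proof (rule ccontr)
          assume "\<not> g \<prec> x - b'"
          hence "x - b' \<preceq> g" by (simp add: not_vlt_iff)
          from vle_add[OF this vlt_imp_vle[OF b'(1)]] have "x - b \<preceq> g" by simp
          thus False using * vle_vlt_trans by fastforce
        qed
        hence "rv (x - b') = rv ((x - b') + g)" unfolding rv_eq_iff by simp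
        hence "b' + g \<in> B" using b'(2)[of "b' + g"] by simp
        hence "g + (b' - b) \<prec> g" by (simp add: mem algebra_simps)
        from vlt_diff[OF this b'(1)] show False by simp
      qed
    next
      assume *: "x - b \<preceq> g"
      show "\<exists>b'\<in>B. \<forall>y. rv ((x - b') + (y - b')) = rv (x - b') \<longrightarrow> y \<in> B"
      proof (intro bexI[of _ b] allI impI)
        fix y assume "rv ((x - b) + (y - b)) = rv (x - b)"
        hence "rv (x - b) = rv ((x - b) + (y - b))" by (rule sym)
        hence "y - b = 0 \<or> b - y \<prec> x - b" unfolding rv_eq_iff by auto
        hence "y - b = 0 \<or> y - b \<prec> x - b" unfolding vlt_minus_commute[of b y] .
        thus "y \<in> B" using vlt_vle_trans[OF _ *] g0 by (auto simp: mem)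
      qed (simp add: mem g0)
    qed
    also have "\<dots> \<longleftrightarrow> e 0 \<in> {x. Fin \<gamma> \<le> val (x - b)}" by (simp add: vle_def g x_def)
    finally show "R e d \<longleftrightarrow> e 0 \<in> {x. Fin \<gamma> \<le> val (x - b)}" .
  qed
qed

text \<open>The relation quantifies over an enumeration of \<open>Z\<close>, whose sum does not depend on its choice.\<close>

lemma definable_average:
  assumes Z: "definable P 1 0 (line Z)" "finite Z" "Z \<noteq> {}"
  shows "definable_point P (\<Sum>Z / of_nat (card Z))"
proof -
  define N where "N = card Z"
  have N: "N > 0" using Z by (simp add: N_def card_gt_0_iff)
  define T where "T e d \<longleftrightarrow> (\<forall>i\<in>{1..N}. e i \<in> Z) \<and> (\<forall>i\<in>{1..N}. \<forall>j\<in>{1..N}. i \<noteq> j \<longrightarrow> e i \<noteq> e j)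
    \<and> of_nat N * e 0 = (\<Sum>i\<in>{1..N}. e i)" for e :: "nat \<Rightarrow> 'a" and d :: "nat \<Rightarrow> 'a set"
  define R where "R e d \<longleftrightarrow> (\<exists>e'. (\<forall>j. j \<notin> set [1..<Suc N] \<longrightarrow> e' j = e j) \<and> T e' d)" for e d
  have "defin P T" unfolding T_def[abs_def]
    by (intro defin_conj defin_ball defin_imp defin_const defin_not defin_eqV tf_ops tf_var
        defin_mem_line[OF Z(1)] params_le_refl finite_atLeastAtMost)
  hence "defin P R" unfolding R_def[abs_def] by (rule defin_exVs)
  thus ?thesis
  proof (rule definable_lineI)
    fix e :: "nat \<Rightarrow> 'a" and d :: "nat \<Rightarrow> 'a set"
    have "R e d \<longleftrightarrow> of_nat N * e 0 = \<Sum>Z"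
    proof
      assume "R e d"
      then obtain e' where e': "\<forall>j. j \<notin> set [1..<Suc N] \<longrightarrow> e' j = e j" and T: "T e' d"
        unfolding R_def by blast
      have inj: "inj_on e' {1..N}" using T by (auto simp: T_def inj_on_def)
      moreover have "e' ` {1..N} \<subseteq> Z" using T by (auto simp: T_def)
      ultimately have "e' ` {1..N} = Z"
        using Z(2) by (intro card_subset_eq) (simp_all add: card_image N_def)
      hence "\<Sum>Z = (\<Sum>i\<in>{1..N}. e' i)" using sum.reindex[OF inj, of "\<lambda>x. x"] by simp
      moreover have "e' 0 = e 0" using e' by auto
      ultimately show "of_nat N * e 0 = \<Sum>Z" using T by (simp add: T_def)
    next
      assume *: "of_nat N * e 0 = \<Sum>Z"
      obtain h where h: "bij_betw h {1..N} Z"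
        using ex_bij_betw_nat_finite_1[OF Z(2)] unfolding N_def by blast
      define e' where "e' j = (if j \<in> {1..N} then h j else e j)" for j
      have e'h: "e' i = h i" if "i \<in> {1..N}" for i using that by (simp add: e'_def)
      have "(\<Sum>i\<in>{1..N}. e' i) = (\<Sum>i\<in>{1..N}. h i)" by (intro sum.cong refl e'h)
      also have "\<dots> = \<Sum>Z" by (rule sum.reindex_bij_betw[OF h])
      finally have 1: "of_nat N * e' 0 = (\<Sum>i\<in>{1..N}. e' i)" using * by (simp add: e'_def)
      have 2: "\<forall>i\<in>{1..N}. e' i \<in> Z" 
      proof
        fix i assume "i \<in> {1..N}"
        thus "e' i \<in> Z" using bij_betwE[OF h] e'h by simp
      qed
      have 3: "\<forall>i\<in>{1..N}. \<forall>j\<in>{1..N}. i \<noteq> j \<longrightarrow> e' i \<noteq> e' j"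
      proof (intro ballI impI)
        fix i j assume "i \<in> {1..N}" "j \<in> {1..N}" "i \<noteq> j"
        thus "e' i \<noteq> e' j" using inj_onD[OF bij_betw_imp_inj_on[OF h], of i j] e'h[of i] e'h[of j] by auto
      qed
      have "T e' d" unfolding T_def by (intro conjI 1 2 3)
      thus "R e d" unfolding R_def by (intro exI[of _ e']) (auto simp: e'_def)
    qed
    thus "R e d \<longleftrightarrow> e 0 \<in> {\<Sum>Z / of_nat (card Z)}"
      using of_nat_neq_0[OF N] by (auto simp: N_def field_simps)
  qed
qed

text \<open>The formula defining the ball amounts to a condition on \<open>rv (p x)\<close> for finitely many polynomials
  \<open>p\<close>. Some \<open>p\<close> has a root at distance at least \<open>\<gamma>\<close> in value from \<open>b\<close>, and as residue
  characteristic is \<open>0\<close>, the average of all such roots of \<open>p\<close> is not further away.\<close>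

theorem definable_point_near_ball:
  assumes B: "definable P 1 0 (line (open_ball b \<gamma>))"
  shows "\<exists>\<mu>. definable_point P \<mu> \<and> Fin \<gamma> \<le> val (\<mu> - b)"
proof -
  obtain g where g: "val g = Fin \<gamma>" using val_surj by blast
  hence g0: "g \<noteq> 0" by auto
  obtain \<phi> where \<phi>: "fm_over P \<phi>" "line (open_ball b \<gamma>) = {p \<in> space 1 0. holds p \<phi>}"
    using B unfolding definable_def by blast
  define env :: "'a \<Rightarrow> nat \<Rightarrow> 'a" where "env x = (\<lambda>_. 0)(0 := x)" for x
  have holds: "x \<in> open_ball b \<gamma> \<longleftrightarrow> sat (env x) (\<lambda>_. rv 0) \<phi>" for x
  proof -
    have "x \<in> open_ball b \<gamma> \<longleftrightarrow> ([x], []) \<in> {p \<in> space 1 0. holds p \<phi>}"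
      unfolding \<phi>(2)[symmetric] by simp
    also have "\<dots> \<longleftrightarrow> sat (env x) (\<lambda>_. rv 0) \<phi>"
    proof -
      have "(\<lambda>i. if i < length (fst ([x], [] :: 'a set list))
          then fst ([x], [] :: 'a set list) ! i else 0) = env x"
        by (auto simp: env_def)
      thus ?thesis by (simp add: space_def holds_def)
    qed
    finally show ?thesis .
  qed
  have "rv_determined (fst P) (\<lambda>e d. sat e d \<phi>)"
    using \<phi>(1) by (intro formula_rv_determined) (simp add: fm_over_def)
  then obtain G where G: "G \<subseteq> term_functions (fst P)" "finite G"
    "\<forall>e e'. rv_agree G e e' \<longrightarrow> (\<lambda>d. sat e d \<phi>) = (\<lambda>d. sat e' d \<phi>)"
    unfolding rv_determined_def by (elim exE conjE)
  have "\<exists>p. \<forall>x. f (env x) = poly p x" if f: "f \<in> G" for f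
  proof -
    obtain \<tau> where \<tau>: "set_vt \<tau> \<subseteq> fst P" "f = (\<lambda>e. veval e \<tau>)"
      using f G(1) unfolding term_functions_def by auto
    obtain p where "\<forall>e a. veval (e(0 := a)) \<tau> = poly (p e) a"
      using term_as_polynomial[OF \<tau>(1), of 0] by blast
    thus ?thesis unfolding \<tau>(2) env_def by blast
  qed
  then obtain p where p: "\<forall>f\<in>G. \<forall>x. f (env x) = poly (p f) x" by metis
  have "\<exists>f\<in>G. \<exists>c. p f \<noteq> 0 \<and> poly (p f) c = 0 \<and> c - b \<preceq> g"
  proof (rule ccontr)
    assume no: "\<not> ?thesis"
    \<comment> \<open>In this case the formula cannot tell \<open>b\<close> from a point at distance exactly \<open>\<gamma>\<close>.\<close>
    have "rv (poly (p f) (b + g)) = rv (poly (p f) b)" if f: "f \<in> G" for f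
    proof (cases "p f = 0")
      case False
      show ?thesis
      proof (rule rv_poly_cong)
        fix r assume "poly (p f) r = 0"
        hence "\<not> r - b \<preceq> g" using no f False by blast
        hence "g \<prec> b - r" using vlt_uminus(2)[of g "r - b"] by (simp add: not_vle_iff)
        hence "rv (b - r) = rv (b + g - r)" unfolding rv_eq_iff by simp
        thus "rv (b + g - r) = rv (b - r)" by (rule sym)
      qed
    qed simp
    hence "rv_agree G (env (b + g)) (env b)" using p by (simp add: rv_agree_def)
    with G(3) have "(\<lambda>d. sat (env (b + g)) d \<phi>) = (\<lambda>d. sat (env b) d \<phi>)" by blast
    hence "sat (env (b + g)) (\<lambda>_. rv 0) \<phi> = sat (env b) (\<lambda>_. rv 0) \<phi>" by metis
    hence "b + g \<in> open_ball b \<gamma> \<longleftrightarrow> b \<in> open_ball b \<gamma>" by (simp add: holds)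
    thus False using g by (simp add: open_ball_def)
  qed
  then obtain f c where f: "f \<in> G" "p f \<noteq> 0" and c: "poly (p f) c = 0" "c - b \<preceq> g" by blast
  define Z where "Z = {x. poly (p f) x = 0 \<and> Fin \<gamma> \<le> val (x - b)}"
  have Z: "finite Z" "Z \<noteq> {}"
    unfolding Z_def using poly_roots_finite[OF f(2)] c by (auto simp: vle_def g)
  have "definable P 1 0 (line {x. f (env x) = 0})"
  proof (rule definableI[OF defin_eqV[of f P "\<lambda>_. 0"]])
    show "f \<in> term_functions (fst P)" using f G by blast
    fix xs :: "'a list" and rs :: "'a set list" assume *: "length xs = 1" "length rs = 0"
    then obtain x where xs: "xs = [x]" by (cases xs) auto
    have "(\<lambda>i. if i < 1 then xs ! i else 0) = env x" by (auto simp: env_def xs)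
    thus "(xs, rs) \<in> line {x. f (env x) = 0} \<longleftrightarrow> f (\<lambda>i. if i < 1 then xs ! i else 0) = 0"
      using * by (simp add: xs)
  qed (auto intro: tf_ops simp: line_def space_def)
  hence "defin P (\<lambda>e d. e 0 \<in> {x. f (env x) = 0})"
    by (rule defin_mem_line) (auto intro: tf_var)
  moreover have "defin P (\<lambda>e d. e 0 \<in> {x. Fin \<gamma> \<le> val (x - b)})"
    by (rule defin_mem_line[OF definable_closed_hull[OF B]]) (auto intro: tf_var)
  ultimately have "definable P 1 0 (line Z)"
    by (rule definable_lineI[OF defin_conj]) (use f(1) p in \<open>simp add: Z_def\<close>)
  from definable_average[OF this Z] have "definable_point P (\<Sum>Z / of_nat (card Z))" .
  moreover have "\<Sum>Z / of_nat (card Z) - b \<preceq> g"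
  proof -
    have N: "card Z > 0" using Z by (simp add: card_gt_0_iff)
    have "(\<Sum>x\<in>Z. x - b) \<preceq> g" by (rule vle_sum) (simp add: Z_def vle_def g)
    moreover have "(\<Sum>x\<in>Z. x - b) = (\<Sum>Z / of_nat (card Z) - b) * of_nat (card Z)"
      using of_nat_neq_0[OF N] by (simp add: sum_subtractf field_simps)
    moreover have "g * 1 \<preceq> g * of_nat (card Z)"
      by (intro vle_mult vle_refl one_vle_of_nat N)
    ultimately have "(\<Sum>Z / of_nat (card Z) - b) * of_nat (card Z) \<preceq> g * of_nat (card Z)"
      using vle_trans by simp
    thus ?thesis using vle_mult_cancel[OF of_nat_neq_0[OF N]] by blast
  qed
  ultimately show ?thesis by (auto simp: vle_def g)
qed

text \<open>Translation by a centre turns \<open>B\<close> into a union of rv-balls. The second condition says that the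
  translation is a centripetal transformation: the centre lies in the rv-ball that contains \<open>B\<close>,
  unless \<open>B\<close> need not be moved at all.\<close>

definition center :: "'a set \<Rightarrow> 'a \<Rightarrow> bool" where
  "center B \<mu> \<longleftrightarrow> (\<forall>x\<in>B. \<forall>y. rv y = rv (x - \<mu>) \<longrightarrow> y + \<mu> \<in> B) \<and> ((\<forall>x\<in>B. rv \<mu> = rv x) \<or> \<mu> = 0)"

lemma center_singleton: "center {a} a"
  by (simp add: center_def)

lemma open_ball_vlt: "val g = Fin \<gamma> \<Longrightarrow> x \<in> open_ball b \<gamma> \<longleftrightarrow> x - b \<prec> g"
  by (simp add: open_ball_def vlt_def)

lemma center_of_member:
  assumes B: "is_open_ball B" and s: "\<And>x. x \<in> B \<Longrightarrow> rv x = s" and \<mu>: "\<mu> \<in> B"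
  shows "center B \<mu>"
proof -
  obtain b \<gamma> where b: "B = open_ball b \<gamma>" using B by (auto simp: is_open_ball_def)
  obtain g where g: "val g = Fin \<gamma>" using val_surj by blast
  have mem: "x \<in> B \<longleftrightarrow> x - b \<prec> g" for x unfolding b by (rule open_ball_vlt[OF g])
  have "y + \<mu> \<in> B" if "x \<in> B" "rv y = rv (x - \<mu>)" for x y
  proof -
    have "x - \<mu> \<prec> g" using vlt_diff[of "x - b" g "\<mu> - b"] that(1) \<mu> by (simp add: mem)
    hence "y \<prec> g" using val_cong_rv[OF that(2)] by (simp add: vlt_def)
    from vlt_add[OF this, of "\<mu> - b"] \<mu> show ?thesis by (simp add: mem algebra_simps)
  qed
  thus ?thesis using s \<mu> by (auto simp: center_def)
qed

text \<open>A definable point of the ball is a centre. If there is none, the ball is either an rv-ball, with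
  centre \<open>0\<close>, or smaller than the rv-ball containing it; in the latter case a definable point in the
  closed ball around it is at distance exactly the radius and belongs to the same rv-ball. In both
  cases the translated ball is a single rv-ball.\<close>

theorem ex_definable_center:
  assumes def: "definable P 1 0 (line B)" and B: "is_open_ball B" and s: "\<And>x. x \<in> B \<Longrightarrow> rv x = s"
  shows "\<exists>\<mu>. definable_point P \<mu> \<and> center B \<mu> \<and>
    (\<mu> \<in> B \<or> (\<forall>\<nu>\<in>B. \<not> definable_point P \<nu>) \<and> (\<exists>u. u \<noteq> 0 \<and> (\<forall>x\<in>B. rv (x - \<mu>) = rv u)))"
proof (cases "\<exists>\<nu>\<in>B. definable_point P \<nu>")
  case True
  then obtain \<nu> where "\<nu> \<in> B" "definable_point P \<nu>" by blast
  thus ?thesis using center_of_member[OF B s] by blast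
next
  case False
  obtain b \<gamma> where b: "B = open_ball b \<gamma>" using B by (auto simp: is_open_ball_def)
  obtain g where g: "val g = Fin \<gamma>" using val_surj by blast
  hence g0: "g \<noteq> 0" by auto
  have mem: "x \<in> B \<longleftrightarrow> x - b \<prec> g" for x unfolding b by (rule open_ball_vlt[OF g])
  have bB: "b \<in> B" using g0 by (simp add: mem)
  have "b \<noteq> 0" using False bB definable_point_zero by blast
  have "0 \<notin> B" using False definable_point_zero by blast
  hence gb: "g \<preceq> b" by (simp add: mem not_vlt_iff)
  show ?thesis
  proof (cases "b \<preceq> g")
    case True
    \<comment> \<open>Here \<open>B\<close> is itself an rv-ball.\<close>
    have "y \<in> B" if "x \<in> B" "rv y = rv x" for x y
    proof -
      have "rv b = rv y" using that s bB by metis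
      hence "y = b \<or> y - b \<prec> b" unfolding rv_eq_iff by (metis minus_diff_eq vlt_uminus(1))
      thus ?thesis using True vlt_vle_trans g0 by (auto simp: mem)
    qed
    hence "center B 0" by (auto simp: center_def)
    moreover have "\<forall>x\<in>B. rv (x - 0) = rv b" using s bB by auto
    ultimately show ?thesis using definable_point_zero False \<open>b \<noteq> 0\<close> by blast
  next
    case nle: False
    obtain \<mu> where \<mu>: "definable_point P \<mu>" "Fin \<gamma> \<le> val (\<mu> - b)"
      using definable_point_near_ball[of P b \<gamma>] def b by blast
    have le: "\<mu> - b \<preceq> g" using \<mu>(2) by (simp add: vle_def g)
    have "\<mu> \<notin> B" using False \<mu>(1) by blast
    hence ge: "g \<preceq> \<mu> - b" by (simp add: mem not_vlt_iff)
    have close: "x - x' \<prec> \<mu> - b" if "x \<in> B" "x' \<in> B" for x x'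
      using vlt_diff[of "x - b" g "x' - b"] that vlt_vle_trans[OF _ ge] by (simp add: mem)
    have rv\<mu>: "rv (x - \<mu>) = rv (b - \<mu>)" if "x \<in> B" for x
    proof -
      have "b - x \<prec> b - \<mu>" using close[OF bB that] by (metis minus_diff_eq vlt_uminus(2))
      hence "rv (b - \<mu>) = rv (x - \<mu>)" unfolding rv_eq_iff by simp
      thus ?thesis by simp
    qed
    have "y + \<mu> \<in> B" if "x \<in> B" "rv y = rv (x - \<mu>)" for x y
    proof -
      have "rv (b - \<mu>) = rv y" using that rv\<mu> by simp
      hence "y = b - \<mu> \<or> (b - \<mu>) - y \<prec> b - \<mu>" unfolding rv_eq_iff by auto
      hence "y = b - \<mu> \<or> y + \<mu> - b \<prec> \<mu> - b"
        using vlt_uminus(1)[of "y + \<mu> - b"] vlt_uminus(2)[of _ "\<mu> - b"] by (auto simp: algebra_simps)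
      thus ?thesis using vlt_vle_trans[OF _ le] g0 by (auto simp: mem)
    qed
    moreover have "rv \<mu> = rv x" if "x \<in> B" for x
    proof -
      have "\<mu> - b \<prec> b" using le nle by (meson not_vle_iff vle_vlt_trans)
      hence "rv b = rv \<mu>" unfolding rv_eq_iff by (metis minus_diff_eq vlt_uminus(1))
      thus ?thesis using s that bB by simp
    qed
    ultimately have "center B \<mu>" by (auto simp: center_def)
    moreover have "b - \<mu> \<noteq> 0" using \<open>\<mu> \<notin> B\<close> bB by auto
    ultimately show ?thesis using \<mu>(1) False rv\<mu> by blast
  qed
qed

end

section \<open>Contracting one coordinate by a translation\<close>

lemma delete_at_update [simp]: "delete_at i (xs[i := b]) = delete_at i xs"
  by (simp add: delete_at_def)

lemma nth_in_delete_at: "j < length xs \<Longrightarrow> j \<noteq> i \<Longrightarrow> xs ! j \<in> set (delete_at i xs)"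
proof -
  assume "j < length xs" "j \<noteq> i"
  show ?thesis
  proof (cases "j < i")
    case True
    hence "take i xs ! j = xs ! j" "j < length (take i xs)" using \<open>j < length xs\<close> by auto
    thus ?thesis unfolding delete_at_def by (metis UnI1 nth_mem set_append)
  next
    case False
    hence "drop (Suc i) xs ! (j - Suc i) = xs ! j" "j - Suc i < length (drop (Suc i) xs)"
      using \<open>j < length xs\<close> \<open>j \<noteq> i\<close> by auto
    thus ?thesis unfolding delete_at_def by (metis UnI2 nth_mem set_append)
  qed
qed

lemma eq_of_update_eq:
  assumes "xs[i := a] = ys[i := b]" "xs ! i = ys ! i"
  shows "xs = ys"
proof (rule nth_equalityI)
  show "length xs = length ys" using arg_cong[OF assms(1), of length] by simp
  fix j assume "j < length xs"
  thus "xs ! j = ys ! j"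
    using arg_cong[OF assms(1), of "\<lambda>zs. zs ! j"] assms(2) by (cases "j = i") auto
qed

lemma map_upt_add: "map e [0..<n + k] = map e [0..<n] @ map (\<lambda>j. e (n + j)) [0..<k]"
  by (induction k) auto

context acvf
begin

lemma mem_RVH: "(xs, ss) \<in> RVH A \<longleftrightarrow> (\<exists>ys. (ys, ss) \<in> A \<and> map rv ys = map rv xs)"
proof
  assume "(xs, ss) \<in> RVH A"
  then obtain ts ss' where "polydisc ts ss' \<inter> A \<noteq> {}" "(xs, ss) \<in> polydisc ts ss'"
    unfolding RVH_def by blast
  thus "\<exists>ys. (ys, ss) \<in> A \<and> map rv ys = map rv xs" unfolding polydisc_def by auto
next
  assume "\<exists>ys. (ys, ss) \<in> A \<and> map rv ys = map rv xs"
  then obtain ys where "(ys, ss) \<in> A" "map rv ys = map rv xs" by blast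
  hence "polydisc (map rv xs) ss \<inter> A \<noteq> {}" "(xs, ss) \<in> polydisc (map rv xs) ss"
    unfolding polydisc_def by auto
  thus "(xs, ss) \<in> RVH A" unfolding RVH_def by blast
qed

lemma RV_pullbackI:
  assumes "\<And>xs ys ss. (ys, ss) \<in> A \<Longrightarrow> map rv ys = map rv xs \<Longrightarrow> (xs, ss) \<in> A"
  shows "RV_pullback A"
  unfolding RV_pullback_def
proof (intro equalityI subrelI)
  fix xs ss assume "(xs, ss) \<in> RVH A"
  thus "(xs, ss) \<in> A" using assms mem_RVH by blast
qed (auto simp: mem_RVH)

lemma centripetalI:
  assumes "i < n" "definable P n m C" "RV_pullback C" "C \<subseteq> RVH A"
    and "definable P n m {(xs[i := lam (delete_at i xs) rs], rs) |xs rs. (xs, rs) \<in> C \<inter> A}"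
    and "{(xs[i := lam (delete_at i xs) rs], rs) |xs rs. (xs, rs) \<in> C \<inter> A} \<subseteq> C"
    and "\<And>xs rs. (xs, rs) \<in> A \<Longrightarrow> \<eta> (xs, rs) =
      (if (xs, rs) \<in> C then (xs[i := xs ! i - lam (delete_at i xs) rs], rs) else (xs, rs))"
  shows "centripetal P n m A \<eta>"
proof -
  have "case q of (xs, rs) \<Rightarrow> \<eta> (xs, rs) =
      (if (xs, rs) \<in> C then (xs[i := xs ! i - lam (delete_at i xs) rs], rs) else (xs, rs))"
    if "q \<in> A" for q
    using that assms(7)[of "fst q" "snd q"] by (cases q) (simp only: prod.case fst_conv snd_conv)
  thus ?thesis
    unfolding centripetal_def Let_def
    by (intro exI[of _ i] exI[of _ C] exI[of _ lam] conjI assms(1-6) ballI)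
qed

text \<open>One centripetal transformation with a constant centre on a subset of the line. If the centre
  is \<open>0\<close>, the translation is the identity and the transformation with empty domain serves;
  otherwise the centre has to lie in the rv-ball containing the set.\<close>

lemma special_bij_translation:
  assumes B: "definable P 1 0 (line B)" and l: "definable_point P l"
    and pull: "\<And>x y. x \<in> B \<Longrightarrow> rv y = rv (x - l) \<Longrightarrow> y + l \<in> B"
    and D: "(\<forall>x\<in>B. rv l = rv x) \<or> l = 0"
  shows "\<exists>T'. special_bij P 1 0 (line B) 2 T' \<and> RV_pullback (T' ` line B) \<and>
    (\<forall>b\<in>B. T' ([b], []) = ([b - l], [rv (b - l), rv b]))"
proof -
  define \<eta> where "\<eta> q = ([fst q ! 0 - l], snd q)" for q :: "'a point"
  define T' where "T' = canonical \<circ> \<eta> \<circ> canonical"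
  have T': "T' ([b], []) = ([b - l], [rv (b - l), rv b])" for b
    by (simp add: T'_def canonical_def \<eta>_def)
  have can: "canonical ` line B = (\<lambda>b. ([b], [rv b])) ` B"
    by (auto simp: line_def canonical_def image_image)
  have "centripetal P 1 1 (canonical ` line B) \<eta>"
    using D
  proof
    assume l0: "l = 0"
    have def0: "definable P 1 1 {}"
      by (rule definable_setI[OF defin_const[of P False]]) simp_all
    have G: "{(xs[0 := l], rs) |xs rs. (xs, rs) \<in> {} \<inter> canonical ` line B} = {}" by simp
    show ?thesis
    proof (rule centripetalI[where i = 0 and C = "{}" and lam = "\<lambda>_ _. l"])
      show "RV_pullback {}" by (rule RV_pullbackI) simp
      show "\<eta> (xs, rs) = (if (xs, rs) \<in> {} then (xs[0 := xs ! 0 - l], rs) else (xs, rs))"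
        if "(xs, rs) \<in> canonical ` line B" for xs rs
        using that unfolding can by (auto simp: \<eta>_def l0)
    qed (simp_all only: G def0 empty_subsetI zero_less_one)
  next
    assume rvl: "\<forall>x\<in>B. rv l = rv x"
    define C where "C = RVH (canonical ` line B)"
    have C: "(xs, ss) \<in> C \<longleftrightarrow> (\<exists>x. xs = [x] \<and> ss = [rv x] \<and> (\<exists>b\<in>B. rv b = rv x))" for xs ss
    proof
      assume "(xs, ss) \<in> C"
      then obtain b where b: "b \<in> B" "ss = [rv b]" "map rv [b] = map rv xs"
        unfolding C_def mem_RVH can by auto
      then obtain x where "xs = [x]" "rv b = rv x" by (cases xs) simp_all
      with b show "\<exists>x. xs = [x] \<and> ss = [rv x] \<and> (\<exists>b\<in>B. rv b = rv x)" by auto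
    next
      assume "\<exists>x. xs = [x] \<and> ss = [rv x] \<and> (\<exists>b\<in>B. rv b = rv x)"
      then obtain x b where x: "xs = [x]" "ss = [rv x]" "b \<in> B" "rv b = rv x" by blast
      have "([b], [rv b]) \<in> canonical ` line B" unfolding can using x(3) by (rule imageI)
      thus "(xs, ss) \<in> C" unfolding C_def mem_RVH by (intro exI[of _ "[b]"]) (simp add: x)
    qed
    have inC: "(xs, ss) \<in> C" if "(xs, ss) \<in> canonical ` line B" for xs ss
      using that unfolding C can by auto
    have defC: "definable P 1 1 C"
    proof (rule definable_setI)
      show "defin P (\<lambda>e d. d 0 = rv (e 0) \<and> (\<exists>b. (e(1 := b)) 1 \<in> B \<and> rv ((e(1 := b)) 1) = rv ((e(1 := b)) 0)))"
        by (intro defin_conj defin_eqR rtf_var rtf_rv tf_var defin_exV defin_mem_line[OF B] params_le_refl)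
      show "C \<subseteq> space 1 1" by (auto simp: C space_def)
    qed (auto simp: C)
    have G: "{(xs[0 := l], rs) |xs rs. (xs, rs) \<in> C \<inter> canonical ` line B} = (\<lambda>b. ([l], [rv b])) ` B"
      (is "?G = _")
    proof
      show "?G \<subseteq> (\<lambda>b. ([l], [rv b])) ` B" unfolding can by auto
      show "(\<lambda>b. ([l], [rv b])) ` B \<subseteq> ?G"
      proof
        fix q assume "q \<in> (\<lambda>b. ([l], [rv b])) ` B"
        then obtain b where b: "b \<in> B" "q = ([l], [rv b])" by blast
        hence "([b], [rv b]) \<in> canonical ` line B" unfolding can by blast
        with inC[OF this] b(2) show "q \<in> ?G"
          by (intro CollectI exI[of _ "[b]"] exI[of _ "[rv b]"]) simp
      qed
    qed
    have defG: "definable P 1 1 ((\<lambda>b. ([l], [rv b])) ` B)"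
    proof (rule definable_setI)
      show "defin P (\<lambda>e d. e 0 = l \<and> (\<exists>b. (e(1 := b)) 1 \<in> B \<and> d 0 = rv ((e(1 := b)) 1)))"
        by (intro defin_conj defin_eqR rtf_var rtf_rv tf_var defin_exV defin_mem_line[OF B]
            defin_eq_point[OF l] params_le_refl)
      show "(\<lambda>b. ([l], [rv b])) ` B \<subseteq> space 1 1" by (auto simp: space_def)
    qed auto
    show ?thesis
    proof (rule centripetalI[where i = 0 and C = C and lam = "\<lambda>_ _. l"])
      show "RV_pullback C"
      proof (rule RV_pullbackI)
        fix xs ys ss assume "(ys, ss) \<in> C" and eq: "map rv ys = map rv xs"
        then obtain y b where y: "ys = [y]" "ss = [rv y]" "b \<in> B" "rv b = rv y"
          unfolding C by blast
        obtain x where "xs = [x]" "rv y = rv x" using eq y(1) by (cases xs) simp_all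
        thus "(xs, ss) \<in> C"
          unfolding C using y by (intro exI[of _ x] conjI bexI[of _ b]) simp_all
      qed
      show "C \<subseteq> RVH (canonical ` line B)" by (simp add: C_def)
      show "?G \<subseteq> C" unfolding G using rvl by (auto simp: C)
      show "\<eta> (xs, rs) = (if (xs, rs) \<in> C then (xs[0 := xs ! 0 - l], rs) else (xs, rs))"
        if q: "(xs, rs) \<in> canonical ` line B" for xs rs
        using q unfolding if_P[OF inC[OF q]] unfolding can by (auto simp: \<eta>_def)
    qed (simp_all only: G defG defC zero_less_one)
  qed
  hence "special_bij P 1 0 (line B) (1 + (1 + 0)) T'"
    unfolding T'_def by (intro special_bij.step special_bij.canonical) (use B in simp_all)
  hence "special_bij P 1 0 (line B) 2 T'" by (simp add: numeral_2_eq_2)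
  moreover have "RV_pullback (T' ` line B)"
  proof (rule RV_pullbackI)
    fix xs ys ss assume "(ys, ss) \<in> T' ` line B" "map rv ys = map rv xs"
    then obtain b c where b: "b \<in> B" "xs = [c]" "rv (b - l) = rv c" "ss = [rv (b - l), rv b]"
      by (auto simp: line_def T' map_eq_Cons_conv Cons_eq_map_conv)
    have c: "c + l \<in> B" using pull[OF b(1), of c] b(3) by simp
    have "rv (c + l) = rv b"
      using D
    proof
      assume *: "\<forall>x\<in>B. rv l = rv x"
      show ?thesis using bspec[OF * c] bspec[OF * b(1)] by (rule trans[OF sym])
    qed (use b(3) in simp)
    hence "T' ([c + l], []) = (xs, ss)" using b by (simp add: T')
    moreover have "([c + l], []) \<in> line B" using c by simp
    ultimately show "(xs, ss) \<in> T' ` line B" by (metis image_eqI)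
  qed
  ultimately show ?thesis using T' by blast
qed

text \<open>The effect of \<open>special_bij_translation\<close> on the fibres over all tuples of other coordinates. The
  centre is a function of the other VF-coordinates.\<close>

definition translate :: "nat \<Rightarrow> ('a list \<Rightarrow> 'a) \<Rightarrow> 'a point \<Rightarrow> 'a point" where
  "translate i lam q =
     (let x = fst q ! i; x' = x - lam (delete_at i (fst q)) in ((fst q)[i := x'], rv x' # rv x # snd q))"

lemma definable_subset_space: "definable P n m A \<Longrightarrow> A \<subseteq> space n m"
  by (auto simp: definable_def)

text \<open>The hypotheses are the fibrewise ones of \<open>special_bij_translation\<close>. The set in the third hypothesis
  is the graph of the centre; it makes the translation definable, and substituting the other
  coordinates of a point into it makes the centre of the fibre definable over them.\<close>

lemma coordinate_bij_translate:
  assumes A: "definable P n m A" and i: "i < n"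
    and G: "definable P n m ((\<lambda>(xs, rs). (xs[i := lam (delete_at i xs)], rs)) ` A)"
    and pull: "\<And>xs rs y. (xs, rs) \<in> A \<Longrightarrow> rv y = rv (xs ! i - lam (delete_at i xs)) \<Longrightarrow>
      (xs[i := y + lam (delete_at i xs)], rs) \<in> A"
    and D: "(\<forall>(xs, rs)\<in>A. rv (lam (delete_at i xs)) = rv (xs ! i)) \<or> (\<forall>ys. lam ys = 0)"
  shows "coordinate_bij P i n m A 2 (translate i lam)"
proof -
  define G' where "G' = (\<lambda>(xs, rs). (xs[i := lam (delete_at i xs)], rs)) ` A"
  have len: "length xs = n" "length rs = m" "set rs \<subseteq> RV" if "(xs, rs) \<in> A" for xs rs
    using definable_subset_space[OF A] that by (auto simp: space_def)
  have G'_iff: "(xs[i := z], rs) \<in> G' \<longleftrightarrow> z = lam (delete_at i xs)" if xs: "(xs, rs) \<in> A" for xs rs z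
  proof
    assume "(xs[i := z], rs) \<in> G'"
    then obtain ys where ys: "(ys, rs) \<in> A" "xs[i := z] = ys[i := lam (delete_at i ys)]"
      by (auto simp: G'_def)
    have "delete_at i xs = delete_at i ys"
      using arg_cong[OF ys(2), of "delete_at i"] by simp
    moreover have "z = lam (delete_at i ys)"
      using arg_cong[OF ys(2), of "\<lambda>zs. zs ! i"] len(1)[OF xs] len(1)[OF ys(1)] i by simp
    ultimately show "z = lam (delete_at i xs)" by simp
  next
    assume "z = lam (delete_at i xs)"
    thus "(xs[i := z], rs) \<in> G'" using xs by (auto simp: G'_def)
  qed
  have tr_space: "translate i lam q \<in> space n (2 + m)" if "q \<in> A" for q
    using subsetD[OF definable_subset_space[OF A] that] by (auto simp: translate_def Let_def space_def)
  have "definable_fun P n m n (2 + m) A (translate i lam)"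
    unfolding definable_fun_def
  proof (intro conjI)
    show "A \<subseteq> space n m" by (rule definable_subset_space[OF A])
    show "translate i lam ` A \<subseteq> space n (2 + m)"
      using tr_space by blast
    define R where "R e d \<longleftrightarrow> (map e [0..<n], map d [0..<m]) \<in> A \<and>
      (\<forall>j\<in>{..<n} - {i}. e (n + j) = e j) \<and>
      (map (\<lambda>j. if j = i then e i - e (n + i) else e j) [0..<n], map d [0..<m]) \<in> G' \<and>
      d m = rv (e (n + i)) \<and> d (m + 1) = rv (e i) \<and> (\<forall>j\<in>{..<m}. d (m + (2 + j)) = d j)" for e d
    have memA: "defin P (\<lambda>e d. (map e [0..<n], map d [0..<m]) \<in> A)"
      using defin_mem[OF A params_le_refl, of "map (\<lambda>j e. e j) [0..<n]" "map (\<lambda>j e d. d j) [0..<m]"]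
      by (simp add: o_def image_subset_iff tf_var rtf_var)
    have memG: "defin P (\<lambda>e d. (map (\<lambda>j. if j = i then e i - e (n + i) else e j) [0..<n], map d [0..<m]) \<in> G')"
    proof -
      define f :: "nat \<Rightarrow> (nat \<Rightarrow> 'a) \<Rightarrow> 'a" where "f j = (if j = i then (\<lambda>e. e i - e (n + i)) else (\<lambda>e. e j))" for j
      have "f j \<in> term_functions (fst P)" for j
        by (auto simp: f_def intro: tf_ops tf_var)
      moreover have "(if j = i then e i - e (n + i) else e j) = f j e" for j e by (simp add: f_def)
      ultimately show ?thesis
        using defin_mem[OF G[folded G'_def] params_le_refl, of "map f [0..<n]" "map (\<lambda>j e d. d j) [0..<m]"]
        by (simp add: o_def image_subset_iff rtf_var)
    qed
    have "defin P R" unfolding R_def[abs_def]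
      by (intro defin_conj memA memG defin_ball defin_eqV defin_eqR tf_var rtf_var rtf_rv) auto
    thus "definable P (n + n) (m + (2 + m))
        ((\<lambda>p. (fst p @ fst (translate i lam p), snd p @ snd (translate i lam p))) ` A)"
    proof (rule definable_setI)
      show "(\<lambda>p. (fst p @ fst (translate i lam p), snd p @ snd (translate i lam p))) ` A
          \<subseteq> space (n + n) (m + (2 + m))"
      proof (rule image_subsetI)
        fix q assume q: "q \<in> A"
        show "(fst q @ fst (translate i lam q), snd q @ snd (translate i lam q)) \<in> space (n + n) (m + (2 + m))"
          using subsetD[OF definable_subset_space[OF A] q] tr_space[OF q] by (auto simp: space_def)
      qed
      fix e :: "nat \<Rightarrow> 'a" and d :: "nat \<Rightarrow> 'a set"
      define xs where "xs = map e [0..<n]"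
      define rs where "rs = map d [0..<m]"
      define xs' where "xs' = map (\<lambda>j. e (n + j)) [0..<n]"
      define rs' where "rs' = map (\<lambda>j. d (m + j)) [0..<2 + m]"
      have rs': "rs' = d m # d (m + 1) # map (\<lambda>j. d (m + (2 + j))) [0..<m]"
        unfolding rs'_def by (subst map_upt_add) (simp add: numeral_2_eq_2)
      have upd: "map (\<lambda>j. if j = i then e i - e (n + i) else e j) [0..<n] = xs[i := e i - e (n + i)]"
        by (rule nth_equalityI) (auto simp: xs_def nth_list_update)
      have lx: "length xs = n" "length rs = m" by (simp_all add: xs_def rs_def)
      have xi: "xs ! i = e i" using i by (simp add: xs_def)
      have "(map e [0..<n + n], map d [0..<m + (2 + m)])
          \<in> (\<lambda>p. (fst p @ fst (translate i lam p), snd p @ snd (translate i lam p))) ` A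
        \<longleftrightarrow> (xs @ xs', rs @ rs')
          \<in> (\<lambda>p. (fst p @ fst (translate i lam p), snd p @ snd (translate i lam p))) ` A"
        unfolding map_upt_add xs_def rs_def xs'_def rs'_def ..
      also have "\<dots> \<longleftrightarrow> (xs, rs) \<in> A \<and> translate i lam (xs, rs) = (xs', rs')"
      proof
        assume "(xs @ xs', rs @ rs')
          \<in> (\<lambda>p. (fst p @ fst (translate i lam p), snd p @ snd (translate i lam p))) ` A"
        then obtain ys ss where ys: "(ys, ss) \<in> A" "xs @ xs' = ys @ fst (translate i lam (ys, ss))"
          "rs @ rs' = ss @ snd (translate i lam (ys, ss))" by auto
        have "xs = ys" "rs = ss" "xs' = fst (translate i lam (ys, ss))" "rs' = snd (translate i lam (ys, ss))"
          using ys(2,3) len[OF ys(1)] lx by auto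
        thus "(xs, rs) \<in> A \<and> translate i lam (xs, rs) = (xs', rs')" using ys(1) by simp
      next
        assume "(xs, rs) \<in> A \<and> translate i lam (xs, rs) = (xs', rs')"
        thus "(xs @ xs', rs @ rs')
          \<in> (\<lambda>p. (fst p @ fst (translate i lam p), snd p @ snd (translate i lam p))) ` A"
          by (intro image_eqI[of _ _ "(xs, rs)"]) auto
      qed
      also have "\<dots> \<longleftrightarrow> R e d"
      proof (cases "(xs, rs) \<in> A")
        case True
        have "translate i lam (xs, rs) = (xs', rs') \<longleftrightarrow>
          xs[i := e i - lam (delete_at i xs)] = xs' \<and> d m = rv (e i - lam (delete_at i xs)) \<and>
          d (m + 1) = rv (e i) \<and> rs = map (\<lambda>j. d (m + (2 + j))) [0..<m]"
          unfolding rs'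
          by (simp add: translate_def Let_def xi eq_commute[of "d m"] eq_commute[of "d (Suc m)"])
        also have "xs[i := e i - lam (delete_at i xs)] = xs' \<longleftrightarrow>
          (\<forall>j\<in>{..<n} - {i}. e (n + j) = e j) \<and> e i - e (n + i) = lam (delete_at i xs)"
        proof
          assume *: "xs[i := e i - lam (delete_at i xs)] = xs'"
          have "e (n + j) = (if j = i then e i - lam (delete_at i xs) else e j)" if "j < n" for j
            using arg_cong[OF *, of "\<lambda>zs. zs ! j"] that i
            by (simp add: xs_def xs'_def nth_list_update split: if_splits)
          thus "(\<forall>j\<in>{..<n} - {i}. e (n + j) = e j) \<and> e i - e (n + i) = lam (delete_at i xs)"
            using i by auto
        next
          assume *: "(\<forall>j\<in>{..<n} - {i}. e (n + j) = e j) \<and> e i - e (n + i) = lam (delete_at i xs)"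
          hence "e i - lam (delete_at i xs) = e (n + i)" by (simp flip: conjunct2[OF *])
          moreover have "xs[i := e (n + i)] = xs'"
            using * i by (intro nth_equalityI) (auto simp: xs_def xs'_def nth_list_update)
          ultimately show "xs[i := e i - lam (delete_at i xs)] = xs'" by (simp only:)
        qed
        also have "rs = map (\<lambda>j. d (m + (2 + j))) [0..<m] \<longleftrightarrow> (\<forall>j\<in>{..<m}. d (m + (2 + j)) = d j)"
          unfolding rs_def by auto
        finally have tr: "translate i lam (xs, rs) = (xs', rs') \<longleftrightarrow>
          ((\<forall>j\<in>{..<n} - {i}. e (n + j) = e j) \<and> e i - e (n + i) = lam (delete_at i xs)) \<and>
          d m = rv (e i - lam (delete_at i xs)) \<and> d (m + 1) = rv (e i) \<and>
          (\<forall>j\<in>{..<m}. d (m + (2 + j)) = d j)" .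
        have "e i - lam (delete_at i xs) = e (n + i)" if "e i - e (n + i) = lam (delete_at i xs)"
          by (simp flip: that)
        thus ?thesis
          unfolding tr R_def upd xs_def[symmetric] rs_def[symmetric] G'_iff[OF True]
          by (cases "e i - e (n + i) = lam (delete_at i xs)") (simp_all add: True)
      next
        case False
        thus ?thesis by (simp add: R_def flip: xs_def rs_def)
      qed
      finally show "R e d \<longleftrightarrow> (map e [0..<n + n], map d [0..<m + (2 + m)])
          \<in> (\<lambda>p. (fst p @ fst (translate i lam p), snd p @ snd (translate i lam p))) ` A" ..
    qed
  qed
  moreover have "inj_on (translate i lam) A"
  proof (rule inj_onI)
    fix p q assume p: "p \<in> A" and q: "q \<in> A" and eq: "translate i lam p = translate i lam q"
    obtain xs rs ys ss where pq: "p = (xs, rs)" "q = (ys, ss)" by fastforce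
    have u: "xs[i := xs ! i - lam (delete_at i xs)] = ys[i := ys ! i - lam (delete_at i ys)]" "rs = ss"
      using eq by (simp_all add: pq translate_def Let_def)
    have "delete_at i xs = delete_at i ys" using arg_cong[OF u(1), of "delete_at i"] by simp
    moreover have "xs ! i - lam (delete_at i xs) = ys ! i - lam (delete_at i ys)"
      using arg_cong[OF u(1), of "\<lambda>zs. zs ! i"] len(1)[of xs rs] len(1)[of ys ss] i p q by (simp add: pq)
    ultimately have "xs ! i = ys ! i" by simp
    thus "p = q" using eq_of_update_eq[OF u(1)] u(2) by (simp add: pq)
  qed
  moreover have "let B = {([b], []) |b. (xs[i := b], rs) \<in> A}
        in \<exists>T'. special_bij (extend_params P (delete_at i xs, rs)) 1 0 B 2 T' \<and>
                RV_pullback (T' ` B) \<and>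
                (\<forall>b b' new. ([b], []) \<in> B \<and> T' ([b], []) = ([b'], new) \<longrightarrow>
                   translate i lam (xs[i := b], rs) = (xs[i := b'], new @ rs))"
    if xs: "(xs, rs) \<in> A" for xs rs
  proof -
    define P' where "P' = extend_params P (delete_at i xs, rs)"
    define B where "B = {b. (xs[i := b], rs) \<in> A}"
    define l where "l = lam (delete_at i xs)"
    have PP': "params_le P P'" by (simp add: P'_def)
    have lineB: "{([b], []) |b. (xs[i := b], rs) \<in> A} = line B" by (auto simp: line_def B_def)
    define f :: "nat \<Rightarrow> (nat \<Rightarrow> 'a) \<Rightarrow> 'a" where "f j = (if j = i then (\<lambda>e. e 0) else (\<lambda>e. xs ! j))" for j
    have f: "f j \<in> term_functions (fst P')" if "j < n" for j
    proof (cases "j = i")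
      case False
      hence "xs ! j \<in> fst P'" using nth_in_delete_at[of j xs i] that len(1)[OF xs]
        by (simp add: P'_def extend_params_def)
      thus ?thesis using False by (simp add: f_def tf_const)
    qed (simp add: f_def tf_var)
    have g: "(\<lambda>e d. rs ! j) \<in> rterm_functions P'" if "j < m" for j
      using that len(2)[OF xs] by (intro rtf_const) (simp add: P'_def extend_params_def)
    have fx: "map (\<lambda>f. f e) (map f [0..<n]) = xs[i := e 0]" for e
      using len(1)[OF xs] by (intro nth_equalityI) (auto simp: f_def nth_list_update)
    have gx: "map (\<lambda>g. g e d) (map (\<lambda>j e d. rs ! j) [0..<m]) = rs" for e :: "nat \<Rightarrow> 'a" and d :: "nat \<Rightarrow> 'a set"
      using len(2)[OF xs] by (intro nth_equalityI) auto
    have sub: "defin P' (\<lambda>e d. (xs[i := e 0], rs) \<in> Z)" if "definable P n m Z" for Z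
      using defin_mem[OF that PP', of "map f [0..<n]" "map (\<lambda>j e d. rs ! j) [0..<m]"] f g
      unfolding fx gx by (auto simp: image_subset_iff)
    have "definable P' 1 0 (line B)"
      by (rule definable_lineI[OF sub[OF A]]) (simp add: B_def)
    moreover have "definable_point P' l"
      by (rule definable_lineI[OF sub[OF G]]) (simp add: l_def G'_iff[OF xs] flip: G'_def)
    moreover have "y + l \<in> B" if "x \<in> B" "rv y = rv (x - l)" for x y
      using pull[of "xs[i := x]" rs y] that len(1)[OF xs] i by (simp add: B_def l_def)
    moreover have "(\<forall>x\<in>B. rv l = rv x) \<or> l = 0"
      using D
    proof
      assume *: "\<forall>(xs, rs)\<in>A. rv (lam (delete_at i xs)) = rv (xs ! i)"
      have "rv l = rv x" if "x \<in> B" for x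
        using bspec[OF *, of "(xs[i := x], rs)"] that len(1)[OF xs] i by (simp add: B_def l_def)
      thus ?thesis by blast
    qed (simp add: l_def)
    ultimately have "\<exists>T'. special_bij P' 1 0 (line B) 2 T' \<and> RV_pullback (T' ` line B) \<and>
        (\<forall>b\<in>B. T' ([b], []) = ([b - l], [rv (b - l), rv b]))"
      by (rule special_bij_translation)
    then obtain T' where T': "special_bij P' 1 0 (line B) 2 T'" "RV_pullback (T' ` line B)"
      "\<forall>b\<in>B. T' ([b], []) = ([b - l], [rv (b - l), rv b])" by blast
    have "translate i lam (xs[i := b], rs) = (xs[i := b'], new @ rs)"
      if "([b], []) \<in> line B" "T' ([b], []) = ([b'], new)" for b b' new
      using that T'(3) len(1)[OF xs] i by (auto simp: translate_def Let_def l_def)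
    thus ?thesis unfolding Let_def lineB P'_def[symmetric] using T'(1,2) by blast
  qed
  ultimately show ?thesis unfolding coordinate_bij_def by blast
qed


section \<open>Contracting both coordinates\<close>

lemma coordinate_bij_translate_line:
  assumes A: "definable P 1 m A" and \<mu>: "definable_point P \<mu>"
    and pull: "\<And>x y rs. ([x], rs) \<in> A \<Longrightarrow> rv y = rv (x - \<mu>) \<Longrightarrow> ([y + \<mu>], rs) \<in> A"
    and D: "(\<forall>x rs. ([x], rs) \<in> A \<longrightarrow> rv \<mu> = rv x) \<or> \<mu> = 0"
  shows "coordinate_bij P 0 1 m A 2 (translate 0 (\<lambda>_. \<mu>))"
proof (rule coordinate_bij_translate[OF A])
  have single: "\<exists>x. xs = [x]" if "(xs, rs) \<in> A" for xs rs
    using subsetD[OF definable_subset_space[OF A] that] by (cases xs) (auto simp: space_def)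
  define G where "G = (\<lambda>(xs, rs). (xs[0 := \<mu>], rs)) ` A"
  have G: "(zs, rs) \<in> G \<longleftrightarrow> zs = [\<mu>] \<and> (\<exists>x. ([x], rs) \<in> A)" for zs rs
  proof
    assume "(zs, rs) \<in> G"
    then obtain xs where "(xs, rs) \<in> A" "zs = xs[0 := \<mu>]" by (auto simp: G_def)
    thus "zs = [\<mu>] \<and> (\<exists>x. ([x], rs) \<in> A)" using single[of xs rs] by auto
  next
    assume "zs = [\<mu>] \<and> (\<exists>x. ([x], rs) \<in> A)"
    thus "(zs, rs) \<in> G" unfolding G_def by force
  qed
  show "definable P 1 m ((\<lambda>(xs, rs). (xs[0 := \<mu>], rs)) ` A)"
    unfolding G_def[symmetric]
  proof (rule definable_setI)
    have "defin P (\<lambda>e d. ([e 1], map d [0..<m]) \<in> A)"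
      using defin_mem[OF A params_le_refl, of "[\<lambda>e. e 1]" "map (\<lambda>j e d. d j) [0..<m]"]
      by (simp add: o_def image_subset_iff tf_var rtf_var)
    from defin_conj[OF defin_eq_point[OF \<mu> params_le_refl tf_var[of 0]] defin_exV[OF this, of 1]]
    show "defin P (\<lambda>e d. e 0 = \<mu> \<and> (\<exists>x. ([(e(1 := x)) 1], map d [0..<m]) \<in> A))" .
    show "G \<subseteq> space 1 m"
      using definable_subset_space[OF A] by (auto simp: G_def space_def)
  qed (simp add: G)
  show "(\<forall>(xs, rs)\<in>A. rv \<mu> = rv (xs ! 0)) \<or> (\<forall>ys::'a list. \<mu> = 0)"
    using D
  proof
    assume *: "\<forall>x rs. ([x], rs) \<in> A \<longrightarrow> rv \<mu> = rv x"
    have "rv \<mu> = rv (xs ! 0)" if "(xs, rs) \<in> A" for xs rs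
      using single[OF that] * that by auto
    thus ?thesis by blast
  qed simp
  show "(xs[0 := y + \<mu>], rs) \<in> A" if "(xs, rs) \<in> A" "rv y = rv (xs ! 0 - \<mu>)" for xs rs y
    using single[OF that(1)] pull[OF _ that(2)] that by auto
qed simp

text \<open>The two orders of contraction are treated together: \<open>x\<close> stands for the coordinate of index \<open>i\<close>,
  which is contracted first, and \<open>z\<close> for the other one.\<close>

definition place :: "nat \<Rightarrow> 'b \<Rightarrow> 'b \<Rightarrow> 'b list" where
  "place i x z = (if i = 0 then [x, z] else [z, x])"

text \<open>For pairs \<open>(x, z)\<close> with \<open>x\<close> contracted first. The first two conditions say that \<open>l z\<close> is a centre
  of the fibre over \<open>z\<close>. Contracting it leaves triples \<open>z, rv (x - l z), rv x\<close>; the last two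
  conditions say that \<open>\<mu>\<close> is a centre of the set of all \<open>z\<close> with given second and third entry.\<close>

definition contractible :: "('a \<times> 'a) set \<Rightarrow> ('a \<Rightarrow> 'a) \<Rightarrow> 'a \<Rightarrow> bool" where
  "contractible C l \<mu> \<longleftrightarrow>
     (\<forall>x z w. (x, z) \<in> C \<longrightarrow> rv w = rv (x - l z) \<longrightarrow> (w + l z, z) \<in> C) \<and>
     ((\<forall>(x, z)\<in>C. rv (l z) = rv x) \<or> (\<forall>z. l z = 0)) \<and>
     (\<forall>x z w. (x, z) \<in> C \<longrightarrow> rv w = rv (z - \<mu>) \<longrightarrow>
        (\<exists>x'. (x', w + \<mu>) \<in> C \<and> rv (x' - l (w + \<mu>)) = rv (x - l z) \<and> rv x' = rv x)) \<and>
     ((\<forall>(x, z)\<in>C. rv \<mu> = rv z) \<or> \<mu> = 0)"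

theorem contraction_of_contractible:
  fixes i :: nat and C :: "('a \<times> 'a) set"
  assumes i: "i = 0 \<or> i = 1"
    and C: "definable P 2 0 ((\<lambda>(x, z). (place i x z, [])) ` C)"
    and l: "definable P 2 0 ((\<lambda>z. (place i (l z) z, [])) ` snd ` C)"
    and \<mu>: "definable_point P \<mu>" and contr: "contractible C l \<mu>"
  shows "standard_contraction P [i, 1 - i] 2 0 ((\<lambda>(x, z). (place i x z, [])) ` C) 4
    (\<lambda>q. let x = fst q ! i; z = fst q ! (1 - i) in place i (rv (x - l z)) (rv (z - \<mu>)) @ [rv x, rv z])"
proof -
  have pull1: "(w + l z, z) \<in> C" if "(x, z) \<in> C" "rv w = rv (x - l z)" for x z w
    using contr that unfolding contractible_def by blast
  have pull2: "\<exists>x'. (x', w + \<mu>) \<in> C \<and> rv (x' - l (w + \<mu>)) = rv (x - l z) \<and> rv x' = rv x"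
    if "(x, z) \<in> C" "rv w = rv (z - \<mu>)" for x z w
    using contr that unfolding contractible_def by blast
  define A where "A = (\<lambda>(x, z). (place i x z, [] :: 'a set list)) ` C"
  have A: "definable P 2 0 A" using C by (simp add: A_def)
  have A_E: "\<exists>x z. (x, z) \<in> C \<and> q = (place i x z, [])" if "q \<in> A" for q
    using that by (auto simp: A_def)
  have pt: "delete_at i (place i x z) = [z]" "(place i x z)[i := w] = place i w z" "place i x z ! i = x"
    "place i x z ! (1 - i) = z" for x z w
    using i by (auto simp: place_def delete_at_def)
  have pt_inj: "place i x z = place i x' z' \<longleftrightarrow> x = x' \<and> z = z'" for x z x' z' by (auto simp: place_def)
  have mem: "defin P (\<lambda>e d. (place i (f e) (g e), []) \<in> Z)"
    if "definable P 2 0 Z" "f \<in> term_functions (fst P)" "g \<in> term_functions (fst P)" for Z f g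
    using defin_mem[OF that(1) params_le_refl, of "if i = 0 then [f, g] else [g, f]" "[]"] that(2,3)
    by (cases "i = 0") (simp_all add: place_def)
  define T1 where "T1 = translate i (\<lambda>ys. l (ys ! 0))"
  define T2 where "T2 = translate 0 (\<lambda>_. \<mu>)"
  define h1 where "h1 = induced_contraction i 0 2 T1"
  define h2 where "h2 = induced_contraction 0 (1 - i) 2 T2"
  have h1: "h1 (place i x z, []) = ([z], [rv (x - l z), rv x])" for x z
    by (simp add: h1_def T1_def induced_contraction_def translate_def Let_def pt)
  have h2: "h2 ([z], [r, s]) = ([], place i r (rv (z - \<mu>)) @ [s, rv z])" for z r s
    using i by (auto simp: h2_def T2_def induced_contraction_def translate_def delete_at_def Let_def place_def)
  have c1: "coordinate_bij P i 2 0 A 2 T1"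
    unfolding T1_def
  proof (rule coordinate_bij_translate[OF A])
    have "(\<lambda>(xs, rs). (xs[i := l (delete_at i xs ! 0)], rs)) ` A = (\<lambda>z. (place i (l z) z, [])) ` snd ` C"
      by (force simp: A_def pt image_image)
    thus "definable P 2 0 ((\<lambda>(xs, rs). (xs[i := l (delete_at i xs ! 0)], rs)) ` A)"
      using l by simp
    have "(\<forall>(x, z)\<in>C. rv (l z) = rv x) \<or> (\<forall>z. l z = 0)"
      using contr unfolding contractible_def by blast
    thus "(\<forall>(xs, rs)\<in>A. rv (l (delete_at i xs ! 0)) = rv (xs ! i)) \<or> (\<forall>ys. l (ys ! 0) = 0)"
    proof
      assume *: "\<forall>(x, z)\<in>C. rv (l z) = rv x"
      have "case q of (xs, rs) \<Rightarrow> rv (l (delete_at i xs ! 0)) = rv (xs ! i)" if "q \<in> A" for q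
      proof -
        obtain x z where q: "(x, z) \<in> C" "q = (place i x z, [])" using A_E[OF \<open>q \<in> A\<close>] by blast
        show ?thesis using bspec[OF * q(1)] by (simp add: q(2) pt)
      qed
      thus ?thesis by blast
    qed simp
    show "(xs[i := w + l (delete_at i xs ! 0)], rs) \<in> A"
      if q: "(xs, rs) \<in> A" "rv w = rv (xs ! i - l (delete_at i xs ! 0))" for xs rs w
    proof -
      obtain x z where xz: "(x, z) \<in> C" "(xs, rs) = (place i x z, [])" using A_E[OF q(1)] by blast
      have "(w + l z, z) \<in> C" using pull1[OF xz(1)] q(2) xz(2) by (simp add: pt)
      thus ?thesis using xz(2) by (force simp: A_def pt)
    qed
  qed (use i in auto)
  define A1 where "A1 = h1 ` A"
  have A1: "(zs, rs) \<in> A1 \<longleftrightarrow> (\<exists>x z. (x, z) \<in> C \<and> zs = [z] \<and> rs = [rv (x - l z), rv x])" for zs rs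
  proof
    assume "(zs, rs) \<in> A1"
    then obtain x z where "(x, z) \<in> C" "(zs, rs) = h1 (place i x z, [])" by (auto simp: A1_def A_def)
    thus "\<exists>x z. (x, z) \<in> C \<and> zs = [z] \<and> rs = [rv (x - l z), rv x]" unfolding h1 by auto
  next
    assume "\<exists>x z. (x, z) \<in> C \<and> zs = [z] \<and> rs = [rv (x - l z), rv x]"
    then obtain x z where *: "(x, z) \<in> C" "zs = [z]" "rs = [rv (x - l z), rv x]" by blast
    have "(place i x z, []) \<in> A" using *(1) by (force simp: A_def)
    from imageI[OF this, of h1] show "(zs, rs) \<in> A1" by (simp add: A1_def h1 *(2,3))
  qed
  have defA1: "definable P 1 2 A1"
  proof (rule definable_setI)
    define L where "L = (\<lambda>z. (place i (l z) z, [] :: 'a set list)) ` snd ` C"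
    define Q where "Q e d \<longleftrightarrow> (place i (e 1) (e 0), []) \<in> A \<and> (place i (e 2) (e 0), []) \<in> L \<and>
      d 0 = rv (e 1 - e 2) \<and> d 1 = rv (e 1)"
      for e :: "nat \<Rightarrow> 'a" and d :: "nat \<Rightarrow> 'a set"
    have "defin P Q" unfolding Q_def[abs_def] L_def
      by (intro defin_conj defin_eqR rtf_var rtf_rv tf_ops tf_var mem[OF A] mem[OF l])
    from defin_exV[OF defin_exV[OF this, of 2], of 1]
    show "defin P (\<lambda>e d. \<exists>x w. Q (e(1 := x, 2 := w)) d)" .
    show "A1 \<subseteq> space 1 2" by (auto simp: A1 space_def)
    fix e :: "nat \<Rightarrow> 'a" and d :: "nat \<Rightarrow> 'a set"
    have memA: "(place i x z, []) \<in> A \<longleftrightarrow> (x, z) \<in> C" for x z by (force simp: A_def pt_inj)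
    have memL: "(place i w z, []) \<in> L \<longleftrightarrow> z \<in> snd ` C \<and> w = l z" for w z 
      by (force simp: L_def pt_inj)
    have prj: "z \<in> snd ` C" if "(x, z) \<in> C" for x z using imageI[OF that, of snd] by simp
    have "Q (e(1 := x, 2 := w)) d \<longleftrightarrow> (x, e 0) \<in> C \<and> w = l (e 0) \<and> d 0 = rv (x - l (e 0)) \<and> d 1 = rv x" for x w
      unfolding Q_def memA memL using prj[of x "e 0"] by simp blast
    thus "(\<exists>x w. Q (e(1 := x, 2 := w)) d) \<longleftrightarrow> (map e [0..<1], map d [0..<2]) \<in> A1"
      by (simp add: A1 numeral_2_eq_2)
  qed
  have c2: "coordinate_bij P 0 1 2 A1 2 T2"
    unfolding T2_def
  proof (rule coordinate_bij_translate_line[OF defA1 \<mu>])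
    show "([w + \<mu>], rs) \<in> A1" if q: "([z], rs) \<in> A1" "rv w = rv (z - \<mu>)" for z w rs
    proof -
      obtain x where x: "(x, z) \<in> C" "rs = [rv (x - l z), rv x]" using q(1) unfolding A1 by auto
      from pull2[OF x(1) q(2)] obtain x' where "(x', w + \<mu>) \<in> C"
        "rv (x' - l (w + \<mu>)) = rv (x - l z)" "rv x' = rv x" by blast
      thus ?thesis unfolding A1 x(2) by (intro exI[of _ x'] exI[of _ "w + \<mu>"]) simp
    qed
    have "(\<forall>(x, z)\<in>C. rv \<mu> = rv z) \<or> \<mu> = 0"
      using contr unfolding contractible_def by blast
    thus "(\<forall>z rs. ([z], rs) \<in> A1 \<longrightarrow> rv \<mu> = rv z) \<or> \<mu> = 0"
      unfolding A1 by auto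
  qed
  \<comment> \<open>Once the coordinate \<open>i\<close> is contracted, the other one sits at position \<open>0\<close>.\<close>
  have "{j \<in> insert i {}. j < 1 - i} = (if i = 0 then {0} else {})" using i by auto
  hence card1: "card {j \<in> insert i {}. j < 1 - i} = 1 - i" using i by auto
  have inner: "successive_contraction P [1 - i] (insert i {}) 1 2 A1 4 h2"
    unfolding successive_contraction.simps(2)[of P "1 - i" "[]"] Let_def card1 diff_self_eq_0
  proof (rule exI[of _ 2], rule exI[of _ T2], rule exI[of _ id], intro conjI ballI)
    show "h2 q = id (induced_contraction 0 (1 - i) 2 T2 q)" for q by (simp add: h2_def)
  qed (use c2 in simp_all)
  define T where "T q = (let x = fst q ! i; z = fst q ! (1 - i) in place i (rv (x - l z)) (rv (z - \<mu>)) @ [rv x, rv z])"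
    for q :: "'a point"
  have "successive_contraction P [i, 1 - i] {} 2 0 A 4 (\<lambda>q. ([], T q))"
    unfolding successive_contraction.simps(2)[of P i "[1 - i]"] Let_def
  proof (rule exI[of _ 2], rule exI[of _ T1], rule exI[of _ h2], intro conjI ballI)
    have 0: "card {j \<in> {}. j < i} = 0" by simp
    show "coordinate_bij P (i - card {j \<in> {}. j < i}) 2 0 A 2 T1"
      using c1 by (simp only: 0 diff_zero)
    have "(2::nat) - 1 = 1" by simp
    thus "successive_contraction P [1 - i] (insert i {}) (2 - 1) (0 + 2)
        (induced_contraction (i - card {j \<in> {}. j < i}) (card {j \<in> {}. j < i}) 2 T1 ` A) 4 h2"
      using inner by (simp only: A1_def h1_def 0 add_0 diff_zero)
    fix q assume "q \<in> A"
    then obtain x z where q: "q = (place i x z, [])" using A_E by blast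
    show "([], T q) = h2 (induced_contraction (i - card {j \<in> {}. j < i}) (card {j \<in> {}. j < i}) 2 T1 q)"
      unfolding 0 diff_zero h1_def[symmetric] q h1 h2 by (simp add: T_def pt Let_def del: One_nat_def)
  qed
  moreover have "set [i, 1 - i] = {..<2}" "distinct [i, 1 - i]" using i by auto
  ultimately show ?thesis
    unfolding standard_contraction_def A_def[symmetric] T_def[symmetric] using A by simp
qed


section \<open>Isomorphisms of contracted sets\<close>

definition graph_set :: "('a set list \<times> 'a set list) set \<Rightarrow> 'a point set" where
  "graph_set W = (\<lambda>(u, v). ([], u @ v)) ` W"

lemma mem_graph_set:
  assumes "\<And>u v. (u, v) \<in> W \<Longrightarrow> length u = n" "length u = n"
  shows "([], u @ v) \<in> graph_set W \<longleftrightarrow> (u, v) \<in> W"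
proof
  assume "([], u @ v) \<in> graph_set W"
  then obtain u' v' where *: "(u', v') \<in> W" "u @ v = u' @ v'" by (auto simp: graph_set_def)
  thus "(u, v) \<in> W" using assms(1)[OF *(1)] assms(2) by auto
qed (auto simp: graph_set_def)

end

text \<open>A definable correspondence between subsets of \<open>RV\<^sup>4\<close>. If it is bijective and the last two
  coordinates are constant on both sides, it is an isomorphism for the projections to the first two
  coordinates: a pair of these determines the point, hence its image.\<close>

locale definable_correspondence = acvf val
  for val :: "'a::alg_closed_field \<Rightarrow> 'g::linordered_ab_group_add ext_val" +
  fixes P :: "'a params" and W :: "('a set list \<times> 'a set list) set" and cu cv :: "'a set list"
  assumes defW: "definable P 0 8 (graph_set W)"
    and lenW: "(u, v) \<in> W \<Longrightarrow> length u = 4 \<and> length v = 4"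
    and RVW: "(u, v) \<in> W \<Longrightarrow> set u \<subseteq> RV \<and> set v \<subseteq> RV"
    and bijW: "(u, v) \<in> W \<Longrightarrow> (u', v') \<in> W \<Longrightarrow> u = u' \<longleftrightarrow> v = v'"
    and constW: "(u, v) \<in> W \<Longrightarrow> drop 2 u = cu \<and> drop 2 v = cv"
begin

lemma Domain_space: "Pair [] ` Domain W \<subseteq> space 0 4"
proof (rule image_subsetI)
  fix u assume "u \<in> Domain W"
  then obtain v where "(u, v) \<in> W" by blast
  from lenW[OF this] RVW[OF this] show "([], u) \<in> space 0 4" by (simp add: space_def)
qed

lemma defin_W:
  assumes "params_le P P'" "length us = 4" "length vs = 4"
    "set us \<subseteq> rterm_functions P'" "set vs \<subseteq> rterm_functions P'"
  shows "defin P' (\<lambda>e d. (map (\<lambda>g. g e d) us, map (\<lambda>g. g e d) vs) \<in> W)"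
proof -
  have "defin P' (\<lambda>e d. (map (\<lambda>f. f e) [], map (\<lambda>g. g e d) (us @ vs)) \<in> graph_set W)"
    using assms by (intro defin_mem[OF defW assms(1)]) auto
  moreover have "([], map (\<lambda>g. g e d) (us @ vs)) \<in> graph_set W \<longleftrightarrow>
      (map (\<lambda>g. g e d) us, map (\<lambda>g. g e d) vs) \<in> W" for e :: "nat \<Rightarrow> 'a" and d :: "nat \<Rightarrow> 'a set"
    unfolding map_append by (rule mem_graph_set[of W 4]) (use lenW assms in auto)
  ultimately show ?thesis by simp
qed

lemma list4_iff: "length u = 4 \<longleftrightarrow> (\<exists>a b c d. u = [a, b, c, d])"
  by (auto simp: length_Suc_conv eval_nat_numeral)

lemma upt4: "[0..<4] = [0, 1, 2, 3::nat]"
  by (simp add: eval_nat_numeral)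

lemma definable_domain: "definable P 0 4 (Pair [] ` Domain W)"
proof (rule definable_setI)
  define Q where "Q e d \<longleftrightarrow> (map (\<lambda>g. g e d) (map (\<lambda>j e d. d j) [0, 1, 2, 3]),
      map (\<lambda>g. g e d) (map (\<lambda>j e d. d j) [4, 5, 6, 7])) \<in> W"
    for e :: "nat \<Rightarrow> 'a" and d :: "nat \<Rightarrow> 'a set"
  have "defin P Q" unfolding Q_def[abs_def]
    by (rule defin_W) (simp_all add: rtf_var)
  from defin_exRs[OF this, of "[4, 5, 6, 7]"]
  show "defin P (\<lambda>e d. \<exists>d'. (\<forall>j. j \<notin> set [4, 5, 6, 7] \<longrightarrow> d' j = d j) \<and>
    (\<forall>j\<in>set [4, 5, 6, 7]. d' j \<in> RV) \<and> Q e d')" .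
  show "Pair [] ` Domain W \<subseteq> space 0 4" by (rule Domain_space)
  fix e :: "nat \<Rightarrow> 'a" and d :: "nat \<Rightarrow> 'a set"
  show "(\<exists>d'. (\<forall>j. j \<notin> set [4, 5, 6, 7] \<longrightarrow> d' j = d j) \<and>
    (\<forall>j\<in>set [4, 5, 6, 7]. d' j \<in> RV) \<and> Q e d') \<longleftrightarrow> (map e [0..<0], map d [0..<4]) \<in> Pair [] ` Domain W"
    (is "?L \<longleftrightarrow> ?R")
  proof
    assume ?L
    then obtain d' where d': "\<forall>j. j \<notin> set [4, 5, 6, 7] \<longrightarrow> d' j = d j" "Q e d'" by blast
    have "d' 0 = d 0" "d' 1 = d 1" "d' 2 = d 2" "d' 3 = d 3" using d'(1) by simp_all
    hence "(map d [0..<4], [d' 4, d' 5, d' 6, d' 7]) \<in> W" using d'(2) by (simp add: Q_def upt4)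
    thus ?R by auto
  next
    assume ?R
    then obtain v where v: "(map d [0..<4], v) \<in> W" by auto
    then obtain v0 v1 v2 v3 where v': "v = [v0, v1, v2, v3]" using lenW list4_iff by meson
    have "set v \<subseteq> RV" using RVW[OF v] by simp
    moreover have "Q e (d(4 := v0, 5 := v1, 6 := v2, 7 := v3))" using v by (simp add: Q_def upt4 v')
    ultimately show ?L
      by (intro exI[of _ "d(4 := v0, 5 := v1, 6 := v2, 7 := v3)"]) (simp add: v')
  qed
qed

lemma RV_object_domain: "RV_object P 2 4 (Domain W) (take 2)"
  unfolding RV_object_def definable_RV_fun_def definable_fun_def
proof (intro conjI definable_domain)
  show "Pair [] ` Domain W \<subseteq> space 0 4" by (rule Domain_space)
  show "(\<lambda>q. ([], take 2 (snd q))) ` Pair [] ` Domain W \<subseteq> space 0 2"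
  proof (intro image_subsetI, elim imageE)
    fix q u assume "q = ([], u)" "u \<in> Domain W"
    thus "([], take 2 (snd q)) \<in> space 0 2"
      using subsetD[OF Domain_space, of "([], u)"] set_take_subset[of 2 u] by (auto simp: space_def)
  qed
  define Z :: "'a point set" where "Z = (\<lambda>p. (fst p @ fst ([], take 2 (snd p)), snd p @ snd ([], take 2 (snd p)))) ` Pair [] ` Domain W"
  have Z: "(xs, rs) \<in> Z \<longleftrightarrow> xs = [] \<and> (\<exists>u\<in>Domain W. rs = u @ take 2 u)" for xs rs
    by (auto simp: Z_def image_image)
  have "definable P 0 6 Z"
  proof (rule definable_setI)
    have "defin P (\<lambda>e d. (map (\<lambda>f. f e) [], map (\<lambda>g. g e d) (map (\<lambda>j e d. d j) [0, 1, 2, 3])) \<in> (Pair [] ` Domain W :: 'a point set))"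
      using defin_mem[OF definable_domain params_le_refl, of "[]" "map (\<lambda>j e d. d j) [0, 1, 2, 3]"]
      by (simp add: rtf_var)
    thus "defin P (\<lambda>e d. (map (\<lambda>f. f e) [], map (\<lambda>g. g e d) (map (\<lambda>j e d. d j) [0, 1, 2, 3])) \<in> (Pair [] ` Domain W :: 'a point set)
        \<and> d 4 = d 0 \<and> d 5 = d 1)"
      by (intro defin_conj defin_eqR rtf_var)
    show "Z \<subseteq> space 0 6"
    proof (intro subrelI)
      fix xs rs assume "(xs, rs) \<in> Z"
      then obtain u where u: "u \<in> Domain W" "xs = []" "rs = u @ take 2 u" unfolding Z by blast
      have "length u = 4" "set u \<subseteq> RV"
        using subsetD[OF Domain_space, of "([], u)"] u(1) by (auto simp: space_def)
      thus "(xs, rs) \<in> space 0 6" using u(2,3) set_take_subset[of 2 u] by (auto simp: space_def)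
    qed
    fix e :: "nat \<Rightarrow> 'a" and d :: "nat \<Rightarrow> 'a set"
    have u6: "[0..<6] = [0, 1, 2, 3, 4, 5::nat]" by (simp add: eval_nat_numeral)
    have "(\<exists>u\<in>Domain W. map d [0..<6] = u @ take 2 u) \<longleftrightarrow>
        [d 0, d 1, d 2, d 3] \<in> Domain W \<and> d 4 = d 0 \<and> d 5 = d 1"
    proof
      assume "\<exists>u\<in>Domain W. map d [0..<6] = u @ take 2 u"
      then obtain u where u: "u \<in> Domain W" "map d [0..<6] = u @ take 2 u" by blast
      then obtain a b c f where "u = [a, b, c, f]" using lenW list4_iff by (meson DomainE)
      thus "[d 0, d 1, d 2, d 3] \<in> Domain W \<and> d 4 = d 0 \<and> d 5 = d 1"
        using u by (simp add: u6)
    next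
      assume "[d 0, d 1, d 2, d 3] \<in> Domain W \<and> d 4 = d 0 \<and> d 5 = d 1"
      thus "\<exists>u\<in>Domain W. map d [0..<6] = u @ take 2 u"
        by (intro bexI[of _ "[d 0, d 1, d 2, d 3]"]) (simp_all add: u6)
    qed
    thus "((map (\<lambda>f. f e) [], map (\<lambda>g. g e d) (map (\<lambda>j e d. d j) [0, 1, 2, 3])) \<in> (Pair [] ` Domain W :: 'a point set)
        \<and> d 4 = d 0 \<and> d 5 = d 1) \<longleftrightarrow> (map e [0..<0], map d [0..<6]) \<in> Z"
      unfolding Z by (simp add: image_iff)
  qed
  thus "definable P (0 + 0) (4 + 2)
     ((\<lambda>p. (fst p @ fst ([], take 2 (snd p)), snd p @ snd ([], take 2 (snd p)))) ` Pair [] ` Domain W)"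
    unfolding Z_def by simp
qed

lemma acl_of_image:
  assumes uv: "(u, v) \<in> W"
  shows "take 2 v \<in> acl_RV P (take 2 u)"
proof -
  define P' where "P' = extend_params P ([], take 2 u)"
  obtain u0 u1 u2 u3 where u: "u = [u0, u1, u2, u3]" using lenW[OF uv] list4_iff by meson
  obtain v0 v1 v2 v3 where v: "v = [v0, v1, v2, v3]" using lenW[OF uv] list4_iff by meson
  have PP': "params_le P P'" by (simp add: P'_def)
  define us :: "((nat \<Rightarrow> 'a) \<Rightarrow> (nat \<Rightarrow> 'a set) \<Rightarrow> 'a set) list"
    where "us = [\<lambda>e d. u0, \<lambda>e d. u1, \<lambda>e d. d 2, \<lambda>e d. d 3]"
  define vs :: "((nat \<Rightarrow> 'a) \<Rightarrow> (nat \<Rightarrow> 'a set) \<Rightarrow> 'a set) list"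
    where "vs = [\<lambda>e d. d 0, \<lambda>e d. d 1, \<lambda>e d. d 4, \<lambda>e d. d 5]"
  define Q where "Q e d \<longleftrightarrow> (map (\<lambda>g. g e d) us, map (\<lambda>g. g e d) vs) \<in> W" for e d
  have "u0 \<in> snd P'" "u1 \<in> snd P'" by (simp_all add: P'_def extend_params_def u numeral_2_eq_2)
  hence "defin P' Q" unfolding Q_def[abs_def]
    by (intro defin_W[OF PP']) (auto simp: us_def vs_def rtf_var rtf_const)
  hence R: "defin P' (\<lambda>e d. \<exists>d'. (\<forall>j. j \<notin> set [2, 3, 4, 5] \<longrightarrow> d' j = d j) \<and>
      (\<forall>j\<in>set [2, 3, 4, 5]. d' j \<in> RV) \<and> Q e d')"
    by (rule defin_exRs)
  have "definable P' 0 2 {([], take 2 v)}"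
  proof (rule definable_setI[OF R])
    show "{([], take 2 v)} \<subseteq> space 0 2" using RVW[OF uv] by (auto simp: space_def v)
    fix e :: "nat \<Rightarrow> 'a" and d :: "nat \<Rightarrow> 'a set"
    have "(\<exists>d'. (\<forall>j. j \<notin> set [2, 3, 4, 5] \<longrightarrow> d' j = d j) \<and>
      (\<forall>j\<in>set [2, 3, 4, 5]. d' j \<in> RV) \<and> Q e d') \<longleftrightarrow> d 0 = v0 \<and> d 1 = v1" (is "?L \<longleftrightarrow> ?R")
    proof
      assume ?L
      then obtain d' where d': "\<forall>j. j \<notin> set [2, 3, 4, 5] \<longrightarrow> d' j = d j" "Q e d'" by blast
      have d01: "d' 0 = d 0" "d' 1 = d 1" using d'(1) by simp_all
      have W: "([u0, u1, d' 2, d' 3], [d' 0, d' 1, d' 4, d' 5]) \<in> W"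
        using d'(2) by (simp add: Q_def us_def vs_def)
      have "[u0, u1, d' 2, d' 3] = u" using constW[OF W] constW[OF uv] by (simp add: u)
      hence "[d' 0, d' 1, d' 4, d' 5] = v" using bijW[OF W uv] by simp
      thus ?R using d01 by (simp add: v)
    next
      assume ?R
      have "set u \<subseteq> RV" "set v \<subseteq> RV" using RVW[OF uv] by simp_all
      moreover have "Q e (d(2 := u2, 3 := u3, 4 := v2, 5 := v3))"
        using uv \<open>?R\<close> by (simp add: Q_def us_def vs_def u v)
      ultimately show ?L
        by (intro exI[of _ "d(2 := u2, 3 := u3, 4 := v2, 5 := v3)"]) (simp add: u v)
    qed
    thus "(\<exists>d'. (\<forall>j. j \<notin> set [2, 3, 4, 5] \<longrightarrow> d' j = d j) \<and>
      (\<forall>j\<in>set [2, 3, 4, 5]. d' j \<in> RV) \<and> Q e d') \<longleftrightarrow> (map e [0..<0], map d [0..<2]) \<in> {([], take 2 v)}"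
      by (simp add: v numeral_2_eq_2)
  qed
  thus ?thesis unfolding acl_RV_def P'_def using lenW[OF uv]
    by (intro CollectI exI[of _ "{([], take 2 v)}"]) auto
qed

lemma converse_correspondence: "definable_correspondence val P (W\<inverse>) cv cu"
proof
  show "definable P 0 8 (graph_set (W\<inverse>))"
  proof (rule definable_setI)
    define Q where "Q e d \<longleftrightarrow> (map (\<lambda>g. g e d) (map (\<lambda>j e d. d j) [4, 5, 6, 7]),
        map (\<lambda>g. g e d) (map (\<lambda>j e d. d j) [0, 1, 2, 3])) \<in> W"
      for e :: "nat \<Rightarrow> 'a" and d :: "nat \<Rightarrow> 'a set"
    show "defin P Q" unfolding Q_def[abs_def]
      by (rule defin_W) (simp_all add: rtf_var)
    show "graph_set (W\<inverse>) \<subseteq> space 0 8" 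
    proof (intro subrelI)
      fix xs rs assume "(xs, rs) \<in> graph_set (W\<inverse>)"
      then obtain u v where uv: "(u, v) \<in> W" "xs = []" "rs = v @ u" by (auto simp: graph_set_def)
      thus "(xs, rs) \<in> space 0 8" using lenW[OF uv(1)] RVW[OF uv(1)] by (simp add: space_def)
    qed
    fix e :: "nat \<Rightarrow> 'a" and d :: "nat \<Rightarrow> 'a set"
    have u8: "map d [0..<8] = [d 0, d 1, d 2, d 3] @ [d 4, d 5, d 6, d 7]"
      by (simp add: eval_nat_numeral)
    have "([], map d [0..<8]) \<in> graph_set (W\<inverse>) \<longleftrightarrow> ([d 0, d 1, d 2, d 3], [d 4, d 5, d 6, d 7]) \<in> W\<inverse>"
      unfolding u8 by (rule mem_graph_set[of _ 4]) (use lenW in auto)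
    thus "Q e d \<longleftrightarrow> (map e [0..<0], map d [0..<8]) \<in> graph_set (W\<inverse>)" by (simp add: Q_def)
  qed
qed (use lenW RVW bijW constW in auto)

theorem RV_iso_of_correspondence:
  assumes count: "\<And>u v. (u, v) \<in> W \<Longrightarrow>
    length (filter (\<lambda>t. t \<noteq> RV_infty) (take 2 u)) = length (filter (\<lambda>t. t \<noteq> RV_infty) (take 2 v))"
  shows "\<exists>F. RV_iso P 2 4 (Domain W) (take 2) 4 (Range W) (take 2) F"
proof -
  interpret conv: definable_correspondence val P "W\<inverse>" cv cu by (rule converse_correspondence)
  define F where "F u = (THE v. (u, v) \<in> W)" for u
  have F: "F u = v" if "(u, v) \<in> W" for u v
    unfolding F_def using that bijW[OF that] by (intro the_equality) auto
  have "RV_object P 2 4 (Range W) (take 2)" using conv.RV_object_domain by simp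
  moreover have "definable_RV_fun P 4 4 (Domain W) F"
    unfolding definable_RV_fun_def definable_fun_def
  proof (intro conjI)
    show "Pair [] ` Domain W \<subseteq> space 0 4" by (rule Domain_space)
    show "(\<lambda>q. ([], F (snd q))) ` Pair [] ` Domain W \<subseteq> space 0 4"
    proof (intro image_subsetI, elim imageE)
      fix q u assume q: "q = ([], u)" "u \<in> Domain W"
      then obtain v where v: "(u, v) \<in> W" by blast
      show "([], F (snd q)) \<in> space 0 4"
        using lenW[OF v] RVW[OF v] by (simp add: q(1) F[OF v] space_def)
    qed
    have "(\<lambda>p. (fst p @ fst ([], F (snd p)), snd p @ snd ([], F (snd p)))) ` Pair [] ` Domain W = graph_set W"
      using F by (force simp: graph_set_def image_image)
    thus "definable P (0 + 0) (4 + 4)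
      ((\<lambda>p. (fst p @ fst ([], F (snd p)), snd p @ snd ([], F (snd p)))) ` Pair [] ` Domain W)"
      using defW by simp
  qed
  moreover have "bij_betw F (Domain W) (Range W)"
  proof (rule bij_betwI')
    show "(F u = F u') = (u = u')" if "u \<in> Domain W" "u' \<in> Domain W" for u u'
      using that F bijW by (auto elim!: DomainE)
    show "F u \<in> Range W" if "u \<in> Domain W" for u using that F by auto
    show "\<exists>u\<in>Domain W. v = F u" if "v \<in> Range W" for v using that F by force
  qed
  moreover have "length (filter (\<lambda>t. t \<noteq> RV_infty) (take 2 u)) = length (filter (\<lambda>t. t \<noteq> RV_infty) (take 2 (F u))) \<and>
      take 2 (F u) \<in> acl_RV P (take 2 u) \<and> take 2 u \<in> acl_RV P (take 2 (F u))" if u: "u \<in> Domain W" for u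
  proof -
    obtain v where v: "(u, v) \<in> W" using u by blast
    have "(v, u) \<in> W\<inverse>" using v by simp
    from conv.acl_of_image[OF this] acl_of_image[OF v] count[OF v] show ?thesis
      unfolding F[OF v] by simp
  qed
  ultimately show ?thesis
    unfolding RV_iso_def using RV_object_domain by (intro exI[of _ F] conjI ballI) auto
qed

end

context acvf
begin

definition isomorphic_contractions :: "'a params \<Rightarrow> ('a \<times> 'a) set \<Rightarrow> bool" where
  "isomorphic_contractions P A \<longleftrightarrow> (\<exists>k T k' R F.
      standard_contraction P [0, 1] 2 0 (plane A) k T \<and>
      standard_contraction P [1, 0] 2 0 (plane A) k' R \<and>
      RV_iso P 2 k (T ` plane A) (take 2) k' (R ` plane A) (take 2) F)"

text \<open>The sets \<open>U ` A\<close> and \<open>V ` A\<close> are the contractions in the two orders. The isomorphism is described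
  by a definable relation \<open>E\<close> between points of \<open>A\<close>: it takes \<open>U p\<close> to \<open>V p'\<close> for all \<open>(p, p') \<in> E\<close>.
  The last two coordinates are constant as \<open>A\<close> lies in a product of rv-balls.\<close>

theorem isomorphic_contractionsI:
  fixes A :: "('a \<times> 'a) set" and l l' :: "'a \<Rightarrow> 'a" and \<mu> \<mu>' :: 'a
    and E :: "(('a \<times> 'a) \<times> 'a \<times> 'a) set"
  defines "U \<equiv> \<lambda>(x, y). [rv (x - l y), rv (y - \<mu>), rv x, rv y]"
    and "V \<equiv> \<lambda>(x, y). [rv (x - \<mu>'), rv (y - l' x), rv y, rv x]"
  assumes A: "definable P 2 0 (plane A)"
    and rvA: "\<And>x y. (x, y) \<in> A \<Longrightarrow> rv x = s1 \<and> rv y = s2"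
    and l: "definable P 2 0 (plane ((\<lambda>y. (l y, y)) ` snd ` A))"
    and l': "definable P 2 0 (plane ((\<lambda>x. (x, l' x)) ` fst ` A))"
    and \<mu>: "definable_point P \<mu>" and \<mu>': "definable_point P \<mu>'"
    and contr: "contractible A l \<mu>" and contr': "contractible (A\<inverse>) l' \<mu>'"
    and E: "defin P (\<lambda>e d. ((e 0, e 1), (e 2, e 3)) \<in> E)"
    and EA: "E \<subseteq> A \<times> A"
    and E_total: "\<And>p. p \<in> A \<Longrightarrow> \<exists>p'. (p, p') \<in> E"
    and E_surj: "\<And>p'. p' \<in> A \<Longrightarrow> \<exists>p q. (p, q) \<in> E \<and> V q = V p'"
    and E_iff: "\<And>p p' q q'. (p, p') \<in> E \<Longrightarrow> (q, q') \<in> E \<Longrightarrow> U p = U q \<longleftrightarrow> V p' = V q'"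
    and count: "\<And>p p'. (p, p') \<in> E \<Longrightarrow> length (filter (\<lambda>t. t \<noteq> RV_infty) (take 2 (U p)))
      = length (filter (\<lambda>t. t \<noteq> RV_infty) (take 2 (V p')))"
  shows "isomorphic_contractions P A"
proof -
  define W where "W = (\<lambda>(p, p'). (U p, V p')) ` E"
  have W: "\<exists>p p'. (p, p') \<in> E \<and> u = U p \<and> v = V p'" if "(u, v) \<in> W" for u v
    using that by (auto simp: W_def)
  have UV: "U (x, y) = [rv (x - l y), rv (y - \<mu>), rv x, rv y]"
    "V (x, y) = [rv (x - \<mu>'), rv (y - l' x), rv y, rv x]" for x y
    by (simp_all add: U_def V_def)
  have "definable_correspondence val P W [s1, s2] [s2, s1]"
  proof
    show "definable P 0 8 (graph_set W)"
    proof (rule definable_setI)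
      define Q where "Q e d \<longleftrightarrow> ((e 0, e 1), (e 2, e 3)) \<in> E \<and>
          (e 4, e 1) \<in> (\<lambda>y. (l y, y)) ` snd ` A \<and> (e 2, e 5) \<in> (\<lambda>x. (x, l' x)) ` fst ` A \<and>
          e 6 = \<mu> \<and> e 7 = \<mu>' \<and>
          d 0 = rv (e 0 - e 4) \<and> d 1 = rv (e 1 - e 6) \<and> d 2 = rv (e 0) \<and> d 3 = rv (e 1) \<and>
          d 4 = rv (e 2 - e 7) \<and> d 5 = rv (e 3 - e 5) \<and> d 6 = rv (e 3) \<and> d 7 = rv (e 2)"
        for e :: "nat \<Rightarrow> 'a" and d :: "nat \<Rightarrow> 'a set"
      have "defin P Q" unfolding Q_def[abs_def]
        by (intro defin_conj defin_eqR rtf_var rtf_rv tf_ops tf_var defin_mem_plane[OF l]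
            defin_mem_plane[OF l'] defin_eq_point[OF \<mu>] defin_eq_point[OF \<mu>'] params_le_refl E)
      from defin_exVs[OF this, of "[0..<8]"]
      show "defin P (\<lambda>e d. \<exists>e'. (\<forall>j. j \<notin> set [0..<8] \<longrightarrow> e' j = e j) \<and> Q e' d)" .
      show "graph_set W \<subseteq> space 0 8"
      proof (intro subrelI)
        fix xs rs assume "(xs, rs) \<in> graph_set W"
        then obtain p p' where "(p, p') \<in> E" "xs = []" "rs = U p @ V p'"
          by (auto simp: graph_set_def W_def)
        thus "(xs, rs) \<in> space 0 8" by (cases p; cases p') (simp add: UV space_def)
      qed
      fix e :: "nat \<Rightarrow> 'a" and d :: "nat \<Rightarrow> 'a set"
      have d8: "map d [0..<8] = [d 0, d 1, d 2, d 3, d 4, d 5, d 6, d 7]"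
        by (simp add: eval_nat_numeral)
      have lg: "(z, y) \<in> (\<lambda>y. (l y, y)) ` snd ` A \<longleftrightarrow> y \<in> snd ` A \<and> z = l y" for z y by auto
      have lg': "(x, z) \<in> (\<lambda>x. (x, l' x)) ` fst ` A \<longleftrightarrow> x \<in> fst ` A \<and> z = l' x" for z x by auto
      have prj: "x \<in> fst ` A \<and> y \<in> snd ` A" if "(x, y) \<in> A" for x y
        using imageI[OF that, of fst] imageI[OF that, of snd] by simp
      show "(\<exists>e'. (\<forall>j. j \<notin> set [0..<8] \<longrightarrow> e' j = e j) \<and> Q e' d)
          \<longleftrightarrow> (map e [0..<0], map d [0..<8]) \<in> graph_set W"
      proof
        assume "\<exists>e'. (\<forall>j. j \<notin> set [0..<8] \<longrightarrow> e' j = e j) \<and> Q e' d"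
        then obtain e' where Q: "Q e' d" by blast
        hence "((e' 0, e' 1), (e' 2, e' 3)) \<in> E" by (simp add: Q_def)
        hence "(U (e' 0, e' 1), V (e' 2, e' 3)) \<in> W" by (force simp: W_def)
        hence "([], U (e' 0, e' 1) @ V (e' 2, e' 3)) \<in> graph_set W" by (force simp: graph_set_def)
        moreover have "map d [0..<8] = U (e' 0, e' 1) @ V (e' 2, e' 3)"
          unfolding d8 UV using Q by (simp add: Q_def lg lg')
        ultimately show "(map e [0..<0], map d [0..<8]) \<in> graph_set W" by simp
      next
        assume "(map e [0..<0], map d [0..<8]) \<in> graph_set W"
        then obtain x y x' y' where xy: "((x, y), (x', y')) \<in> E" "map d [0..<8] = U (x, y) @ V (x', y')"
          by (auto simp: graph_set_def W_def)
        define e' where "e' j = (if j < 8 then [x, y, x', y', l y, l' x', \<mu>, \<mu>'] ! j else e j)" for j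
        have "(x, y) \<in> A" "(x', y') \<in> A" using xy(1) EA by auto
        hence "x' \<in> fst ` A" "y \<in> snd ` A" using prj by blast+
        hence "Q e' d" using xy unfolding d8 UV by (simp add: Q_def lg lg' e'_def)
        moreover have "\<forall>j. j \<notin> set [0..<8] \<longrightarrow> e' j = e j" by (simp add: e'_def)
        ultimately show "\<exists>e'. (\<forall>j. j \<notin> set [0..<8] \<longrightarrow> e' j = e j) \<and> Q e' d" by blast
      qed
    qed
    fix u v assume uv: "(u, v) \<in> W"
    obtain p p' where p: "(p, p') \<in> E" "u = U p" "v = V p'" using W[OF uv] by blast
    obtain x y x' y' where xy: "p = (x, y)" "p' = (x', y')" by fastforce
    have inA: "(x, y) \<in> A" "(x', y') \<in> A" using p(1) EA by (auto simp: xy)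
    show "length u = 4 \<and> length v = 4" "set u \<subseteq> RV \<and> set v \<subseteq> RV"
      by (simp_all add: p xy UV)
    show "drop 2 u = [s1, s2] \<and> drop 2 v = [s2, s1]"
      using rvA[OF inA(1)] rvA[OF inA(2)] by (simp add: p xy UV)
    fix u' v' assume uv': "(u', v') \<in> W"
    show "u = u' \<longleftrightarrow> v = v'" using W[OF uv'] E_iff p by blast
  qed
  then interpret definable_correspondence val P W "[s1, s2]" "[s2, s1]" .
  have "length (filter (\<lambda>t. t \<noteq> RV_infty) (take 2 u)) = length (filter (\<lambda>t. t \<noteq> RV_infty) (take 2 v))"
    if "(u, v) \<in> W" for u v
    using W[OF that] count by blast
  from RV_iso_of_correspondence[OF this] obtain F
    where F: "RV_iso P 2 4 (Domain W) (take 2) 4 (Range W) (take 2) F" by blast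
  define T :: "'a point \<Rightarrow> 'a set list" where "T = (\<lambda>q. let x = fst q ! 0; z = fst q ! (1 - 0)
    in place 0 (rv (x - l z)) (rv (z - \<mu>)) @ [rv x, rv z])"
  define R :: "'a point \<Rightarrow> 'a set list" where "R = (\<lambda>q. let x = fst q ! 1; z = fst q ! (1 - 1)
    in place 1 (rv (x - l' z)) (rv (z - \<mu>')) @ [rv x, rv z])"
  have "T ` plane A = U ` A"
    by (force simp: plane_def T_def U_def image_image Let_def place_def)
  also have "\<dots> = Domain W"
  proof
    show "U ` A \<subseteq> Domain W" using E_total by (force simp: W_def)
    show "Domain W \<subseteq> U ` A" using EA by (auto simp: W_def)
  qed
  finally have T: "T ` plane A = Domain W" .
  have "R ` plane A = V ` A"
    by (force simp: plane_def R_def V_def image_image Let_def place_def)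
  also have "\<dots> = Range W"
  proof
    show "V ` A \<subseteq> Range W"
    proof
      fix v assume "v \<in> V ` A"
      then obtain p q where "(p, q) \<in> E" "V q = v" using E_surj by blast
      thus "v \<in> Range W" by (force simp: W_def)
    qed
    show "Range W \<subseteq> V ` A" using EA by (auto simp: W_def)
  qed
  finally have R: "R ` plane A = Range W" .
  have plane0: "(\<lambda>(x, z). (place 0 x z, [])) ` C = plane C" for C :: "('a \<times> 'a) set"
    by (simp add: plane_def place_def)
  have plane1: "(\<lambda>(x, z). (place 1 x z, [])) ` (C\<inverse>) = plane C" for C :: "('a \<times> 'a) set"
    by (force simp: plane_def place_def)
  have l0: "(\<lambda>z. (place 0 (l z) z, [])) ` snd ` A = plane ((\<lambda>y. (l y, y)) ` snd ` A)"
    by (simp add: plane_def place_def image_image)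
  have l1: "(\<lambda>z. (place 1 (l' z) z, [])) ` snd ` (A\<inverse>) = plane ((\<lambda>x. (x, l' x)) ` fst ` A)"
    by (force simp: plane_def place_def image_image)
  have "standard_contraction P [0, 1] 2 0 (plane A) 4 T"
    using contraction_of_contractible[of 0 P A l \<mu>, unfolded plane0 l0, OF _ A l \<mu> contr]
    by (simp add: T_def)
  moreover have "standard_contraction P [1, 0] 2 0 (plane A) 4 R"
    using contraction_of_contractible[of 1 P "A\<inverse>" l' \<mu>', unfolded plane1 l1, OF _ A l' \<mu>' contr']
    by (simp add: R_def)
  ultimately show ?thesis
    using F unfolding T[symmetric] R[symmetric] isomorphic_contractions_def by blast
qed

lemma contractible_product:
  assumes "center B1 \<mu>1" "center B2 \<mu>2"
  shows "contractible (B1 \<times> B2) (\<lambda>_. \<mu>1) \<mu>2"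
  unfolding contractible_def
proof (intro conjI allI impI)
  have c1: "w + \<mu>1 \<in> B1" if "x \<in> B1" "rv w = rv (x - \<mu>1)" for x w
    using assms(1) that unfolding center_def by blast
  have c2: "w + \<mu>2 \<in> B2" if "z \<in> B2" "rv w = rv (z - \<mu>2)" for z w
    using assms(2) that unfolding center_def by blast
  show "(w + \<mu>1, z) \<in> B1 \<times> B2" if "(x, z) \<in> B1 \<times> B2" "rv w = rv (x - \<mu>1)" for x z w
    using c1[of x w] that by simp
  show "\<exists>x'. (x', w + \<mu>2) \<in> B1 \<times> B2 \<and> rv (x' - \<mu>1) = rv (x - \<mu>1) \<and> rv x' = rv x"
    if "(x, z) \<in> B1 \<times> B2" "rv w = rv (z - \<mu>2)" for x z w
    using c2[of z w] that by (intro exI[of _ x]) simp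
  show "(\<forall>(x, z)\<in>B1 \<times> B2. rv \<mu>1 = rv x) \<or> (\<forall>z::'a. \<mu>1 = 0)"
    using assms(1) unfolding center_def by blast
  show "(\<forall>(x, z)\<in>B1 \<times> B2. rv \<mu>2 = rv z) \<or> \<mu>2 = 0"
    using assms(2) unfolding center_def by blast
qed

lemma contractible_fibred:
  assumes C: "\<And>x z. (x, z) \<in> C \<longleftrightarrow> z \<in> B \<and> rv (x - l z) = t"
    and s: "\<And>x z. (x, z) \<in> C \<Longrightarrow> rv x = s" "\<And>z. z \<in> B \<Longrightarrow> rv (l z) = s"
    and \<mu>: "center B \<mu>"
  shows "contractible C l \<mu>"
  unfolding contractible_def
proof (intro conjI allI impI)
  show "(w + l z, z) \<in> C" if "(x, z) \<in> C" "rv w = rv (x - l z)" for x z w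
    using that by (simp add: C)
  have "rv (l z) = rv x" if "(x, z) \<in> C" for x z
    using s(1)[OF that] s(2)[of z] that by (simp add: C)
  thus "(\<forall>(x, z)\<in>C. rv (l z) = rv x) \<or> (\<forall>z. l z = 0)" by blast
  show "\<exists>x'. (x', w + \<mu>) \<in> C \<and> rv (x' - l (w + \<mu>)) = rv (x - l z) \<and> rv x' = rv x"
    if xz: "(x, z) \<in> C" and w: "rv w = rv (z - \<mu>)" for x z w
  proof -
    have "z \<in> B" using xz by (simp add: C)
    hence "w + \<mu> \<in> B" using \<mu> w unfolding center_def by blast
    hence in_C: "(l (w + \<mu>) + (x - l z), w + \<mu>) \<in> C" using xz by (simp add: C)
    have "rv (l (w + \<mu>) + (x - l z)) = rv x" using s(1)[OF in_C] s(1)[OF xz] by simp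
    with in_C show ?thesis by (intro exI[of _ "l (w + \<mu>) + (x - l z)"]) simp
  qed
  have "z \<in> B" if "(x, z) \<in> C" for x z using that by (simp add: C)
  thus "(\<forall>(x, z)\<in>C. rv \<mu> = rv z) \<or> \<mu> = 0" using \<mu> unfolding center_def by blast
qed

section \<open>2-cells\<close>

lemma definable_fst:
  assumes A: "definable P 2 0 (plane A)"
  shows "definable P 1 0 (line (fst ` A))"
proof (rule definable_lineI)
  have "defin P (\<lambda>e d. (e 0, e 1) \<in> A)"
    by (intro defin_mem_plane[OF A] params_le_refl tf_var)
  from defin_exV[OF this, of 1] show "defin P (\<lambda>e d. \<exists>a. ((e(1 := a)) 0, (e(1 := a)) 1) \<in> A)" .
qed (force simp: image_iff)

lemma definable_snd:
  assumes A: "definable P 2 0 (plane A)"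
  shows "definable P 1 0 (line (snd ` A))"
proof (rule definable_lineI)
  have "defin P (\<lambda>e d. (e 1, e 0) \<in> A)"
    by (intro defin_mem_plane[OF A] params_le_refl tf_var)
  from defin_exV[OF this, of 1] show "defin P (\<lambda>e d. \<exists>a. ((e(1 := a)) 1, (e(1 := a)) 0) \<in> A)" .
qed (force simp: image_iff)

theorem isomorphic_contractions_product:
  assumes A: "definable P 2 0 (plane (B1 \<times> B2))"
    and s1: "\<And>x. x \<in> B1 \<Longrightarrow> rv x = s1" and s2: "\<And>y. y \<in> B2 \<Longrightarrow> rv y = s2"
    and \<mu>1: "definable_point P \<mu>1" "center B1 \<mu>1" and \<mu>2: "definable_point P \<mu>2" "center B2 \<mu>2"
  shows "isomorphic_contractions P (B1 \<times> B2)"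
proof (rule isomorphic_contractionsI[where l = "\<lambda>_. \<mu>1" and l' = "\<lambda>_. \<mu>2" and \<mu> = \<mu>2 and \<mu>' = \<mu>1
      and E = "Id_on (B1 \<times> B2)" and ?s1.0 = s1 and ?s2.0 = s2, OF A])
  show "definable P 2 0 (plane ((\<lambda>y. (\<mu>1, y)) ` snd ` (B1 \<times> B2)))"
    by (rule definable_planeI[OF defin_conj[OF defin_eq_point[OF \<mu>1(1) params_le_refl tf_var[of 0]]
            defin_mem_line[OF definable_snd[OF A] params_le_refl tf_var[of 1]]]]) auto
  show "definable P 2 0 (plane ((\<lambda>x. (x, \<mu>2)) ` fst ` (B1 \<times> B2)))"
    by (rule definable_planeI[OF defin_conj[OF defin_eq_point[OF \<mu>2(1) params_le_refl tf_var[of 1]]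
            defin_mem_line[OF definable_fst[OF A] params_le_refl tf_var[of 0]]]]) auto
  show "defin P (\<lambda>e d. ((e 0, e 1), e 2, e 3) \<in> Id_on (B1 \<times> B2))"
  proof -
    have "defin P (\<lambda>e d. (e 0, e 1) \<in> B1 \<times> B2 \<and> e 2 = e 0 \<and> e 3 = e 1)"
      by (intro defin_conj defin_eqV defin_mem_plane[OF A] params_le_refl tf_var)
    moreover have "((e 0, e 1) \<in> B1 \<times> B2 \<and> e 2 = e 0 \<and> e 3 = e 1) \<longleftrightarrow> ((e 0, e 1), e 2, e 3) \<in> Id_on (B1 \<times> B2)"
      for e :: "nat \<Rightarrow> 'a" by auto
    ultimately show ?thesis by (simp only:)
  qed
  show "rv x = s1 \<and> rv y = s2" if "(x, y) \<in> B1 \<times> B2" for x y using s1 s2 that by simp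
  show "definable_point P \<mu>1" "definable_point P \<mu>2" by fact+
  show "contractible (B1 \<times> B2) (\<lambda>_. \<mu>1) \<mu>2" by (rule contractible_product[OF \<mu>1(2) \<mu>2(2)])
  have "(B1 \<times> B2)\<inverse> = B2 \<times> B1" by auto
  thus "contractible ((B1 \<times> B2)\<inverse>) (\<lambda>_. \<mu>2) \<mu>1"
    using contractible_product[OF \<mu>2(2) \<mu>1(2)] by simp
  show "Id_on (B1 \<times> B2) \<subseteq> (B1 \<times> B2) \<times> B1 \<times> B2" by auto
  show "\<exists>p'. (p, p') \<in> Id_on (B1 \<times> B2)" if "p \<in> B1 \<times> B2" for p
    using that by blast
  show "\<exists>p q. (p, q) \<in> Id_on (B1 \<times> B2) \<and> (case q of (x, y) \<Rightarrow> [rv (x - \<mu>1), rv (y - \<mu>2), rv y, rv x])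
      = (case p' of (x, y) \<Rightarrow> [rv (x - \<mu>1), rv (y - \<mu>2), rv y, rv x])" if "p' \<in> B1 \<times> B2" for p'
    using that by blast
qed (auto elim!: Id_onE)

lemma open_ball_nonempty: "is_open_ball B \<Longrightarrow> B \<noteq> {}"
proof -
  assume "is_open_ball B"
  then obtain b \<gamma> where "B = open_ball b \<gamma>" by (auto simp: is_open_ball_def)
  hence "b \<in> B" by (simp add: open_ball_def)
  thus ?thesis by blast
qed

lemma open_ball_shift:
  assumes "is_open_ball B" "a \<in> B" "b \<in> B" "c \<in> B"
  shows "a + (b - c) \<in> B"
proof -
  obtain z \<gamma> where B: "B = open_ball z \<gamma>" using assms(1) by (auto simp: is_open_ball_def)
  obtain g where g: "val g = Fin \<gamma>" using val_surj by blast
  have "b - c \<prec> g"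
    using vlt_diff[of "b - z" g "c - z"] assms(3,4) unfolding B open_ball_vlt[OF g] by simp
  from vlt_add[OF _ this, of "a - z"] assms(2) show ?thesis
    unfolding B open_ball_vlt[OF g] by (simp add: algebra_simps)
qed

lemma Fin_plus_less_iff: "Fin \<delta> + v < Fin \<delta> + w \<longleftrightarrow> v < w" for v w :: "'g ext_val"
  by (cases v; cases w) (simp_all add: less_ext_val_def)

text \<open>The point \<open>(x, y)\<close> is related to the points \<open>(x', y')\<close> of \<open>A\<close> with \<open>f x' = y\<close>: contracting the
  first coordinate forgets \<open>x\<close>, contracting the second one forgets \<open>y'\<close>, and \<open>f\<close> matches what is
  left.\<close>

theorem isomorphic_contractions_balanced:
  assumes A: "definable P 2 0 (plane A)"
    and s: "\<And>x y. (x, y) \<in> A \<Longrightarrow> rv x = s1 \<and> rv y = s2"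
    and f: "definable P 2 0 (plane ((\<lambda>x. (x, f x)) ` fst ` A))"
    and bal: "balanced A f"
  shows "isomorphic_contractions P A"
proof -
  define B1 where "B1 = fst ` A"
  define B2 where "B2 = snd ` A"
  have B1: "is_open_ball B1" and B2: "is_open_ball B2" and bij: "bij_betw f B1 B2"
    and Glin: "Gamma_linear B1 f"
    using bal by (simp_all add: balanced_def B1_def B2_def)
  obtain t1 t2 where fibs: "\<forall>a\<in>B1. fib A a = (\<lambda>y. y + f a) ` (rv -` {t2}) \<and>
      {x \<in> B1. f x \<in> fib A a} = (\<lambda>x. a - x) ` (rv -` {t1})"
    using bal unfolding balanced_def B1_def[symmetric] by blast
  obtain \<delta> where \<delta>: "\<forall>a\<in>B1. \<forall>a'\<in>B1. val (f a - f a') = Fin \<delta> + val (a - a')"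
    using Glin unfolding Gamma_linear_def by blast
  have A_B1: "x \<in> B1" and A_B2: "y \<in> B2" if "(x, y) \<in> A" for x y
    using imageI[OF that, of fst] imageI[OF that, of snd] by (simp_all add: B1_def B2_def)
  have B1_A: "\<exists>y. (x, y) \<in> A" if "x \<in> B1" for x using that by (auto simp: B1_def)
  have B2_A: "\<exists>x. (x, y) \<in> A" if "y \<in> B2" for y using that by (auto simp: B2_def)
  have rv1: "rv x = s1" if "x \<in> B1" for x using B1_A[OF that] s by blast
  have rv2: "rv y = s2" if "y \<in> B2" for y using B2_A[OF that] s by blast
  define g where "g = the_inv_into B1 f"
  have f_B2: "f x \<in> B2" if "x \<in> B1" for x using bij_betwE[OF bij] that by blast
  have g_B1: "g y \<in> B1" and fg: "f (g y) = y" if "y \<in> B2" for y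
    using bij_betwE[OF bij_betw_the_inv_into[OF bij]] f_the_inv_into_f_bij_betw[OF bij, of y] that
    by (simp_all add: g_def)
  have inj: "f x = f x' \<longleftrightarrow> x = x'" if "x \<in> B1" "x' \<in> B1" for x x'
    using inj_on_eq_iff[OF bij_betw_imp_inj_on[OF bij] that] .
  have gf: "g (f x) = x" if "x \<in> B1" for x
    using inj[OF g_B1[OF f_B2[OF that]] that] fg[OF f_B2[OF that]] by simp
  have fib2: "(x, y) \<in> A \<longleftrightarrow> rv (y - f x) = t2" if x: "x \<in> B1" for x y
  proof -
    have "y \<in> fib A x \<longleftrightarrow> y \<in> (\<lambda>y. y + f x) ` (rv -` {t2})" using fibs x by simp
    also have "\<dots> \<longleftrightarrow> rv (y - f x) = t2"
    proof
      assume "rv (y - f x) = t2"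
      thus "y \<in> (\<lambda>y. y + f x) ` (rv -` {t2})" by (intro image_eqI[of _ _ "y - f x"]) simp_all
    qed auto
    finally show ?thesis by (simp add: fib_def)
  qed
  have preimage: "z \<in> B1 \<and> (x, f z) \<in> A \<longleftrightarrow> rv (x - z) = t1" if x: "x \<in> B1" for x z
  proof -
    have "z \<in> {x' \<in> B1. f x' \<in> fib A x} \<longleftrightarrow> z \<in> (\<lambda>z. x - z) ` (rv -` {t1})"
      by (rule arg_cong[where f = "\<lambda>X. z \<in> X", OF conjunct2[OF bspec[OF fibs x]]])
    also have "\<dots> \<longleftrightarrow> rv (x - z) = t1"
    proof
      assume "rv (x - z) = t1"
      thus "z \<in> (\<lambda>z. x - z) ` (rv -` {t1})" by (intro image_eqI[of _ _ "x - z"]) simp_all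
    qed auto
    finally show ?thesis by (simp add: fib_def)
  qed
  have fib1: "rv (x - g y) = t1" if "(x, y) \<in> A" for x y
    using preimage[OF A_B1[OF that], of "g y"] that g_B1[OF A_B2[OF that]] fg[OF A_B2[OF that]] by simp
  have fib1': "(g y + w, y) \<in> A" if y: "y \<in> B2" and w: "rv w = t1" for y w
  proof -
    have z: "g y \<in> B1" by (rule g_B1[OF y])
    have "g y - w \<in> B1" using preimage[OF z, of "g y - w"] w by simp
    from open_ball_shift[OF B1 z z this] have "g y + w \<in> B1" by simp
    from preimage[OF this, of "g y"] w fg[OF y] show ?thesis by simp
  qed
  have graph: "(\<lambda>y. (g y, y)) ` snd ` A = (\<lambda>x. (x, f x)) ` fst ` A"
    unfolding B1_def[symmetric] B2_def[symmetric]
  proof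
    show "(\<lambda>y. (g y, y)) ` B2 \<subseteq> (\<lambda>x. (x, f x)) ` B1"
    proof (rule image_subsetI)
      fix y assume "y \<in> B2"
      thus "(g y, y) \<in> (\<lambda>x. (x, f x)) ` B1" by (intro image_eqI[of _ _ "g y"]) (simp_all add: fg g_B1)
    qed
    show "(\<lambda>x. (x, f x)) ` B1 \<subseteq> (\<lambda>y. (g y, y)) ` B2"
    proof (rule image_subsetI)
      fix x assume "x \<in> B1"
      thus "(x, f x) \<in> (\<lambda>y. (g y, y)) ` B2" by (intro image_eqI[of _ _ "f x"]) (simp_all add: gf f_B2)
    qed
  qed
  have mem_graph: "defin P (\<lambda>e d. (e i, e j) \<in> (\<lambda>x. (x, f x)) ` B1)" for i j
    using defin_mem_plane[OF f params_le_refl tf_var tf_var] by (simp add: B1_def)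
  have def_f: "definable_point P (f \<nu>)" if "\<nu> \<in> B1" "definable_point P \<nu>" for \<nu>
  proof (rule definable_lineI)
    have "defin P (\<lambda>e d. e 1 = \<nu> \<and> (e 1, e 0) \<in> (\<lambda>x. (x, f x)) ` B1)"
      by (intro defin_conj mem_graph defin_eq_point[OF that(2)] params_le_refl tf_var)
    from defin_exV[OF this, of 1]
    show "defin P (\<lambda>e d. \<exists>a. (e(1 := a)) 1 = \<nu> \<and> ((e(1 := a)) 1, (e(1 := a)) 0) \<in> (\<lambda>x. (x, f x)) ` B1)" .
  qed (use that(1) in auto)
  have def_g: "definable_point P (g \<nu>)" if "\<nu> \<in> B2" "definable_point P \<nu>" for \<nu>
  proof (rule definable_lineI)
    have "defin P (\<lambda>e d. e 1 = \<nu> \<and> (e 0, e 1) \<in> (\<lambda>x. (x, f x)) ` B1)"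
      by (intro defin_conj mem_graph defin_eq_point[OF that(2)] params_le_refl tf_var)
    from defin_exV[OF this, of 1]
    show "defin P (\<lambda>e d. \<exists>a. (e(1 := a)) 1 = \<nu> \<and> ((e(1 := a)) 0, (e(1 := a)) 1) \<in> (\<lambda>x. (x, f x)) ` B1)" .
    show "(\<exists>a. (e(1 := a)) 1 = \<nu> \<and> ((e(1 := a)) 0, (e(1 := a)) 1) \<in> (\<lambda>x. (x, f x)) ` B1) \<longleftrightarrow> e 0 \<in> {g \<nu>}"
      for e :: "nat \<Rightarrow> 'a" and d :: "nat \<Rightarrow> 'a set"
      using gf[of "e 0"] g_B1[OF that(1)] fg[OF that(1)] by auto
  qed
  \<comment> \<open>The centres are chosen such that \<open>f\<close> induces a map between the translated balls modulo \<open>rv\<close>.\<close>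
  have "\<exists>\<mu>1 \<mu>2. definable_point P \<mu>1 \<and> center B1 \<mu>1 \<and> definable_point P \<mu>2 \<and> center B2 \<mu>2 \<and>
      (\<forall>a\<in>B1. \<forall>b\<in>B1. rv (f a - \<mu>2) = rv (f b - \<mu>2) \<longleftrightarrow> rv (a - \<mu>1) = rv (b - \<mu>1)) \<and>
      (\<forall>a\<in>B1. f a = \<mu>2 \<longleftrightarrow> a = \<mu>1)"
  proof (cases "\<exists>\<nu>\<in>B1. definable_point P \<nu>")
    case True
    then obtain \<nu> where \<nu>: "\<nu> \<in> B1" "definable_point P \<nu>" by blast
    have lin: "f a - f b \<prec> f a - f \<nu> \<longleftrightarrow> a - b \<prec> a - \<nu>" if "a \<in> B1" "b \<in> B1" for a b
      using \<delta> that \<nu>(1) by (simp add: vlt_def Fin_plus_less_iff)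
    have "rv (f a - f \<nu>) = rv (f b - f \<nu>) \<longleftrightarrow> rv (a - \<nu>) = rv (b - \<nu>)" if "a \<in> B1" "b \<in> B1" for a b
      unfolding rv_eq_iff using lin[OF that] inj[OF that] by simp
    thus ?thesis
      using \<nu> def_f[OF \<nu>] center_of_member[OF B1 rv1 \<nu>(1)] center_of_member[OF B2 rv2 f_B2[OF \<nu>(1)]] inj
      by (intro exI[of _ \<nu>] exI[of _ "f \<nu>"]) simp
  next
    case False
    have "definable P 1 0 (line B1)" unfolding B1_def by (rule definable_fst[OF A])
    from ex_definable_center[OF this B1 rv1] False obtain \<mu>1 u1
      where 1: "definable_point P \<mu>1" "center B1 \<mu>1" "u1 \<noteq> 0" "\<forall>x\<in>B1. rv (x - \<mu>1) = rv u1" by blast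
    have "definable P 1 0 (line B2)" unfolding B2_def by (rule definable_snd[OF A])
    from ex_definable_center[OF this B2 rv2] False def_g g_B1 obtain \<mu>2 u2
      where 2: "definable_point P \<mu>2" "center B2 \<mu>2" "u2 \<noteq> 0" "\<forall>x\<in>B2. rv (x - \<mu>2) = rv u2" by blast
    have "a \<noteq> \<mu>1" "f a \<noteq> \<mu>2" if "a \<in> B1" for a
      using bspec[OF 1(4) that] bspec[OF 2(4) f_B2[OF that]] 1(3) 2(3) by auto
    thus ?thesis using 1 2 f_B2 by (intro exI[of _ \<mu>1] exI[of _ \<mu>2]) simp
  qed
  then obtain \<mu>1 \<mu>2 where \<mu>1: "definable_point P \<mu>1" "center B1 \<mu>1"
    and \<mu>2: "definable_point P \<mu>2" "center B2 \<mu>2"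
    and corr: "\<forall>a\<in>B1. \<forall>b\<in>B1. rv (f a - \<mu>2) = rv (f b - \<mu>2) \<longleftrightarrow> rv (a - \<mu>1) = rv (b - \<mu>1)"
    and corr0: "\<forall>a\<in>B1. f a = \<mu>2 \<longleftrightarrow> a = \<mu>1"
    by blast
  define E where "E = {((x, y), (x', y')). (x, y) \<in> A \<and> (x', y') \<in> A \<and> f x' = y}"
  show ?thesis
  proof (rule isomorphic_contractionsI[where l = g and l' = f and \<mu> = \<mu>2 and \<mu>' = \<mu>1 and E = E
        and ?s1.0 = s1 and ?s2.0 = s2, OF A s])
    show "definable P 2 0 (plane ((\<lambda>y. (g y, y)) ` snd ` A))" unfolding graph by (rule f)
    show "definable P 2 0 (plane ((\<lambda>x. (x, f x)) ` fst ` A))" by (rule f)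
    show "definable_point P \<mu>1" "definable_point P \<mu>2" by fact+
    show "contractible A g \<mu>2"
    proof (rule contractible_fibred[where B = B2 and t = t1 and s = s1])
      show "(x, y) \<in> A \<longleftrightarrow> y \<in> B2 \<and> rv (x - g y) = t1" for x y
        using fib1[of x y] fib1'[of y "x - g y"] A_B2[of x y] by auto
    qed (use s rv1 g_B1 \<mu>2 in auto)
    show "contractible (A\<inverse>) f \<mu>1"
    proof (rule contractible_fibred[where B = B1 and t = t2 and s = s2])
      show "(y, x) \<in> A\<inverse> \<longleftrightarrow> x \<in> B1 \<and> rv (y - f x) = t2" for x y
        using fib2[of x y] A_B1[of x y] by auto
    qed (use s rv2 f_B2 \<mu>1 in auto)
    show "defin P (\<lambda>e d. ((e 0, e 1), e 2, e 3) \<in> E)"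
    proof -
      have "defin P (\<lambda>e d. (e 0, e 1) \<in> A \<and> (e 2, e 3) \<in> A \<and> (e 2, e 1) \<in> (\<lambda>x. (x, f x)) ` B1)"
        by (intro defin_conj mem_graph defin_mem_plane[OF A] params_le_refl tf_var)
      moreover have "((e 0, e 1) \<in> A \<and> (e 2, e 3) \<in> A \<and> (e 2, e 1) \<in> (\<lambda>x. (x, f x)) ` B1)
          \<longleftrightarrow> ((e 0, e 1), e 2, e 3) \<in> E" for e :: "nat \<Rightarrow> 'a"
        using A_B1[of "e 2" "e 3"] by (auto simp: E_def)
      ultimately show ?thesis by (simp only:)
    qed
    show "E \<subseteq> A \<times> A" by (auto simp: E_def)
    show "\<exists>p'. (p, p') \<in> E" if p: "p \<in> A" for p
    proof -
      obtain x y where xy: "p = (x, y)" by fastforce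
      have "y \<in> B2" using p A_B2[of x y] by (simp add: xy)
      moreover obtain y' where "(g y, y') \<in> A" using B1_A[OF g_B1[OF \<open>y \<in> B2\<close>]] by blast
      ultimately have "(p, (g y, y')) \<in> E" using p fg[of y] by (simp add: E_def xy)
      thus ?thesis by blast
    qed
    show "\<exists>p q. (p, q) \<in> E \<and> (case q of (x, y) \<Rightarrow> [rv (x - \<mu>1), rv (y - f x), rv y, rv x])
        = (case p' of (x, y) \<Rightarrow> [rv (x - \<mu>1), rv (y - f x), rv y, rv x])" if p': "p' \<in> A" for p'
    proof -
      obtain x' y' where xy: "p' = (x', y')" by fastforce
      obtain x where "(x, f x') \<in> A" using B2_A[OF f_B2[OF A_B1[OF p'[unfolded xy]]]] by blast
      hence "((x, f x'), p') \<in> E" using p' by (simp add: E_def xy)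
      thus ?thesis by blast
    qed
    have inE: "\<exists>x y x' y'. p = (x, y) \<and> p' = (x', y') \<and> (x, y) \<in> A \<and> (x', y') \<in> A \<and> x' \<in> B1 \<and> f x' = y \<and> g y = x'"
      if "(p, p') \<in> E" for p p'
    proof -
      obtain x y x' y' where p: "p = (x, y)" "p' = (x', y')" "(x, y) \<in> A" "(x', y') \<in> A" "f x' = y"
        using \<open>(p, p') \<in> E\<close> by (auto simp: E_def)
      thus ?thesis using A_B1[OF p(4)] gf[OF A_B1[OF p(4)]] by auto
    qed
    show "(case p of (x, y) \<Rightarrow> [rv (x - g y), rv (y - \<mu>2), rv x, rv y])
          = (case q of (x, y) \<Rightarrow> [rv (x - g y), rv (y - \<mu>2), rv x, rv y])
        \<longleftrightarrow> (case p' of (x, y) \<Rightarrow> [rv (x - \<mu>1), rv (y - f x), rv y, rv x])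
          = (case q' of (x, y) \<Rightarrow> [rv (x - \<mu>1), rv (y - f x), rv y, rv x])"
      if pq: "(p, p') \<in> E" "(q, q') \<in> E" for p p' q q'
    proof -
      obtain x y x' y' where p: "p = (x, y)" "p' = (x', y')" "(x, y) \<in> A" "(x', y') \<in> A" "x' \<in> B1" "f x' = y"
        using inE[OF pq(1)] by blast
      obtain a b a' b' where q: "q = (a, b)" "q' = (a', b')" "(a, b) \<in> A" "(a', b') \<in> A" "a' \<in> B1" "f a' = b"
        using inE[OF pq(2)] by blast
      have "rv (y' - f x') = t2" "rv (b' - f a') = t2"
        using fib2[OF p(5), of y'] fib2[OF q(5), of b'] p(4) q(4) by simp_all
      thus ?thesis
        using corr[rule_format, OF p(5) q(5)] fib1[OF p(3)] fib1[OF q(3)] s[OF p(3)] s[OF q(3)] s[OF p(4)] s[OF q(4)]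
        by (simp add: p(1,2) q(1,2) p(6) q(6))
    qed
    show "length (filter (\<lambda>t. t \<noteq> RV_infty) (take 2 (case p of (x, y) \<Rightarrow> [rv (x - g y), rv (y - \<mu>2), rv x, rv y])))
        = length (filter (\<lambda>t. t \<noteq> RV_infty) (take 2 (case p' of (x, y) \<Rightarrow> [rv (x - \<mu>1), rv (y - f x), rv y, rv x])))"
      if pp': "(p, p') \<in> E" for p p'
    proof -
      obtain x y x' y' where p: "p = (x, y)" "p' = (x', y')" "(x, y) \<in> A" "(x', y') \<in> A" "x' \<in> B1" "f x' = y" "g y = x'"
        using inE[OF pp'] by blast
      have "rv (y' - f x') = t2" using fib2[OF p(5), of y'] p(4) by simp
      also have "t2 = rv (y - f x)" using fib2[OF A_B1[OF p(3)], of y] p(3) by simp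
      finally have "y' - f x' = 0 \<longleftrightarrow> y - f x = 0" by (metis rv_eq_zero_iff(1))
      also have "\<dots> \<longleftrightarrow> x - g y = 0" using inj[OF A_B1[OF p(3)] p(5)] p(6,7) by auto
      finally have 1: "y' = f x' \<longleftrightarrow> x = g y" by simp
      have 2: "y = \<mu>2 \<longleftrightarrow> x' = \<mu>1" using corr0 p(5,6) by blast
      show ?thesis
        using 1 2 by (cases "x = g y"; cases "x' = \<mu>1") (auto simp: p(1,2) numeral_2_eq_2)
    qed
  qed
qed

lemma vrv_rv: "vrv (rv x) = val x"
  unfolding vrv_def by (rule the_equality) (auto dest: val_cong_rv)

lemma rv_ball_shape: "B = rv -` {rv \<tau>} \<Longrightarrow> \<tau> \<noteq> 0 \<Longrightarrow> y \<in> B \<longleftrightarrow> y - \<tau> \<prec> \<tau>"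
  using rv_eq_iff[of \<tau> y] vlt_minus_commute[of \<tau> y \<tau>] by auto

text \<open>Unless \<open>A\<close> is balanced, all fibres coincide: this is clear if \<open>\<epsilon>\<close> is constant, and otherwise \<open>\<epsilon>\<close>
  varies within a ball whose radius is at least that of the fibres.\<close>

theorem isomorphic_contractions_two_cell:
  assumes "definable_two_cell P A"
  shows "isomorphic_contractions P A"
proof -
  obtain \<epsilon> t where A: "definable P 2 0 (plane A)" and cell: "two_cell_by A \<epsilon> t"
    and graph: "definable P 2 0 (plane ((\<lambda>a. (a, \<epsilon> a)) ` fst ` A))"
    using assms unfolding definable_two_cell_def by blast
  note cell' = cell[unfolded two_cell_by_def]
  obtain s1 s2 where s: "A \<subseteq> rv -` {s1} \<times> rv -` {s2}"
    using conjunct1[OF cell'] by blast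
  have rvA: "rv x = s1 \<and> rv y = s2" if "(x, y) \<in> A" for x y using subsetD[OF s that] by simp
  have base: "(\<exists>a. fst ` A = {a}) \<or> is_open_ball (fst ` A)"
    using conjunct1[OF conjunct2[OF cell']] by blast
  have t: "t \<in> RV" by (rule conjunct1[OF conjunct2[OF conjunct2[OF cell']]])
  have fibs: "\<forall>a\<in>fst ` A. fib A a = (\<lambda>y. y + \<epsilon> a) ` (rv -` {t})"
    by (rule conjunct1[OF conjunct2[OF conjunct2[OF conjunct2[OF cell']]]])
  have cases: "(\<exists>c. \<forall>a\<in>fst ` A. \<epsilon> a = c) \<or>
      (\<exists>b \<gamma>. \<epsilon> ` fst ` A = open_ball b \<gamma> \<and> vrv t \<le> Fin \<gamma>) \<or> balanced A \<epsilon>"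
    using conjunct2[OF conjunct2[OF conjunct2[OF conjunct2[OF cell']]]] by blast
  show ?thesis
  proof (cases "balanced A \<epsilon>")
    case True
    show ?thesis by (rule isomorphic_contractions_balanced[OF A rvA graph True])
  next
    case False
    obtain \<tau> where \<tau>: "t = rv \<tau>" using t by (auto simp: RV_def)
    have mem: "(x, y) \<in> A \<longleftrightarrow> x \<in> fst ` A \<and> rv (y - \<epsilon> x) = t" for x y
    proof (cases "x \<in> fst ` A")
      case x: True
      have "y \<in> fib A x \<longleftrightarrow> y \<in> (\<lambda>y. y + \<epsilon> x) ` (rv -` {t})"
        by (rule arg_cong[where f = "\<lambda>X. y \<in> X", OF bspec[OF fibs x]])
      also have "\<dots> \<longleftrightarrow> rv (y - \<epsilon> x) = t"
      proof
        assume "rv (y - \<epsilon> x) = t"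
        thus "y \<in> (\<lambda>y. y + \<epsilon> x) ` (rv -` {t})" by (intro image_eqI[of _ _ "y - \<epsilon> x"]) simp_all
      qed auto
      finally show ?thesis using x by (simp add: fib_def)
    next
      case False
      thus ?thesis using imageI[of "(x, y)" A fst] by auto
    qed
    have same: "rv (y - \<epsilon> x) = t \<longleftrightarrow> rv (y - \<epsilon> x') = t" if x: "x \<in> fst ` A" "x' \<in> fst ` A" for x x' y
      using cases False
    proof (elim disjE exE conjE)
      fix c assume c: "\<forall>a\<in>fst ` A. \<epsilon> a = c"
      show ?thesis by (simp only: bspec[OF c x(1)] bspec[OF c x(2)])
    next
      fix b \<gamma> assume ball: "\<epsilon> ` fst ` A = open_ball b \<gamma>" "vrv t \<le> Fin \<gamma>"
      obtain g where g: "val g = Fin \<gamma>" using val_surj by blast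
      have "\<tau> \<noteq> 0" and g\<tau>: "g \<preceq> \<tau>" using ball(2) g by (auto simp: \<tau> vrv_rv vle_def)
      have "\<epsilon> x \<in> open_ball b \<gamma>" "\<epsilon> x' \<in> open_ball b \<gamma>" using ball(1) x by blast+
      hence "\<epsilon> x - b \<prec> g" "\<epsilon> x' - b \<prec> g" by (simp_all add: open_ball_vlt[OF g])
      from vlt_diff[OF this] have "\<epsilon> x - \<epsilon> x' \<prec> g" by simp
      hence close: "\<epsilon> x - \<epsilon> x' \<prec> \<tau>" using g\<tau> by (rule vlt_vle_trans)
      have rv_t: "rv z = t \<longleftrightarrow> z - \<tau> \<prec> \<tau>" for z
        using rv_ball_shape[OF refl \<open>\<tau> \<noteq> 0\<close>, of z] by (simp add: \<tau>)
      have "y - \<epsilon> x' - \<tau> = (y - \<epsilon> x - \<tau>) + (\<epsilon> x - \<epsilon> x')" "y - \<epsilon> x - \<tau> = (y - \<epsilon> x' - \<tau>) - (\<epsilon> x - \<epsilon> x')"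
        by simp_all
      thus ?thesis unfolding rv_t using vlt_add[OF _ close] vlt_diff[OF _ close] by metis
    qed simp
    have "fst ` A \<noteq> {}"
      using base open_ball_nonempty by fastforce
    then obtain x0 where x0: "x0 \<in> fst ` A" by blast
    define B1 where "B1 = fst ` A"
    define B2 where "B2 = {y. rv (y - \<epsilon> x0) = t}"
    have prod: "A = B1 \<times> B2"
    proof (rule set_eqI)
      fix p :: "'a \<times> 'a"
      obtain x y where p: "p = (x, y)" by fastforce
      have "x \<in> fst ` A \<and> rv (y - \<epsilon> x) = t \<longleftrightarrow> x \<in> fst ` A \<and> rv (y - \<epsilon> x0) = t"
        using same[OF _ x0, of x y] by blast
      thus "p \<in> A \<longleftrightarrow> p \<in> B1 \<times> B2" unfolding p mem by (simp only: B1_def B2_def mem_Times_iff fst_conv snd_conv mem_Collect_eq)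
    qed
    have B2': "B2 = {\<epsilon> x0} \<or> is_open_ball B2"
    proof (cases "\<tau> = 0")
      case True
      thus ?thesis by (auto simp: B2_def \<tau>)
    next
      case nz: False
      obtain \<gamma> where \<gamma>: "val \<tau> = Fin \<gamma>" using val_nonzero[OF nz] by blast
      have "y \<in> B2 \<longleftrightarrow> y \<in> open_ball (\<epsilon> x0 + \<tau>) \<gamma>" for y
        using rv_ball_shape[OF refl nz, of "y - \<epsilon> x0"]
        by (simp add: B2_def \<tau> open_ball_vlt[OF \<gamma>] diff_diff_eq)
      hence "B2 = open_ball (\<epsilon> x0 + \<tau>) \<gamma>" by blast
      thus ?thesis by (auto simp: is_open_ball_def)
    qed
    have ne: "B1 \<noteq> {}" "B2 \<noteq> {}"
      using x0 B2' open_ball_nonempty[of B2] by (auto simp: B1_def)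
    have defs: "definable P 1 0 (line B1)" "definable P 1 0 (line B2)"
      using definable_fst[OF A] definable_snd[OF A] ne by (simp_all add: prod)
    have rv1: "rv x = s1" if "x \<in> B1" for x using rvA ne(2) that unfolding prod by blast
    have rv2: "rv y = s2" if "y \<in> B2" for y using rvA ne(1) that unfolding prod by blast
    have ctr: "\<exists>\<mu>. definable_point P \<mu> \<and> center B \<mu>"
      if "definable P 1 0 (line B)" "(\<exists>a. B = {a}) \<or> is_open_ball B" "\<And>x. x \<in> B \<Longrightarrow> rv x = s" for B s
      using that(2)
    proof
      assume "\<exists>a. B = {a}"
      thus ?thesis using that(1) center_singleton by auto
    next
      assume "is_open_ball B"
      from ex_definable_center[OF that(1) this that(3)] show ?thesis by blast
    qed
    obtain \<mu>1 where "definable_point P \<mu>1" "center B1 \<mu>1"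
      using ctr[OF defs(1) _ rv1] base unfolding B1_def by blast
    moreover obtain \<mu>2 where "definable_point P \<mu>2" "center B2 \<mu>2"
      using ctr[OF defs(2) _ rv2] B2' by blast
    ultimately show ?thesis
      using isomorphic_contractions_product[of P B1 B2 s1 s2 \<mu>1 \<mu>2] A rv1 rv2 unfolding prod by blast
  qed
qed

end

theorem lemma5p7:
  fixes val :: "'a::alg_closed_field \<Rightarrow> 'g::linordered_ab_group_add ext_val"
    and \<kappa> :: "'k rel"
    and S :: "'a params"
    and A :: "('a \<times> 'a) set"
  assumes "acvf_00 val"
    and "Card_order \<kappa>" and "(natLeq, \<kappa>) \<in> ordLess"
    and "valued.saturated val \<kappa>"
    and "valued.substructure val S"
    and "(card_of (fst S), \<kappa>) \<in> ordLess" and "(card_of (snd S), \<kappa>) \<in> ordLess"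
    and "valued.Gamma_nontrivial val S"
    and "valued.definable_two_cell val S A"
  shows "\<exists>l T l' R F.
      valued.standard_contraction val S [0, 1] 2 0 (valued.plane A) l T \<and>
      valued.standard_contraction val S [1, 0] 2 0 (valued.plane A) l' R \<and>
      valued.RV_iso val S 2
        l (T ` valued.plane A) (take 2)
        l' (R ` valued.plane A) (take 2) F"
proof -
  interpret acvf val by unfold_locales (rule assms(1))
  show ?thesis
    by (rule isomorphic_contractions_two_cell[OF assms(9), unfolded isomorphic_contractions_def])
qed

end
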